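(* Let $\delta,\lambda\in\mathbb{R}$ with $\lambda>0$. Let $\gamma\in H^2_{imm}([0,2\pi];\mathbb{R}^2)$ be parametrized proportional to arc length, i.e. $|\partial_x\gamma(x)|=L(\gamma)/(2\pi)$ for all $x\in[0,2\pi]$, let $\eta\in H^1_{per}([0,2\pi];\mathbb{R}^2)$, and suppose $\int_0^{2\pi}\gamma\,\mathrm{d}x=0$ and $\int_0^{2\pi}\eta\,\mathrm{d}x=0$. If $(\gamma,\eta)$ is a critical point of $E_{LM}$, then $\gamma,\eta\in C^\infty_{per}([0,2\pi];\mathbb{R}^2)$. Moreover, for every $k\in\mathbb{N}$ there exists a constant $C_k=C_k(\|\gamma\|_{H^2},\|\eta\|_{H^1})$, depending only on $\|\gamma\|_{H^2}$ and $\|\eta\|_{H^1}$ (and on $\delta,\lambda$), with $$\|\gamma\|_{W^{k+2,\infty}}+\|\eta\|_{W^{k+1,\infty}}\le C_k(\|\gamma\|_{H^2},\|\eta\|_{H^1}).$$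
   Context: Let $\langle\cdot,\cdot\rangle$ be the Euclidean inner product on $\mathbb{R}^2$ and $J$ the counterclockwise rotation by $\pi/2$. For $k\in\mathbb{N}=\{1,2,\dots\}$, $H^k_{per}([0,2\pi];\mathbb{R}^m)$ is the set of $f\in H^k([0,2\pi];\mathbb{R}^m)$ with $\partial_x^\ell f(0)=\partial_x^\ell f(2\pi)$ for $\ell=0,\dots,k-1$; $C^\infty_{per}$ is the set of $f\in C^\infty([0,2\pi];\mathbb{R}^2)$ with $\partial_x^\ell f(0)=\partial_x^\ell f(2\pi)$ for all $\ell\ge0$. $H^2_{imm}([0,2\pi];\mathbb{R}^2)$ is the set (open in $H^2_{per}$) of $\gamma\in H^2_{per}([0,2\pi];\mathbb{R}^2)$ with $\partial_x\gamma(x)\neq0$ for all $x$. For $\gamma\in H^2_{imm}$: $\partial_s=|\partial_x\gamma|^{-1}\partial_x$, $\tau=\partial_s\gamma$, $\nu=J\tau$, the curvature $\kappa$ is defined by $\partial_s\tau=\kappa\nu$, $\int_\gamma f\,\mathrm{d}s=\int_0^{2\pi}f|\partial_x\gamma|\,\mathrm{d}x$, and $L(\gamma)=\int_\gamma1\,\mathrm{d}s$. For $\eta\in H^1_{per}([0,2\pi];\mathbb{R}^2)$: $\operatorname{div}_\gamma\eta=\langle\partial_s\eta,\tau\rangle$ and $\nabla_\gamma\eta=\partial_s\eta\otimes\tau$ (so $|\nabla_\gamma\eta|=|\partial_s\eta|$). The energy is $$E_{LM}(\gamma,\eta)=\frac12\int_\gamma(\kappa+\delta\operatorname{div}_\gamma\eta)^2\,\mathrm{d}s+\frac\lambda2\int_\gamma|\nabla_\gamma\eta|^2\,\mathrm{d}s+L(\gamma).$$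 A pair $(\gamma,\eta)\in H^2_{imm}\times H^1_{per}$ is a critical point of $E_{LM}$ if $\frac{\mathrm d}{\mathrm d\varepsilon}\big|_{\varepsilon=0}E_{LM}(\gamma+\varepsilon\varphi,\eta)=0$ and $\frac{\mathrm d}{\mathrm d\varepsilon}\big|_{\varepsilon=0}E_{LM}(\gamma,\eta+\varepsilon\psi)=0$ for all $\varphi\in H^2_{per}([0,2\pi];\mathbb{R}^2)$ and $\psi\in H^1_{per}([0,2\pi];\mathbb{R}^2)$. *)

theory Defs
  imports "HOL-Analysis.Analysis" "HOL-Probability.Essential_Supremum"
begin

section \<open>Sobolev spaces on the interval\<close>

abbreviation I2pi :: "real set" where
  "I2pi \<equiv> {0..2 * pi}"

abbreviation leb :: "real measure" where
  "leb \<equiv> lebesgue_on I2pi"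

definition test_function :: "(real \<Rightarrow> real) \<Rightarrow> bool" where
  "test_function \<phi> \<longleftrightarrow>
     (\<forall>n x. (deriv ^^ n) \<phi> differentiable (at x)) \<and>
     (\<exists>a b. 0 < a \<and> b < 2 * pi \<and> (\<forall>x. x \<notin> {a..b} \<longrightarrow> \<phi> x = 0))"

definition has_weak_deriv ::
    "nat \<Rightarrow> (real \<Rightarrow> 'a::euclidean_space) \<Rightarrow> (real \<Rightarrow> 'a) \<Rightarrow> bool" where
  "has_weak_deriv l f g \<longleftrightarrow>
     integrable leb f \<and> integrable leb g \<and>
     (\<forall>\<phi>. test_function \<phi> \<longrightarrow>
        (LINT x|leb. (deriv ^^ l) \<phi> x *\<^sub>R f x) = (-1) ^ l *\<^sub>R (LINT x|leb. \<phi> x *\<^sub>R g x))"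

definition L2 :: "(real \<Rightarrow> 'a::euclidean_space) set" where
  "L2 = {g \<in> borel_measurable leb. integrable leb (\<lambda>x. (norm (g x))\<^sup>2)}"

definition Linf :: "(real \<Rightarrow> 'a::euclidean_space) set" where
  "Linf = {g \<in> borel_measurable leb. \<exists>C. AE x in leb. norm (g x) \<le> C}"

definition sobolev :: "(real \<Rightarrow> 'a::euclidean_space) set \<Rightarrow> nat \<Rightarrow> (real \<Rightarrow> 'a) set" where
  "sobolev X k = {f. \<forall>l\<le>k. \<exists>g\<in>X. has_weak_deriv l f g}"

text \<open>
  A weak derivative is determined only almost everywhere. The continuous representative on the
  closed interval is chosen whenever there is one; its values on the closed interval are then
  unique, which gives a meaning to pointwise conditions on derivatives of order below
  \<open>k\<close> of functions in \<open>H\<^sup>k\<close>. Values outside the interval are irrelevant throughout.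
\<close>

definition wderiv :: "nat \<Rightarrow> (real \<Rightarrow> 'a::euclidean_space) \<Rightarrow> real \<Rightarrow> 'a" where
  "wderiv l f = (SOME g. has_weak_deriv l f g \<and>
     ((\<exists>h. has_weak_deriv l f h \<and> continuous_on I2pi h) \<longrightarrow> continuous_on I2pi g))"

definition Hnorm :: "nat \<Rightarrow> (real \<Rightarrow> 'a::euclidean_space) \<Rightarrow> real" where
  "Hnorm k f = sqrt (\<Sum>l\<le>k. LINT x|leb. (norm (wderiv l f x))\<^sup>2)"

definition Winf_norm :: "nat \<Rightarrow> (real \<Rightarrow> 'a::euclidean_space) \<Rightarrow> ereal" where
  "Winf_norm k f = (\<Sum>l\<le>k. esssup leb (\<lambda>x. ereal (norm (wderiv l f x))))"

text \<open>For \<open>k \<ge> 1\<close>, elements of \<open>H\<^sup>k\<close> are identified with their continuous representatives.\<close>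

definition Hper :: "nat \<Rightarrow> (real \<Rightarrow> 'a::euclidean_space) set" where
  "Hper k = {f \<in> sobolev L2 k. continuous_on I2pi f \<and>
     (\<forall>l<k. wderiv l f 0 = wderiv l f (2 * pi))}"

text \<open>Classical derivative on the closed interval, one-sided at the end points.\<close>

definition cderiv :: "(real \<Rightarrow> 'a::euclidean_space) \<Rightarrow> real \<Rightarrow> 'a" where
  "cderiv f x = vector_derivative f (at x within I2pi)"

definition Cinf_per :: "(real \<Rightarrow> real^2) set" where
  "Cinf_per = {f. \<forall>l. (cderiv ^^ l) f differentiable_on I2pi \<and>
     (cderiv ^^ l) f 0 = (cderiv ^^ l) f (2 * pi)}"

definition Himm2 :: "(real \<Rightarrow> real^2) set" where
  "Himm2 = {\<gamma> \<in> Hper 2. \<forall>x\<in>I2pi. wderiv 1 \<gamma> x \<noteq> 0}"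

section \<open>Geometry of planar curves and the energy\<close>

definition rot :: "real^2 \<Rightarrow> real^2" where
  "rot v = vector [- (v $ 2), v $ 1]"

definition tensor :: "real^2 \<Rightarrow> real^2 \<Rightarrow> real^2^2" where
  "tensor u v = (\<chi> i j. u $ i * v $ j)"

definition ds :: "(real \<Rightarrow> real^2) \<Rightarrow> (real \<Rightarrow> real^2) \<Rightarrow> real \<Rightarrow> real^2" where
  "ds \<gamma> f x = inverse (norm (wderiv 1 \<gamma> x)) *\<^sub>R wderiv 1 f x"

definition tangent :: "(real \<Rightarrow> real^2) \<Rightarrow> real \<Rightarrow> real^2" where
  "tangent \<gamma> = ds \<gamma> \<gamma>"

definition normal :: "(real \<Rightarrow> real^2) \<Rightarrow> real \<Rightarrow> real^2" where
  "normal \<gamma> x = rot (tangent \<gamma> x)"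

text \<open>The defining equation of the curvature holds, with a unique solution, for almost every \<open>x\<close>.\<close>

definition curvature :: "(real \<Rightarrow> real^2) \<Rightarrow> real \<Rightarrow> real" where
  "curvature \<gamma> x = (THE c. ds \<gamma> (tangent \<gamma>) x = c *\<^sub>R normal \<gamma> x)"

definition curve_integral :: "(real \<Rightarrow> real^2) \<Rightarrow> (real \<Rightarrow> real) \<Rightarrow> real" where
  "curve_integral \<gamma> f = (LINT x|leb. f x * norm (wderiv 1 \<gamma> x))"

definition curve_length :: "(real \<Rightarrow> real^2) \<Rightarrow> real" where
  "curve_length \<gamma> = curve_integral \<gamma> (\<lambda>x. 1)"

definition curve_div :: "(real \<Rightarrow> real^2) \<Rightarrow> (real \<Rightarrow> real^2) \<Rightarrow> real \<Rightarrow> real" where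
  "curve_div \<gamma> \<eta> x = ds \<gamma> \<eta> x \<bullet> tangent \<gamma> x"

text \<open>The norm on \<^typ>\<open>real^2^2\<close> is the Frobenius norm.\<close>

definition curve_grad :: "(real \<Rightarrow> real^2) \<Rightarrow> (real \<Rightarrow> real^2) \<Rightarrow> real \<Rightarrow> real^2^2" where
  "curve_grad \<gamma> \<eta> x = tensor (ds \<gamma> \<eta> x) (tangent \<gamma> x)"

definition energy_LM ::
    "real \<Rightarrow> real \<Rightarrow> (real \<Rightarrow> real^2) \<Rightarrow> (real \<Rightarrow> real^2) \<Rightarrow> real" where
  "energy_LM \<delta> lam \<gamma> \<eta> =
     1/2 * curve_integral \<gamma> (\<lambda>x. (curvature \<gamma> x + \<delta> * curve_div \<gamma> \<eta> x)\<^sup>2)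
     + lam/2 * curve_integral \<gamma> (\<lambda>x. (norm (curve_grad \<gamma> \<eta> x))\<^sup>2)
     + curve_length \<gamma>"

definition critical_point_LM ::
    "real \<Rightarrow> real \<Rightarrow> (real \<Rightarrow> real^2) \<Rightarrow> (real \<Rightarrow> real^2) \<Rightarrow> bool" where
  "critical_point_LM \<delta> lam \<gamma> \<eta> \<longleftrightarrow>
     \<gamma> \<in> Himm2 \<and> \<eta> \<in> Hper 1 \<and>
     (\<forall>\<phi>\<in>Hper 2. ((\<lambda>\<epsilon>. energy_LM \<delta> lam (\<lambda>x. \<gamma> x + \<epsilon> *\<^sub>R \<phi> x) \<eta>)
        has_real_derivative 0) (at 0)) \<and>
     (\<forall>\<psi>\<in>Hper 1. ((\<lambda>\<epsilon>. energy_LM \<delta> lam \<gamma> (\<lambda>x. \<eta> x + \<epsilon> *\<^sub>R \<psi> x))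
        has_real_derivative 0) (at 0))"

end

theory Submission
  imports Defs
begin

text \<open>
  Write \<open>p = \<gamma>'\<close>, \<open>q = \<gamma>''\<close>, \<open>r = \<eta>'\<close>, \<open>|p| = c\<close>, \<open>p = c\<tau>\<close>, \<open>e = r/c\<close> and \<open>w = \<kappa> + \<delta> div \<eta>\<close>.
  The variation in \<open>\<eta>\<close> says that \<open>\<delta>w\<tau> + \<lambda>e\<close> is orthogonal to all functions of mean zero, hence is a
  constant \<open>a\<close>. The variation in \<open>\<gamma>\<close> says that \<open>(w/c)J\<tau>\<close> has the weak derivative \<open>F - m\<close>, where \<open>m\<close> is the mean of
  \<open>F = (1 - 3/2 w\<^sup>2 - \<lambda>/2 |e|\<^sup>2)\<tau> + \<delta>we\<close>. Both relations can be solved for the highest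
  derivatives, and \<open>(\<tau>, w)\<close> satisfies a polynomial ODE with the constants \<open>c\<close>, \<open>a\<close>, \<open>m\<close> as
  parameters; \<open>\<gamma>'\<close> and \<open>\<eta>'\<close> are polynomials in these quantities. So all derivatives of \<open>\<gamma>\<close> and
  \<open>\<eta>\<close> are polynomials in the periodic function \<open>(\<tau>, w)\<close> and in \<open>c\<close>, \<open>a\<close>, \<open>m\<close>.

  The bounds come from criticality under scaling, which gives
  \<open>\<integral> (w\<^sup>2/2 + \<lambda>|e|\<^sup>2/2) dx = 2\<pi>\<close>. Hence \<open>a\<close> and \<open>m\<close> are bounded in terms of
  \<open>\<delta>\<close> and \<open>\<lambda>\<close> alone and \<open>w\<close> in terms of \<open>c\<close>, which is at most the \<open>H\<^sup>2\<close> norm of \<open>\<gamma>\<close>; no lower bound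
  on the length is needed.
\<close>

section \<open>Smooth test functions\<close>

text \<open>All data are weak derivatives picked by \<open>wderiv\<close>, so they are first
  translated into \<open>ac\<close>: absolutely continuous functions with a given integrable
  derivative, for which product and chain rules are at hand. The two variations differ in kind. In
  the \<open>\<eta>\<close> direction the energy is an exact quadratic polynomial in the parameter;
  in the \<open>\<gamma>\<close> direction |p| stands in denominators, and differentiation under the
  integral needs an integrable majorant. Solving for the highest derivatives works because
  \<open>lam > 0\<close>: the tangential part of \<open>\<sigma> = a\<close> reads lam div =
  a.\<tau> - \<delta>w, so that \<kappa> = w - \<delta> div is affine in w. In w' the quadratic
  terms of F drop out, being tangential. Under \<gamma> -> s\<gamma> with \<eta> fixed, the first
  two energy terms scale like 1/s and the length like s; criticality at s = 1 therefore equates the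
  length with the sum of the other two, and division by c gives the stated identity. The inverse
  power of c in the constant of integration \<open>d\<close> is cancelled by |p| = c when
  \<open>W\<close> is formed.\<close>

fun Ck :: "nat \<Rightarrow> (real \<Rightarrow> real) \<Rightarrow> bool" where
  "Ck 0 f \<longleftrightarrow> True"
| "Ck (Suc n) f \<longleftrightarrow> (\<forall>x. f differentiable (at x)) \<and> Ck n (deriv f)"

definition smooth :: "(real \<Rightarrow> real) \<Rightarrow> bool" where
  "smooth f \<longleftrightarrow> (\<forall>n x. (deriv ^^ n) f differentiable (at x))"

text \<open>\<open>Ck\<close> peels the innermost \<open>deriv\<close>, which suits inductions with
  \<open>f\<close> arbitrary: the derivative of a product is again a sum of products. This
  translates to the iterates used in \<open>test_function\<close>.\<close>

lemma Ck_iff: "Ck n f \<longleftrightarrow> (\<forall>m<n. \<forall>x. (deriv ^^ m) f differentiable (at x))"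
proof (induction n arbitrary: f)
  case (Suc n)
  have "(\<forall>m<Suc n. P m) \<longleftrightarrow> P 0 \<and> (\<forall>m<n. P (Suc m))" for P :: "nat \<Rightarrow> bool"
    by (metis All_less_Suc2)
  then show ?case
    by (simp add: Suc funpow_Suc_right del: funpow.simps)
qed simp

lemma smooth_iff_Ck: "smooth f \<longleftrightarrow> (\<forall>n. Ck n f)"
  unfolding smooth_def Ck_iff by auto

lemma Ck_SucD: "Ck (Suc n) f \<Longrightarrow> Ck n f"
  by (simp add: Ck_iff)

lemma differentiable_deriv:
  fixes f :: "real \<Rightarrow> real"
  shows "f differentiable (at x) \<Longrightarrow> (f has_real_derivative deriv f x) (at x)"
  by (metis DERIV_imp_deriv real_differentiable_def)

lemma Ck_add: "Ck n f \<Longrightarrow> Ck n g \<Longrightarrow> Ck n (\<lambda>x. f x + g x)"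
proof (induction n arbitrary: f g)
  case (Suc n)
  have "deriv (\<lambda>x. f x + g x) = (\<lambda>x. deriv f x + deriv g x)"
    using Suc.prems by (intro ext DERIV_imp_deriv) (auto intro!: derivative_eq_intros differentiable_deriv)
  then show ?case
    using Suc by (auto intro: differentiable_add)
qed simp

lemma Ck_mult: "Ck n f \<Longrightarrow> Ck n g \<Longrightarrow> Ck n (\<lambda>x. f x * g x)"
proof (induction n arbitrary: f g)
  case (Suc n)
  have "deriv (\<lambda>x. f x * g x) = (\<lambda>x. deriv f x * g x + f x * deriv g x)"
    using Suc.prems by (intro ext DERIV_imp_deriv) (auto intro!: derivative_eq_intros differentiable_deriv)
  moreover have "Ck n f" "Ck n g"
    using Suc.prems Ck_SucD by blast+
  ultimately show ?case
    using Suc by (auto intro!: differentiable_mult Ck_add)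
qed simp

lemma Ck_const: "Ck n (\<lambda>x. c)"
proof (induction n arbitrary: c)
  case (Suc n)
  have "deriv (\<lambda>x::real. c) = (\<lambda>x. 0)" by auto
  then show ?case using Suc by auto
qed simp

lemma Ck_affine: "Ck n f \<Longrightarrow> Ck n (\<lambda>x. f (a * x + b))"
proof (induction n arbitrary: f)
  case (Suc n)
  have D: "((\<lambda>x. f (a * x + b)) has_real_derivative a * deriv f (a * x + b)) (at x)" for x
  proof -
    have "((\<lambda>x. a * x + b) has_real_derivative a) (at x)"
      by (auto intro!: derivative_eq_intros)
    moreover have "(f has_real_derivative deriv f (a * x + b)) (at (a * x + b))"
      using Suc.prems by (simp add: differentiable_deriv)
    ultimately show ?thesis
      using DERIV_chain2 by (metis mult.commute)
  qed
  then have "deriv (\<lambda>x. f (a * x + b)) = (\<lambda>x. a * deriv f (a * x + b))"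
    by (intro ext DERIV_imp_deriv)
  moreover have "Ck n (\<lambda>x. a * deriv f (a * x + b))"
    using Suc by (intro Ck_mult Ck_const) auto
  ultimately show ?case
    using D real_differentiable_def by auto
qed simp

lemma smooth_add: "smooth f \<Longrightarrow> smooth g \<Longrightarrow> smooth (\<lambda>x. f x + g x)"
  and smooth_mult: "smooth f \<Longrightarrow> smooth g \<Longrightarrow> smooth (\<lambda>x. f x * g x)"
  and smooth_const: "smooth (\<lambda>x. c)"
  and smooth_affine: "smooth f \<Longrightarrow> smooth (\<lambda>x. f (a * x + b))"
  by (auto simp: smooth_iff_Ck Ck_add Ck_mult Ck_const intro: Ck_affine)

lemma smooth_deriv: "smooth f \<Longrightarrow> smooth (deriv f)"
  unfolding smooth_def by (metis comp_apply funpow_Suc_right)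

lemma smooth_of_deriv:
  assumes "\<And>x. f differentiable (at x)" "smooth (deriv f)"
  shows "smooth f"
proof -
  have "Ck n f" for n
    using assms by (cases n) (simp_all add: smooth_iff_Ck)
  then show ?thesis by (simp add: smooth_iff_Ck)
qed

lemma smooth_DERIV: "smooth f \<Longrightarrow> (f has_real_derivative deriv f x) (at x)"
  by (metis smooth_def funpow_0 differentiable_deriv)

lemma smooth_continuous_on: "smooth f \<Longrightarrow> continuous_on A f"
  by (meson DERIV_continuous_on has_field_derivative_at_within smooth_DERIV)

text \<open>Every derivative of \<open>exp (-1/x)\<close> has the form \<open>p(1/x) exp (-1/x)\<close> with a polynomial \<open>p\<close>.\<close>

definition flat :: "real poly \<Rightarrow> real \<Rightarrow> real" where
  "flat p x = (if x > 0 then poly p (1 / x) * exp (- (1 / x)) else 0)"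

lemma poly_exp_tendsto_0: "((\<lambda>x::real. poly p x * exp (- x)) \<longlongrightarrow> 0) at_top"
proof -
  have "((\<lambda>x::real. \<Sum>i\<le>degree p. coeff p i * (x ^ i / exp x)) \<longlongrightarrow> (\<Sum>i\<le>degree p. coeff p i * 0)) at_top"
    by (intro tendsto_intros tendsto_power_div_exp_0)
  moreover have "(\<lambda>x::real. \<Sum>i\<le>degree p. coeff p i * (x ^ i / exp x)) = (\<lambda>x. poly p x * exp (- x))"
    by (simp add: poly_altdef exp_minus sum_distrib_right divide_inverse mult.assoc)
  ultimately show ?thesis by simp
qed

text \<open>With y = 1/x, differentiating p(y) exp(-y) in x gives (p(y) - p'(y)) y^2 exp(-y); the
  factor \<open>[:0, 0, 1:]\<close> is y^2. Only x = 0 needs an argument.\<close>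

lemma flat_DERIV:
  "(flat p has_real_derivative flat ((p - pderiv p) * [:0, 0, 1:]) x) (at x)"
proof -
  consider "x > 0" | "x < 0" | "x = 0" by linarith
  then show ?thesis
  proof cases
    case 1
    have "((\<lambda>x. poly p (1 / x) * exp (- (1 / x))) has_real_derivative
            flat ((p - pderiv p) * [:0, 0, 1:]) x) (at x)"
      using 1 by (auto intro!: derivative_eq_intros simp: flat_def field_simps power2_eq_square)
    then show ?thesis
      by (rule has_field_derivative_transform_within_open[where S = "{0<..}"]) (use 1 in \<open>auto simp: flat_def\<close>)
  next
    case 2
    have "((\<lambda>x. 0) has_real_derivative flat ((p - pderiv p) * [:0, 0, 1:]) x) (at x)"
      using 2 by (auto simp: flat_def)
    then show ?thesis
      by (rule has_field_derivative_transform_within_open[where S = "{..<0}"]) (use 2 in \<open>auto simp: flat_def\<close>)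
  next
    case 3
    have "((\<lambda>h. (flat p (0 + h) - flat p 0) / h) \<longlongrightarrow> 0) (at 0)"
      unfolding filterlim_at_split
    proof
      show "((\<lambda>h. (flat p (0 + h) - flat p 0) / h) \<longlongrightarrow> 0) (at_left 0)"
        by (rule tendsto_eventually) (auto simp: eventually_at_filter flat_def)
      \<comment> \<open>Dividing by h multiplies the polynomial by y = 1/h, and the exponential
        still wins.\<close>
      have "((\<lambda>h. poly (p * [:0, 1:]) (inverse h) * exp (- inverse h)) \<longlongrightarrow> 0) (at_right 0)"
        by (rule filterlim_compose[OF poly_exp_tendsto_0 filterlim_inverse_at_top_right])
      then show "((\<lambda>h. (flat p (0 + h) - flat p 0) / h) \<longlongrightarrow> 0) (at_right 0)"
        by (rule Lim_transform_eventually)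
          (auto simp: eventually_at_filter flat_def field_simps)
    qed
    then show ?thesis
      using 3 by (simp add: DERIV_def flat_def)
  qed
qed

lemma smooth_flat: "smooth (flat p)"
proof -
  have "Ck n (flat p)" for n
  proof (induction n arbitrary: p)
    case (Suc n)
    have "deriv (flat p) = flat ((p - pderiv p) * [:0, 0, 1:])"
      by (intro ext DERIV_imp_deriv flat_DERIV)
    then show ?case
      using Suc flat_DERIV real_differentiable_def by (simp del: mult_pCons_right) blast
  qed simp
  then show ?thesis by (simp add: smooth_iff_Ck)
qed

text \<open>The factor \<open>Suc n\<close> steepens both flanks, so the bumps stay in [0,1] and
  tend pointwise to the indicator of the open interval. No normalisation is involved, which makes
  the domination trivial later.\<close>

definition bump :: "real \<Rightarrow> real \<Rightarrow> nat \<Rightarrow> real \<Rightarrow> real" where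
  "bump a b n x = flat 1 (real (Suc n) * (x - a)) * flat 1 (real (Suc n) * (b - x))"

lemma smooth_bump: "smooth (bump a b n)"
proof -
  have "smooth (\<lambda>x. flat 1 (real (Suc n) * x + (- real (Suc n) * a)) *
      flat 1 ((- real (Suc n)) * x + real (Suc n) * b))"
    by (intro smooth_mult smooth_affine smooth_flat)
  moreover have "bump a b n = (\<lambda>x. flat 1 (real (Suc n) * x + (- real (Suc n) * a)) *
      flat 1 ((- real (Suc n)) * x + real (Suc n) * b))"
    unfolding bump_def by (intro ext arg_cong2[where f = "(*)"] arg_cong[where f = "flat 1"])
      (simp_all add: algebra_simps del: of_nat_Suc)
  ultimately show ?thesis by simp
qed

lemma bump_outside: "x \<notin> {a<..<b} \<Longrightarrow> bump a b n x = 0"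
  by (auto simp: bump_def flat_def zero_less_mult_iff not_less)

lemma bump_bounds: "0 \<le> bump a b n x" "bump a b n x \<le> 1"
  by (auto simp: bump_def flat_def zero_less_mult_iff intro!: mult_le_one)

lemma bump_tendsto: "(\<lambda>n. bump a b n x) \<longlonglongrightarrow> indicator {a<..<b} x"
proof (cases "x \<in> {a<..<b}")
  case True
  have *: "(\<lambda>n. flat 1 (real (Suc n) * c)) \<longlonglongrightarrow> 1" if "c > 0" for c
  proof -
    have "(\<lambda>n. exp (- ((1 / c) * (1 / real (Suc n))))) \<longlonglongrightarrow> exp (- ((1 / c) * 0))"
      using LIMSEQ_inverse_real_of_nat by (intro tendsto_intros) (simp add: inverse_eq_divide)
    moreover have "flat 1 (real (Suc n) * c) = exp (- ((1 / c) * (1 / real (Suc n))))" for n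
      using that by (simp add: flat_def zero_less_mult_iff divide_inverse mult.commute del: of_nat_Suc)
    ultimately show ?thesis by simp
  qed
  have "(\<lambda>n. bump a b n x) \<longlonglongrightarrow> 1 * 1"
    unfolding bump_def using True by (intro tendsto_mult *) auto
  then show ?thesis using True by simp
qed (simp add: bump_outside)

lemma test_function_alt:
  "test_function \<phi> \<longleftrightarrow> smooth \<phi> \<and> (\<exists>a b. 0 < a \<and> b < 2 * pi \<and> (\<forall>x. x \<notin> {a..b} \<longrightarrow> \<phi> x = 0))"
  by (simp add: test_function_def smooth_def)

lemma test_bump: "0 < a \<Longrightarrow> b < 2 * pi \<Longrightarrow> test_function (bump a b n)"
  unfolding test_function_alt using smooth_bump
  by (intro conjI exI[of _ a] exI[of _ b]) (auto intro!: bump_outside)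

lemma test_deriv: "test_function \<phi> \<Longrightarrow> test_function (deriv \<phi>)"
proof -
  assume "test_function \<phi>"
  then obtain a b where ab: "0 < a" "b < 2 * pi" "\<And>x. x \<notin> {a..b} \<Longrightarrow> \<phi> x = 0" and s: "smooth \<phi>"
    unfolding test_function_alt by blast
  have "deriv \<phi> x = 0" if "x \<notin> {a..b}" for x
  proof -
    have "((\<lambda>x. 0) has_real_derivative 0) (at x)" by simp
    then have "(\<phi> has_real_derivative 0) (at x)"
      by (rule has_field_derivative_transform_within_open[where S = "- {a..b}"])
        (use that ab in \<open>auto simp: open_Compl\<close>)
    then show ?thesis by (rule DERIV_imp_deriv)
  qed
  then have "\<forall>x. x \<notin> {a..b} \<longrightarrow> deriv \<phi> x = 0" by blast
  then show ?thesis
    unfolding test_function_alt using ab(1,2) smooth_deriv[OF s] by blast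
qed

lemma test_continuous: "test_function \<phi> \<Longrightarrow> continuous_on A \<phi>"
  by (simp add: test_function_alt smooth_continuous_on)

lemma test_ends: "test_function \<phi> \<Longrightarrow> \<phi> 0 = 0" "test_function \<phi> \<Longrightarrow> \<phi> (2 * pi) = 0"
  unfolding test_function_def by fastforce+

lemma test_lincomb:
  assumes "test_function \<phi>" "test_function \<psi>"
  shows "test_function (\<lambda>x. \<phi> x + c * \<psi> x)"
proof -
  obtain a b where 1: "0 < a" "b < 2 * pi" "\<And>x. x \<notin> {a..b} \<Longrightarrow> \<phi> x = 0" "smooth \<phi>"
    using assms(1) unfolding test_function_alt by blast
  obtain a' b' where 2: "0 < a'" "b' < 2 * pi" "\<And>x. x \<notin> {a'..b'} \<Longrightarrow> \<psi> x = 0" "smooth \<psi>"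
    using assms(2) unfolding test_function_alt by blast
  have "\<phi> x + c * \<psi> x = 0" if "x \<notin> {min a a'..max b b'}" for x
  proof -
    have "x \<notin> {a..b}" "x \<notin> {a'..b'}" using that by auto
    then show ?thesis using 1(3) 2(3) by simp
  qed
  moreover have "smooth (\<lambda>x. \<phi> x + c * \<psi> x)"
    by (intro smooth_add smooth_mult smooth_const 1 2)
  moreover have "0 < min a a'" "max b b' < 2 * pi" using 1 2 by auto
  ultimately show ?thesis
    unfolding test_function_alt by (intro conjI exI[of _ "min a a'"] exI[of _ "max b b'"]) auto
qed

text \<open>Mean zero is exactly the condition under which the primitive vanishes again to the right
  of the support.\<close>

lemma test_antideriv:
  assumes "test_function \<psi>" and int0: "integral {0..2 * pi} \<psi> = 0"
  obtains \<phi> where "test_function \<phi>" "deriv \<phi> = \<psi>"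
proof -
  obtain a b where ab: "0 < a" "b < 2 * pi" "\<And>x. x \<notin> {a..b} \<Longrightarrow> \<psi> x = 0" and s: "smooth \<psi>"
    using assms unfolding test_function_alt by blast
  note cont = smooth_continuous_on[OF s]
  define \<phi> where "\<phi> x = integral {0..x} \<psi>" for x
  \<comment> \<open>This includes negative \<open>x\<close>, where {0..x} is empty and the integral
    is 0.\<close>
  have \<phi>0: "\<phi> x = 0" if "x < a" for x
  proof -
    have "\<phi> x = integral {0..x} (\<lambda>x. 0)"
      unfolding \<phi>_def using that ab(3) by (intro integral_cong) auto
    then show ?thesis by simp
  qed
  have \<phi>1: "\<phi> x = 0" if "x > b" for x
  proof -
    have z: "integral {u..v} \<psi> = 0" if "b < u" for u v
    proof -
      have "integral {u..v} \<psi> = integral {u..v} (\<lambda>x. 0)"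
        using that ab(3) by (intro integral_cong) auto
      then show ?thesis by simp
    qed
    show ?thesis
    proof (cases "x \<le> 0 \<or> x < a")
      case True
      then show ?thesis using \<phi>0 ab by auto
    next
      case False
      \<comment> \<open>Both \<open>x\<close> and 2 pi lie beyond \<open>b\<close>. Extending each
        integral to the larger of the two adds nothing, so they agree whichever comes first.\<close>
      have "integral {0..x} \<psi> + integral {x..max x (2*pi)} \<psi> = integral {0..max x (2*pi)} \<psi>"
        using False by (intro Henstock_Kurzweil_Integration.integral_combine integrable_continuous_real cont) auto
      moreover have "integral {0..2*pi} \<psi> + integral {2*pi..max x (2*pi)} \<psi> = integral {0..max x (2*pi)} \<psi>"
        using False by (intro Henstock_Kurzweil_Integration.integral_combine integrable_continuous_real cont) auto
      ultimately show ?thesis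
        using z that ab int0 by (auto simp: \<phi>_def)
    qed
  qed
  have D: "(\<phi> has_real_derivative \<psi> x) (at x)" for x
  proof (cases "x < a")
    case True
    have "((\<lambda>x. 0) has_real_derivative \<psi> x) (at x)"
      using True ab by simp
    then show ?thesis
      by (rule has_field_derivative_transform_within_open[where S = "{..<a}"]) (use True \<phi>0 in auto)
  next
    case False
    then have "(\<phi> has_real_derivative \<psi> x) (at x within {0..x+1})"
      unfolding \<phi>_def using ab by (intro integral_has_real_derivative cont) auto
    then show ?thesis
      using False ab by (subst (asm) at_within_Icc_at) auto
  qed
  have d: "deriv \<phi> = \<psi>" by (intro ext DERIV_imp_deriv D)
  have "\<phi> differentiable (at x)" for x
    unfolding real_differentiable_def by (rule exI, rule D)
  then have "smooth \<phi>"
    using d s by (simp add: smooth_of_deriv)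
  then have "test_function \<phi>"
    unfolding test_function_alt using ab(1,2) \<phi>0 \<phi>1
    by (intro conjI exI[of _ a] exI[of _ b]) (auto simp: not_le)
  with d that show ?thesis by blast
qed

section \<open>Absolutely continuous functions\<close>

lemma I2pi_sets: "I2pi \<in> sets lebesgue"
  by simp

lemma integrable_leb_iff:
  fixes f :: "real \<Rightarrow> 'a::euclidean_space"
  shows "integrable leb f \<longleftrightarrow> f absolutely_integrable_on I2pi"
  unfolding set_integrable_def by (subst integrable_restrict_space) auto

lemma LINT_leb:
  fixes f :: "real \<Rightarrow> 'a::euclidean_space"
  shows "integrable leb f \<Longrightarrow> (LINT x|leb. f x) = integral I2pi f"
  by (rule lebesgue_integral_eq_integral) auto

lemma integrable_sub:
  fixes f :: "real \<Rightarrow> 'a::euclidean_space"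
  assumes "integrable leb f" "0 \<le> a" "b \<le> 2 * pi"
  shows "f absolutely_integrable_on {a..b}"
proof -
  have "f absolutely_integrable_on {a..b}" if "a \<le> b"
    using assms by (intro absolutely_integrable_on_subinterval[OF assms(1)[unfolded integrable_leb_iff]]) auto
  then show ?thesis
    by (cases "a \<le> b") (auto simp: set_integrable_def)
qed

lemma integrable_sub_hk:
  fixes f :: "real \<Rightarrow> 'a::euclidean_space"
  assumes "integrable leb f" "0 \<le> a" "b \<le> 2 * pi"
  shows "f integrable_on {a..b}" "(\<lambda>x. norm (f x)) integrable_on {a..b}"
  using integrable_sub[OF assms] by (auto simp: absolutely_integrable_on_def)

lemma AE_leb_iff: "(AE x in leb. P x) \<longleftrightarrow> negligible {x \<in> I2pi. \<not> P x}"
proof -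
  have "(AE x in leb. P x) \<longleftrightarrow> (AE x in lebesgue. x \<in> I2pi \<longrightarrow> P x)"
    by (subst AE_restrict_space_iff) simp_all
  also have "\<dots> \<longleftrightarrow> negligible {x \<in> I2pi. \<not> P x}"
    unfolding completion.AE_iff_null_sets negligible_iff_null_sets by simp
  finally show ?thesis .
qed

lemma AE_leb_I: "(\<And>x. x \<in> I2pi \<Longrightarrow> P x) \<Longrightarrow> AE x in leb. P x"
  by (rule AE_I2) simp

text \<open>Completeness of Lebesgue measure; extension by zero moves the question from
  \<open>leb\<close> to \<open>lebesgue\<close>.\<close>

lemma measurable_leb_cong_AE:
  fixes f :: "real \<Rightarrow> 'a::euclidean_space"
  assumes "f \<in> borel_measurable leb" "AE x in leb. f x = g x"
  shows "g \<in> borel_measurable leb"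
proof -
  have "AE x in lebesgue. x \<in> I2pi \<longrightarrow> f x = g x"
    using assms(2) by (subst (asm) AE_restrict_space_iff) auto
  then have AE: "AE x in lebesgue. (if x \<in> I2pi then f x else 0) = (if x \<in> I2pi then g x else 0)"
    by eventually_elim auto
  have "(\<lambda>x. if x \<in> I2pi then f x else 0) \<in> borel_measurable lebesgue"
    using assms(1) by (intro borel_measurable_if_I) auto
  from borel_measurable_AE[OF this AE] show ?thesis by (rule borel_measurable_if_D)
qed

lemma integrable_leb_cong_AE:
  fixes f :: "real \<Rightarrow> 'a::euclidean_space"
  assumes "AE x in leb. f x = g x" "integrable leb f"
  shows "integrable leb g"
proof -
  have "g \<in> borel_measurable leb"
    using borel_measurable_integrable[OF assms(2)] assms(1) by (rule measurable_leb_cong_AE)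
  then show ?thesis
    using assms by (subst integrable_cong_AE[of g leb f]) auto
qed

text \<open>Integrability passes across null sets, so in the non-integrable case both sides take the
  default value 0.\<close>

lemma integral_leb_cong_AE:
  fixes f :: "real \<Rightarrow> 'a::euclidean_space"
  assumes "AE x in leb. f x = g x"
  shows "(LINT x|leb. f x) = (LINT x|leb. g x)"
proof (cases "integrable leb f")
  case True
  then have "integrable leb g" by (rule integrable_leb_cong_AE[OF assms])
  with True assms show ?thesis
    by (intro integral_cong_AE) auto
next
  case False
  have "AE x in leb. g x = f x" using assms by auto
  with False have "\<not> integrable leb g" using integrable_leb_cong_AE[of g f] by blast
  with False show ?thesis by (simp add: not_integrable_integral_eq)
qed

lemma integral_sub_cong_AE:
  fixes f :: "real \<Rightarrow> 'a::euclidean_space"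
  assumes "AE x in leb. f x = g x" "0 \<le> a" "b \<le> 2 * pi"
  shows "integral {a..b} f = integral {a..b} g"
  by (rule integral_spike[OF assms(1)[unfolded AE_leb_iff]]) (use assms in auto)

lemma continuous_integrable_leb:
  fixes f :: "real \<Rightarrow> 'a::euclidean_space"
  shows "continuous_on I2pi f \<Longrightarrow> integrable leb f"
  by (simp add: integrable_leb_iff absolutely_integrable_continuous_real)

lemma continuous_measurable_leb:
  fixes f :: "real \<Rightarrow> 'a::euclidean_space"
  shows "continuous_on I2pi f \<Longrightarrow> f \<in> borel_measurable leb"
  by (rule borel_measurable_integrable[OF continuous_integrable_leb])

text \<open>The continuous function |f - g| has integral zero. This makes the continuous
  representative in \<open>wderiv\<close> unique, end points included.\<close>

lemma continuous_AE_eq: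
  fixes f :: "real \<Rightarrow> 'a::euclidean_space"
  assumes "continuous_on I2pi f" "continuous_on I2pi g" "AE x in leb. f x = g x" "x \<in> I2pi"
  shows "f x = g x"
proof -
  have "integral I2pi (\<lambda>x. norm (f x - g x)) = integral I2pi (\<lambda>x. 0)"
    by (rule integral_sub_cong_AE) (use assms(3) in auto)
  then have "((\<lambda>x. norm (f x - g x)) has_integral 0) I2pi"
    using integrable_integral[OF integrable_continuous_real, of 0 "2 * pi" "\<lambda>x. norm (f x - g x)"] assms(1,2)
    by (simp add: continuous_intros)
  then have "norm (f x - g x) = 0"
    using assms by (intro has_integral_0_cbox_imp_0[of 0 "2 * pi" "\<lambda>x. norm (f x - g x)"]) 
      (auto intro!: continuous_intros simp: not_le)
  then show ?thesis by simp
qed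

text \<open>This replaces Lebesgue differentiation in the product and chain rules below.\<close>

lemma constant_of_small_increments:
  fixes H :: "real \<Rightarrow> 'a::real_normed_vector" and G :: "real \<Rightarrow> real"
  assumes "a \<le> b"
    and small: "\<And>e. e > 0 \<Longrightarrow> \<exists>d>0. \<forall>x y. a \<le> x \<longrightarrow> x \<le> y \<longrightarrow> y \<le> b \<longrightarrow> y - x < d \<longrightarrow>
      norm (H y - H x) \<le> e * (G y - G x)"
  shows "H b = H a"
proof -
  have bound: "norm (H b - H a) \<le> e * (G b - G a)" if "e > 0" for e
  proof -
    obtain d where d: "d > 0" "\<And>x y. a \<le> x \<Longrightarrow> x \<le> y \<Longrightarrow> y \<le> b \<Longrightarrow> y - x < d \<Longrightarrow>
      norm (H y - H x) \<le> e * (G y - G x)"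
      using small[OF \<open>e > 0\<close>] by blast
    obtain N :: nat where N: "N > 0" "(b - a) / N < d"
      using reals_Archimedean2[of "(b - a) / d"] d(1) \<open>a \<le> b\<close>
      by (metis divide_nonneg_pos le_less_trans diff_ge_0_iff_ge of_nat_0_less_iff pos_divide_less_eq mult.commute)
    \<comment> \<open>Equidistant points of mesh below \<open>d\<close>; the increments of
      \<open>G\<close> telescope to G b - G a.\<close>
    define t where "t i = a + i * ((b - a) / N)" for i :: nat
    have step: "norm (H (t i) - H a) \<le> e * (G (t i) - G a)" if "i \<le> N" for i
      using that
    proof (induction i)
      case 0
      then show ?case by (simp add: t_def)
    next
      case (Suc i)
      have "t (Suc i) - t i = (b - a) / N"
        by (simp add: t_def algebra_simps add_divide_distrib diff_divide_distrib)
      moreover have "t (Suc i) \<le> t N"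
        using Suc.prems \<open>a \<le> b\<close> unfolding t_def
        by (intro add_left_mono mult_right_mono) auto
      moreover have "t N = b" using N by (simp add: t_def)
      moreover have "a \<le> t i" using \<open>a \<le> b\<close> by (simp add: t_def)
      ultimately have "norm (H (t (Suc i)) - H (t i)) \<le> e * (G (t (Suc i)) - G (t i))"
        using N \<open>a \<le> b\<close> by (intro d(2)) (auto simp: diff_le_eq algebra_simps)
      moreover have "norm (H (t (Suc i)) - H a) \<le> norm (H (t (Suc i)) - H (t i)) + norm (H (t i) - H a)"
        using norm_triangle_ineq[of "H (t (Suc i)) - H (t i)" "H (t i) - H a"] by simp
      moreover have "norm (H (t i) - H a) \<le> e * (G (t i) - G a)"
        using Suc by simp
      ultimately have "norm (H (t (Suc i)) - H a) \<le> e * (G (t (Suc i)) - G (t i)) + e * (G (t i) - G a)"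
        by linarith
      then show ?case by (simp add: algebra_simps)
    qed
    moreover have "t N = b" using N by (simp add: t_def)
    ultimately show ?thesis using step[of N] by simp
  qed
  have "norm (H b - H a) \<le> 0 + e" if "e > 0" for e
  proof -
    \<comment> \<open>The total increment of \<open>G\<close> may vanish, hence the added 1 in the
      denominator.\<close>
    have "norm (H b - H a) \<le> (e / (\<bar>G b - G a\<bar> + 1)) * (G b - G a)"
      using that by (intro bound) auto
    also have "\<dots> = e * ((G b - G a) / (\<bar>G b - G a\<bar> + 1))" by simp
    also have "\<dots> \<le> e * 1"
      using that by (intro mult_left_mono) (auto simp: divide_le_eq)
    finally show ?thesis by simp
  qed
  then have "norm (H b - H a) \<le> 0"
    using field_le_epsilon by blast
  then show ?thesis by simp
qed

text \<open>\<open>f\<close> is absolutely continuous on the interval with almost everywhere derivative \<open>g\<close>.\<close>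

definition ac :: "(real \<Rightarrow> 'a::euclidean_space) \<Rightarrow> (real \<Rightarrow> 'a) \<Rightarrow> bool" where
  "ac f g \<longleftrightarrow> integrable leb g \<and> (\<forall>x\<in>I2pi. f x = f 0 + integral {0..x} g)"

section \<open>Calculus of absolutely continuous functions\<close>

lemma ac_integrable: "ac f g \<Longrightarrow> integrable leb g"
  by (simp add: ac_def)

lemma ac_eq: "ac f g \<Longrightarrow> x \<in> I2pi \<Longrightarrow> f x = f 0 + integral {0..x} g"
  unfolding ac_def by blast

lemma ac_diff:
  assumes "ac f g" "0 \<le> x" "x \<le> y" "y \<le> 2 * pi"
  shows "f y - f x = integral {x..y} g"
proof -
  have "integral {0..x} g + integral {x..y} g = integral {0..y} g"
    using assms
    by (intro Henstock_Kurzweil_Integration.integral_combine integrable_sub_hk ac_integrable[OF assms(1)]) auto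
  moreover have "f x = f 0 + integral {0..x} g" "f y = f 0 + integral {0..y} g"
    using assms by (auto intro!: ac_eq)
  ultimately show ?thesis by (simp add: algebra_simps)
qed

lemma ac_I:
  assumes "integrable leb g" "\<And>x. x \<in> I2pi \<Longrightarrow> f x = c + integral {0..x} g"
  shows "ac f g"
proof -
  have "f 0 = c" using assms(2)[of 0] by simp
  then show ?thesis using assms unfolding ac_def by blast
qed

lemma ac_total:
  assumes "ac f g" shows "f (2 * pi) - f 0 = (LINT x|leb. g x)"
  using ac_diff[OF assms, of 0 "2 * pi"] LINT_leb[OF ac_integrable[OF assms]] by simp

lemma ac_norm_diff:
  assumes "ac f g" "0 \<le> x" "x \<le> y" "y \<le> 2 * pi"
  shows "norm (f y - f x) \<le> integral {x..y} (\<lambda>t. norm (g t))"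
  unfolding ac_diff[OF assms]
  using assms by (intro integral_norm_bound_integral integrable_sub_hk ac_integrable[OF assms(1)]) auto

lemma ac_continuous:
  assumes "ac f g" shows "continuous_on I2pi f"
proof -
  have "continuous_on I2pi (\<lambda>x. f 0 + integral {0..x} g)"
    by (intro continuous_intros indefinite_integral_continuous_1 integrable_sub_hk ac_integrable[OF assms]) auto
  then show ?thesis
    by (rule continuous_on_eq) (simp add: ac_eq[OF assms, symmetric])
qed

lemma ac_cong:
  assumes "ac f g" "\<And>x. x \<in> I2pi \<Longrightarrow> f' x = f x" "AE x in leb. g x = g' x"
  shows "ac f' g'"
proof (rule ac_I[where c = "f 0"])
  show "integrable leb g'"
    by (rule integrable_leb_cong_AE[OF assms(3) ac_integrable[OF assms(1)]])
  fix x :: real assume x: "x \<in> I2pi"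
  have "integral {0..x} g = integral {0..x} g'"
    using x by (intro integral_sub_cong_AE assms) auto
  then show "f' x = f 0 + integral {0..x} g'"
    using ac_eq[OF assms(1) x] assms(2)[OF x] by metis
qed

lemma ac_linear:
  assumes "ac f g" "bounded_linear h"
  shows "ac (\<lambda>x. h (f x)) (\<lambda>x. h (g x))"
proof (rule ac_I[where c = "h (f 0)"])
  show "integrable leb (\<lambda>x. h (g x))"
    by (rule integrable_bounded_linear[OF assms(2) ac_integrable[OF assms(1)]])
  fix x :: real assume x: "x \<in> I2pi"
  have "integral {0..x} (h \<circ> g) = h (integral {0..x} g)"
    using x by (intro integral_linear integrable_sub_hk ac_integrable[OF assms(1)] assms(2)) auto
  then show "h (f x) = h (f 0) + integral {0..x} (\<lambda>x. h (g x))"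
    using arg_cong[OF ac_eq[OF assms(1) x], of h]
    by (simp add: o_def linear_add[OF bounded_linear.linear[OF assms(2)]])
qed

lemma ac_add:
  assumes "ac f g" "ac f' g'"
  shows "ac (\<lambda>x. f x + f' x) (\<lambda>x. g x + g' x)"
proof (rule ac_I[where c = "f 0 + f' 0"])
  show "integrable leb (\<lambda>x. g x + g' x)"
    using ac_integrable[OF assms(1)] ac_integrable[OF assms(2)] by simp
  fix x :: real assume x: "x \<in> I2pi"
  have "integral {0..x} (\<lambda>x. g x + g' x) = integral {0..x} g + integral {0..x} g'"
    using x by (intro integral_add integrable_sub_hk ac_integrable[OF assms(1)] ac_integrable[OF assms(2)]) auto
  then show "f x + f' x = f 0 + f' 0 + integral {0..x} (\<lambda>x. g x + g' x)"
    using ac_eq[OF assms(1) x] ac_eq[OF assms(2) x] by (simp add: algebra_simps)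
qed

lemma ac_scaleR: "ac f g \<Longrightarrow> ac (\<lambda>x. c *\<^sub>R f x) (\<lambda>x. c *\<^sub>R g x)"
  by (rule ac_linear) (auto intro: bounded_linear_scaleR_right)

lemma ac_const: "ac (\<lambda>x. c) (\<lambda>x. 0)"
  by (rule ac_I[where c = c]) auto

lemma ac_primitive: "integrable leb g \<Longrightarrow> ac (\<lambda>x. c + integral {0..x} g) g"
  by (rule ac_I[where c = c]) auto

text \<open>The difference of \<open>f\<close> and the primitive of \<open>g\<close> has increments
  that are small relative to those of the primitive of \<open>G\<close>, uniformly on short
  intervals, so it is constant. Product and chain rule both reduce to this criterion.\<close>

lemma ac_small_remainder:
  fixes f g :: "real \<Rightarrow> 'a::euclidean_space" and G :: "real \<Rightarrow> real"
  assumes "integrable leb g" "integrable leb G"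
    and small: "\<And>e. e > 0 \<Longrightarrow> \<exists>d>0. \<forall>x y. 0 \<le> x \<longrightarrow> x \<le> y \<longrightarrow> y \<le> 2 * pi \<longrightarrow> y - x < d \<longrightarrow>
      norm (f y - f x - integral {x..y} g) \<le> e * integral {x..y} G"
  shows "ac f g"
proof (rule ac_I[where c = "f 0"])
  fix z :: real assume z: "z \<in> I2pi"
  have split: "integral {0..y} h - integral {0..x} h = integral {x..y} h"
    if "0 \<le> x" "x \<le> y" "y \<le> 2 * pi" "integrable leb h" for x y and h :: "real \<Rightarrow> 'b::euclidean_space"
    using Henstock_Kurzweil_Integration.integral_combine[of 0 x y h] that
    by (simp add: integrable_sub_hk algebra_simps)
  have "(\<lambda>x. f x - integral {0..x} g) z = (\<lambda>x. f x - integral {0..x} g) 0"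
  proof (rule constant_of_small_increments[where G = "\<lambda>x. integral {0..x} G"])
    show "0 \<le> z" using z by simp
    fix e :: real assume "e > 0"
    from small[OF this] obtain d where d: "d > 0" "\<And>x y. 0 \<le> x \<Longrightarrow> x \<le> y \<Longrightarrow> y \<le> 2 * pi \<Longrightarrow> y - x < d \<Longrightarrow>
      norm (f y - f x - integral {x..y} g) \<le> e * integral {x..y} G" by blast
    have "norm (f y - integral {0..y} g - (f x - integral {0..x} g)) \<le> e * (integral {0..y} G - integral {0..x} G)"
      if "0 \<le> x" "x \<le> y" "y \<le> z" "y - x < d" for x y
    proof -
      have "y \<le> 2 * pi" using that z by simp
      then have eq: "f y - integral {0..y} g - (f x - integral {0..x} g) = f y - f x - integral {x..y} g"
        using that split[OF _ _ _ assms(1), of x y] by (simp add: algebra_simps)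
      show ?thesis
        unfolding eq using d(2)[of x y] that \<open>y \<le> 2 * pi\<close> split[OF _ _ _ assms(2), of x y] by simp
    qed
    then show "\<exists>d>0. \<forall>x y. 0 \<le> x \<longrightarrow> x \<le> y \<longrightarrow> y \<le> z \<longrightarrow> y - x < d \<longrightarrow>
        norm (f y - integral {0..y} g - (f x - integral {0..x} g)) \<le> e * (integral {0..y} G - integral {0..x} G)"
      using d(1) by blast
  qed
  then show "f z = f 0 + integral {0..z} g" by (simp add: algebra_simps)
qed (use assms in auto)

lemma uniform_osc:
  fixes f :: "real \<Rightarrow> 'a::euclidean_space"
  assumes "continuous_on I2pi f" "e > 0"
  obtains d where "d > 0" "\<And>x y. x \<in> I2pi \<Longrightarrow> y \<in> I2pi \<Longrightarrow> \<bar>y - x\<bar> < d \<Longrightarrow> norm (f y - f x) < e"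
proof -
  have "uniformly_continuous_on I2pi f"
    by (rule compact_uniformly_continuous[OF assms(1) compact_Icc])
  then obtain d where "d > 0" "\<forall>x\<in>I2pi. \<forall>y\<in>I2pi. dist y x < d \<longrightarrow> dist (f y) (f x) < e"
    using assms(2) unfolding uniformly_continuous_on_def by blast
  then show thesis by (intro that[of d]) (simp_all add: dist_norm)
qed

lemma continuous_bounded_I2pi:
  fixes f :: "real \<Rightarrow> 'a::euclidean_space"
  assumes "continuous_on I2pi f"
  obtains B where "B > 0" "\<And>x. x \<in> I2pi \<Longrightarrow> norm (f x) \<le> B"
proof -
  have "bounded (f ` I2pi)"
    by (rule compact_imp_bounded[OF compact_continuous_image[OF assms compact_Icc]])
  then obtain B where "B > 0" "\<forall>y\<in>f ` I2pi. norm y \<le> B" unfolding bounded_pos by blast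
  then show thesis by (intro that[of B]) simp_all
qed

lemma integrable_prod_continuous:
  fixes f :: "real \<Rightarrow> 'a::euclidean_space" and g :: "real \<Rightarrow> 'b::euclidean_space"
    and prod :: "'a \<Rightarrow> 'b \<Rightarrow> 'c::euclidean_space"
  assumes "bounded_bilinear prod" "continuous_on I2pi f" "integrable leb g"
  shows "integrable leb (\<lambda>x. prod (f x) (g x))"
proof -
  have "bilinear prod" using assms(1) by (simp add: bilinear_conv_bounded_bilinear)
  moreover have "bounded (f ` I2pi)"
    by (rule compact_imp_bounded[OF compact_continuous_image[OF assms(2) compact_Icc]])
  ultimately show ?thesis
    unfolding integrable_leb_iff
    by (rule absolutely_integrable_bounded_measurable_product[OF _ continuous_measurable_leb[OF assms(2)] I2pi_sets _
          assms(3)[unfolded integrable_leb_iff]])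
qed

lemma ac_prod:
  fixes f f' :: "real \<Rightarrow> 'a::euclidean_space" and g g' :: "real \<Rightarrow> 'b::euclidean_space"
    and prod :: "'a \<Rightarrow> 'b \<Rightarrow> 'c::euclidean_space"
  assumes bl: "bounded_bilinear prod" and f: "ac f f'" and g: "ac g g'"
  shows "ac (\<lambda>x. prod (f x) (g x)) (\<lambda>x. prod (f' x) (g x) + prod (f x) (g' x))"
proof -
  interpret bounded_bilinear prod by fact
  note cf = ac_continuous[OF f] and cg = ac_continuous[OF g]
  note intf = ac_integrable[OF f] and intg = ac_integrable[OF g]
  have I1: "integrable leb (\<lambda>x. prod (f' x) (g x))"
    using integrable_prod_continuous[OF flip cg intf] by simp
  have I2: "integrable leb (\<lambda>x. prod (f x) (g' x))"
    using integrable_prod_continuous[OF bl cf intg] by simp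
  obtain K where K: "K > 0" "\<And>a b. norm (prod a b) \<le> norm a * norm b * K"
    using pos_bounded by blast
  show ?thesis
  proof (rule ac_small_remainder[where G = "\<lambda>t. norm (f' t) + norm (g' t)"])
    show "integrable leb (\<lambda>x. prod (f' x) (g x) + prod (f x) (g' x))" using I1 I2 by auto
    show "integrable leb (\<lambda>t. norm (f' t) + norm (g' t))" using intf intg by auto
    fix e :: real assume "e > 0"
    \<comment> \<open>The oscillation tolerance absorbs the norm \<open>K\<close> of the bilinear
      map.\<close>
    then have "e / K > 0" using K by simp
    obtain d1 where d1: "d1 > 0" "\<And>x y. x \<in> I2pi \<Longrightarrow> y \<in> I2pi \<Longrightarrow> \<bar>y - x\<bar> < d1 \<Longrightarrow> norm (f y - f x) < e / K"
      by (rule uniform_osc[OF cf \<open>e / K > 0\<close>]) blast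
    obtain d2 where d2: "d2 > 0" "\<And>x y. x \<in> I2pi \<Longrightarrow> y \<in> I2pi \<Longrightarrow> \<bar>y - x\<bar> < d2 \<Longrightarrow> norm (g y - g x) < e / K"
      by (rule uniform_osc[OF cg \<open>e / K > 0\<close>]) blast
    have "norm (prod (f y) (g y) - prod (f x) (g x) - integral {x..y} (\<lambda>x. prod (f' x) (g x) + prod (f x) (g' x)))
        \<le> e * integral {x..y} (\<lambda>t. norm (f' t) + norm (g' t))"
      if xy: "0 \<le> x" "x \<le> y" "y \<le> 2 * pi" "y - x < min d1 d2" for x y
    proof -
      note S = integrable_sub_hk[OF _ xy(1,3)]
      have A1: "integral {x..y} (\<lambda>t. prod (f' t) (g y)) = prod (f y - f x) (g y)"
        using integral_linear[OF S(1)[OF intf] bounded_linear_left, of "g y"] ac_diff[OF f xy(1-3)]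
        by (simp add: o_def)
      have A2: "integral {x..y} (\<lambda>t. prod (f x) (g' t)) = prod (f x) (g y - g x)"
        using integral_linear[OF S(1)[OF intg] bounded_linear_right, of "f x"] ac_diff[OF g xy(1-3)]
        by (simp add: o_def)
      have B1: "(\<lambda>t. prod (f' t) (g y)) integrable_on {x..y}"
        using integrable_linear[OF S(1)[OF intf] bounded_linear_left, of "g y"] by (simp add: o_def)
      have B2: "(\<lambda>t. prod (f x) (g' t)) integrable_on {x..y}"
        using integrable_linear[OF S(1)[OF intg] bounded_linear_right, of "f x"] by (simp add: o_def)
      have "prod (f y) (g y) - prod (f x) (g x) = prod (f y - f x) (g y) + prod (f x) (g y - g x)"
        by (simp add: diff_left diff_right)
      also have "\<dots> - integral {x..y} (\<lambda>x. prod (f' x) (g x) + prod (f x) (g' x)) =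
         integral {x..y} (\<lambda>t. (prod (f' t) (g y) + prod (f x) (g' t)) - (prod (f' t) (g t) + prod (f t) (g' t)))"
        unfolding A1[symmetric] A2[symmetric] integral_add[OF B1 B2, symmetric]
        using I1 I2 by (intro integral_diff[symmetric] integrable_add B1 B2 S(1)) auto
      also have "norm \<dots> \<le> integral {x..y} (\<lambda>t. e * (norm (f' t) + norm (g' t)))"
      proof (rule integral_norm_bound_integral)
        show "(\<lambda>t. (prod (f' t) (g y) + prod (f x) (g' t)) - (prod (f' t) (g t) + prod (f t) (g' t))) integrable_on {x..y}"
          using I1 I2 by (intro integrable_diff integrable_add B1 B2 S) auto
        show "(\<lambda>t. e * (norm (f' t) + norm (g' t))) integrable_on {x..y}"
          using intf intg by (intro S) auto
        fix t assume t: "t \<in> {x..y}"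
        have "norm (prod (f' t) (g y - g t)) \<le> norm (f' t) * (e / K) * K"
          using t xy K d2(2)[of t y]
          by (intro order_trans[OF K(2)] mult_right_mono mult_left_mono) auto
        moreover have "norm (prod (f t - f x) (g' t)) \<le> (e / K) * norm (g' t) * K"
          using t xy K d1(2)[of x t]
          by (intro order_trans[OF K(2)] mult_right_mono) auto
        moreover have eq: "(prod (f' t) (g y) + prod (f x) (g' t)) - (prod (f' t) (g t) + prod (f t) (g' t))
          = prod (f' t) (g y - g t) - prod (f t - f x) (g' t)"
          by (simp add: diff_left diff_right)
        ultimately show "norm ((prod (f' t) (g y) + prod (f x) (g' t)) - (prod (f' t) (g t) + prod (f t) (g' t)))
            \<le> e * (norm (f' t) + norm (g' t))"
          unfolding eq using K(1) norm_triangle_ineq4[of "prod (f' t) (g y - g t)" "prod (f t - f x) (g' t)"]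
          by (simp add: distrib_left mult.commute)
      qed
      also have "\<dots> = e * integral {x..y} (\<lambda>t. norm (f' t) + norm (g' t))" by simp
      finally show ?thesis .
    qed
    then show "\<exists>d>0. \<forall>x y. 0 \<le> x \<longrightarrow> x \<le> y \<longrightarrow> y \<le> 2 * pi \<longrightarrow> y - x < d \<longrightarrow>
      norm (prod (f y) (g y) - prod (f x) (g x) - integral {x..y} (\<lambda>x. prod (f' x) (g x) + prod (f x) (g' x)))
        \<le> e * integral {x..y} (\<lambda>t. norm (f' t) + norm (g' t))"
      using d1(1) d2(1) by (intro exI[of _ "min d1 d2"]) auto
  qed
qed

text \<open>The points \<open>a\<close> and \<open>b\<close> are values of a function along a curve,
  so their order is unknown and they may sit at the ends of the range; \<open>ac_chain\<close> needs
  the intermediate point to stay close to \<open>a\<close>.\<close>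

lemma mvt_between:
  fixes F F' :: "real \<Rightarrow> real"
  assumes F: "\<And>z. z \<in> {m..M} \<Longrightarrow> (F has_real_derivative F' z) (at z within {m..M})"
    and "a \<in> {m..M}" "b \<in> {m..M}"
  shows "\<exists>z\<in>{m..M}. \<bar>z - a\<bar> \<le> \<bar>b - a\<bar> \<and> F b - F a = F' z * (b - a)"
proof -
  have *: "\<exists>z. p < z \<and> z < q \<and> F q - F p = F' z * (q - p)"
    if pq: "p < q" "p \<in> {m..M}" "q \<in> {m..M}" for p q
  proof -
    have "(F has_derivative (*) (F' z)) (at z within {p..q})" if "p \<le> z" "z \<le> q" for z
      by (rule has_derivative_subset[OF F[unfolded has_field_derivative_def]]) (use pq that in auto)
    from mvt_simple[OF pq(1) this] show ?thesis by auto
  qed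
  consider "a < b" | "a = b" | "b < a" by linarith
  then show ?thesis
  proof cases
    case 1
    then obtain z where "a < z" "z < b" "F b - F a = F' z * (b - a)"
      using * assms(2,3) by blast
    then show ?thesis using assms(2,3) by (intro bexI[of _ z]) auto
  next
    case 2
    then show ?thesis using assms(2) by (intro bexI[of _ a]) auto
  next
    case 3
    then obtain z where z: "b < z" "z < a" "F a - F b = F' z * (a - b)"
      using * assms(2,3) by blast
    then have "F b - F a = F' z * (b - a)"
      by (simp add: right_diff_distrib)
    then show ?thesis using assms(2,3) z(1,2) by (intro bexI[of _ z]) auto
  qed
qed

text \<open>Same freezing idea: the mean value theorem writes the increment of F(u) as F'(z) times
  the integral of u', and uniform continuity of F' controls the replacement of z by u t.\<close>

lemma ac_chain:
  fixes u u' :: "real \<Rightarrow> real" and F F' :: "real \<Rightarrow> real"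
  assumes u: "ac u u'" and range: "\<And>x. x \<in> I2pi \<Longrightarrow> u x \<in> {m..M}"
    and F: "\<And>z. z \<in> {m..M} \<Longrightarrow> (F has_real_derivative F' z) (at z within {m..M})"
    and F': "continuous_on {m..M} F'"
  shows "ac (\<lambda>x. F (u x)) (\<lambda>x. F' (u x) * u' x)"
proof (rule ac_small_remainder[where G = "\<lambda>t. \<bar>u' t\<bar>"])
  note cu = ac_continuous[OF u] and intu = ac_integrable[OF u]
  have cFu: "continuous_on I2pi (\<lambda>x. F' (u x))"
    using range by (intro continuous_on_compose2[OF F' cu]) auto
  show int: "integrable leb (\<lambda>x. F' (u x) * u' x)"
    by (rule integrable_prod_continuous[OF bounded_bilinear_mult cFu intu])
  show "integrable leb (\<lambda>t. \<bar>u' t\<bar>)" using intu by auto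
  fix e :: real assume "e > 0"
  obtain d1 where d1: "d1 > 0" "\<And>z w. z \<in> {m..M} \<Longrightarrow> w \<in> {m..M} \<Longrightarrow> \<bar>z - w\<bar> < d1 \<Longrightarrow> \<bar>F' z - F' w\<bar> < e"
  proof -
    obtain d1 where "d1 > 0" "\<forall>x\<in>{m..M}. \<forall>y\<in>{m..M}. dist y x < d1 \<longrightarrow> dist (F' y) (F' x) < e"
      using compact_uniformly_continuous[OF F' compact_Icc] \<open>e > 0\<close>
      unfolding uniformly_continuous_on_def by blast
    then show thesis by (intro that[of d1]) (simp_all add: dist_real_def)
  qed
  \<comment> \<open>Both z and u t lie within d1/2 of u x, hence within d1 of each other.\<close>
  have "d1 / 2 > 0" using d1 by simp
  obtain d2 where d2: "d2 > 0" "\<And>x y. x \<in> I2pi \<Longrightarrow> y \<in> I2pi \<Longrightarrow> \<bar>y - x\<bar> < d2 \<Longrightarrow> norm (u y - u x) < d1 / 2"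
    by (rule uniform_osc[OF cu \<open>d1 / 2 > 0\<close>]) blast
  have "norm (F (u y) - F (u x) - integral {x..y} (\<lambda>x. F' (u x) * u' x)) \<le> e * integral {x..y} (\<lambda>t. \<bar>u' t\<bar>)"
    if xy: "0 \<le> x" "x \<le> y" "y \<le> 2 * pi" "y - x < d2" for x y
  proof -
    note S = integrable_sub_hk[OF _ xy(1,3)]
    have ux: "u x \<in> {m..M}" and uy: "u y \<in> {m..M}" using range xy by auto
    obtain z where z: "z \<in> {m..M}" "\<bar>z - u x\<bar> \<le> \<bar>u y - u x\<bar>" "F (u y) - F (u x) = F' z * (u y - u x)"
      using mvt_between[OF F ux uy] by blast
    have A: "integral {x..y} (\<lambda>t. F' z * u' t) = F (u y) - F (u x)"
      using z ac_diff[OF u xy(1-3)] by simp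
    have "F (u y) - F (u x) - integral {x..y} (\<lambda>x. F' (u x) * u' x) =
        integral {x..y} (\<lambda>t. F' z * u' t - F' (u t) * u' t)"
      unfolding A[symmetric] using int intu by (subst integral_diff) (auto intro!: S)
    also have "norm \<dots> \<le> integral {x..y} (\<lambda>t. e * \<bar>u' t\<bar>)"
    proof (rule integral_norm_bound_integral)
      show "(\<lambda>t. F' z * u' t - F' (u t) * u' t) integrable_on {x..y}"
        using int intu by (intro S) auto
      show "(\<lambda>t. e * \<bar>u' t\<bar>) integrable_on {x..y}" using intu by (intro S) auto
      fix t assume t: "t \<in> {x..y}"
      have "norm (u t - u x) < d1 / 2" "norm (u y - u x) < d1 / 2"
        using t xy d2(2)[of x t] d2(2)[of x y] by auto
      then have "\<bar>z - u t\<bar> < d1" using z(2) by (simp add: abs_if split: if_splits)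
      then have "\<bar>F' z - F' (u t)\<bar> < e"
        using t xy z range by (intro d1) auto
      moreover have "F' z * u' t - F' (u t) * u' t = (F' z - F' (u t)) * u' t" by (simp add: algebra_simps)
      ultimately show "norm (F' z * u' t - F' (u t) * u' t) \<le> e * \<bar>u' t\<bar>"
        by (simp add: abs_mult mult_right_mono)
    qed
    also have "\<dots> = e * integral {x..y} (\<lambda>t. \<bar>u' t\<bar>)" by simp
    finally show ?thesis .
  qed
  then show "\<exists>d>0. \<forall>x y. 0 \<le> x \<longrightarrow> x \<le> y \<longrightarrow> y \<le> 2 * pi \<longrightarrow> y - x < d \<longrightarrow>
      norm (F (u y) - F (u x) - integral {x..y} (\<lambda>x. F' (u x) * u' x)) \<le> e * integral {x..y} (\<lambda>t. \<bar>u' t\<bar>)"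
    using d2(1) by blast
qed

lemma ac_of_vector_derivative:
  fixes f g :: "real \<Rightarrow> 'a::euclidean_space"
  assumes "\<And>x. x \<in> I2pi \<Longrightarrow> (f has_vector_derivative g x) (at x within I2pi)" "continuous_on I2pi g"
  shows "ac f g"
proof (rule ac_I[where c = "f 0"])
  show "integrable leb g" by (rule continuous_integrable_leb[OF assms(2)])
  fix x :: real assume x: "x \<in> I2pi"
  have "(g has_integral (f x - f 0)) {0..x}"
    using x by (intro fundamental_theorem_of_calculus)
      (auto intro: has_vector_derivative_within_subset[OF assms(1)])
  then show "f x = f 0 + integral {0..x} g" by (simp add: integral_unique)
qed

lemma ac_vector_derivative:
  fixes f g :: "real \<Rightarrow> 'a::euclidean_space"
  assumes "ac f g" "continuous_on I2pi g" "x \<in> I2pi"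
  shows "(f has_vector_derivative g x) (at x within I2pi)"
proof -
  have "((\<lambda>y. f 0 + integral {0..y} g) has_vector_derivative 0 + g x) (at x within I2pi)"
    using assms by (intro derivative_intros integral_has_vector_derivative)
  then have "((\<lambda>y. f 0 + integral {0..y} g) has_vector_derivative g x) (at x within I2pi)"
    by simp
  then show ?thesis
    by (rule has_vector_derivative_transform[OF assms(3), rotated]) (rule ac_eq[OF assms(1)])
qed

section \<open>Weak derivatives\<close>

lemma indicator_measurable_leb:
  "A \<in> sets borel \<Longrightarrow> (indicator A :: real \<Rightarrow> real) \<in> borel_measurable leb"
  by (intro measurable_restrict_space1 borel_measurable_indicator) simp

text \<open>Two limits: bumps converge to the indicator of an interval, but are test functions only
  if it stays inside (0, 2 pi); general intervals are then exhausted by such ones up to the two end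
  points, a null set.\<close>

lemma integral_indicator_interval_0:
  fixes k :: "real \<Rightarrow> 'a::euclidean_space"
  assumes k: "integrable leb k" and test: "\<And>\<phi>. test_function \<phi> \<Longrightarrow> (LINT x|leb. \<phi> x *\<^sub>R k x) = 0"
  shows "(LINT x|leb. indicator {a<..<b} x *\<^sub>R k x) = 0"
proof -
  have km: "k \<in> borel_measurable leb" using k by simp
  have nk: "integrable leb (\<lambda>x. norm (k x))" using k by simp
  have inner: "(LINT x|leb. indicator {a<..<b} x *\<^sub>R k x) = 0" if "0 < a" "b < 2 * pi" for a b
  proof -
    have "(\<lambda>n. LINT x|leb. bump a b n x *\<^sub>R k x) \<longlonglongrightarrow> (LINT x|leb. indicator {a<..<b} x *\<^sub>R k x)"
    proof (rule integral_dominated_convergence[where w = "\<lambda>x. norm (k x)"])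
      show "(\<lambda>x. indicator {a<..<b} x *\<^sub>R k x) \<in> borel_measurable leb"
        using km by (intro borel_measurable_scaleR indicator_measurable_leb) auto
      show "(\<lambda>x. bump a b n x *\<^sub>R k x) \<in> borel_measurable leb" for n
        by (rule borel_measurable_scaleR[OF continuous_measurable_leb[OF smooth_continuous_on[OF smooth_bump]] km])
      show "AE x in leb. (\<lambda>n. bump a b n x *\<^sub>R k x) \<longlonglongrightarrow> indicator {a<..<b} x *\<^sub>R k x"
        by (intro AE_leb_I tendsto_scaleR bump_tendsto tendsto_const)
      show "AE x in leb. norm (bump a b n x *\<^sub>R k x) \<le> norm (k x)" for n
        using bump_bounds by (intro AE_leb_I) (simp add: mult_left_le_one_le)
    qed (fact nk)
    then show ?thesis
      using test[OF test_bump[OF that]] by (simp add: LIMSEQ_const_iff)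
  qed
  define A where "A n = {max a (inverse (real (Suc n)))<..<min b (2 * pi - inverse (real (Suc n)))}" for n
  have "(\<lambda>n. LINT x|leb. indicator (A n) x *\<^sub>R k x) \<longlonglongrightarrow> (LINT x|leb. indicator {a<..<b} x *\<^sub>R k x)"
  proof (rule integral_dominated_convergence[where w = "\<lambda>x. norm (k x)"])
    show "(\<lambda>x. indicator {a<..<b} x *\<^sub>R k x) \<in> borel_measurable leb"
      using km by (intro borel_measurable_scaleR indicator_measurable_leb) auto
    show "(\<lambda>x. indicator (A n) x *\<^sub>R k x) \<in> borel_measurable leb" for n
      using km by (intro borel_measurable_scaleR indicator_measurable_leb) (auto simp: A_def)
    have "AE x in leb. x \<notin> {0, 2 * pi}"
      unfolding AE_leb_iff by (rule negligible_subset[of "{0, 2 * pi}"]) auto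
    moreover have "AE x in leb. x \<in> I2pi" by (rule AE_leb_I)
    ultimately show "AE x in leb. (\<lambda>n. indicator (A n) x *\<^sub>R k x) \<longlonglongrightarrow> indicator {a<..<b} x *\<^sub>R k x"
    proof eventually_elim
      case (elim x)
      then have x: "0 < x" "x < 2 * pi" by auto
      have "\<forall>\<^sub>F n in sequentially. inverse (real (Suc n)) < min x (2 * pi - x)"
        using x by (intro order_tendstoD(2)[OF LIMSEQ_inverse_real_of_nat]) auto
      then have "\<forall>\<^sub>F n in sequentially. indicator {a<..<b} x *\<^sub>R k x = indicator (A n) x *\<^sub>R k x"
        by eventually_elim (auto simp: A_def indicator_def simp del: of_nat_Suc)
      then show ?case by (rule Lim_transform_eventually[OF tendsto_const])
    qed
    show "AE x in leb. norm (indicator (A n) x *\<^sub>R k x) \<le> norm (k x)" for n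
      by (intro AE_leb_I) (simp add: indicator_def)
  qed (fact nk)
  moreover have "(LINT x|leb. indicator (A n) x *\<^sub>R k x) = 0" for n
    unfolding A_def by (rule inner) (auto simp: min_less_iff_disj less_max_iff_disj simp del: of_nat_Suc)
  ultimately show ?thesis by (simp add: LIMSEQ_const_iff)
qed

text \<open>Dynkin's argument: open intervals form an intersection-stable generator of the Borel
  sets. The complement step needs the integral over the whole interval to vanish.\<close>

lemma integral_indicator_borel_0:
  fixes k :: "real \<Rightarrow> 'a::euclidean_space"
  assumes k: "integrable leb k" and test: "\<And>\<phi>. test_function \<phi> \<Longrightarrow> (LINT x|leb. \<phi> x *\<^sub>R k x) = 0"
    and "A \<in> sets borel"
  shows "set_lebesgue_integral leb A k = 0"
proof -
  define G where "G = range (\<lambda>(a::real, b). {a<..<b})"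
  have ball: "sets borel = sigma_sets UNIV G"
    unfolding G_def by (simp add: borel_eq_box box_real[abs_def])
  have I: "set_lebesgue_integral leb {a<..<b} k = 0" for a b :: real
    unfolding set_lebesgue_integral_def by (rule integral_indicator_interval_0[OF k test])
  have meas: "B \<inter> I2pi \<in> sets leb" if "B \<in> sets borel" for B
    using that by (subst sets_restrict_space_iff) (simp_all add: sets.Int)
  have restr: "indicator (B \<inter> I2pi) x *\<^sub>R k x = indicator B x *\<^sub>R k x" if "x \<in> I2pi" for B x
    using that by (simp add: indicator_def)
  have restr_int: "set_lebesgue_integral leb (B \<inter> I2pi) k = set_lebesgue_integral leb B k" for B
    unfolding set_lebesgue_integral_def by (rule Bochner_Integration.integral_cong) (use restr in auto)
  have si: "set_integrable leb (B \<inter> I2pi) k" if "B \<in> sets borel" for B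
    unfolding set_integrable_def using meas[OF that] k by (rule integrable_mult_indicator)
  have total: "(LINT x|leb. k x) = 0"
  proof -
    \<comment> \<open>Any open interval containing [0, 2 pi] would do; pi < 4 suffices for this
      one.\<close>
    have "(LINT x|leb. k x) = set_lebesgue_integral leb {-1<..<10} k"
      unfolding set_lebesgue_integral_def
      using pi_less_4 by (intro Bochner_Integration.integral_cong) (auto simp: indicator_def)
    then show ?thesis using I by simp
  qed
  have A: "A \<in> sigma_sets UNIV G" using assms(3) ball by simp
  have "Int_stable G"
    unfolding Int_stable_def G_def
  proof safe
    fix a b c d :: real
    have "{a<..<b} \<inter> {c<..<d} = {max a c<..<min b d}" by auto
    then show "{a<..<b} \<inter> {c<..<d} \<in> range (\<lambda>(a, b). {a<..<b})" by auto
  qed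
  then show ?thesis
    using subset_UNIV[of G, folded Pow_UNIV] A
  proof (induction rule: sigma_sets_induct_disjoint[consumes 3, case_names basic empty compl union])
    case (basic A)
    then show ?case using I by (auto simp: G_def)
  next
    case empty
    show ?case by (simp add: set_lebesgue_integral_def)
  next
    case (compl A)
    then have "A \<in> sets borel" using ball by simp
    have "set_lebesgue_integral leb (UNIV - A) k = (LINT x|leb. k x - indicator (A \<inter> I2pi) x *\<^sub>R k x)"
      unfolding set_lebesgue_integral_def
      by (intro Bochner_Integration.integral_cong) (auto simp: indicator_def)
    also have "\<dots> = (LINT x|leb. k x) - set_lebesgue_integral leb (A \<inter> I2pi) k"
      using si[OF \<open>A \<in> sets borel\<close>] k unfolding set_lebesgue_integral_def set_integrable_def
      by (intro Bochner_Integration.integral_diff)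
    finally show ?case using total compl restr_int[of A] by simp
  next
    case (union A)
    have A: "A i \<in> sets borel" for i using union ball by auto
    have "set_lebesgue_integral leb (\<Union>i. A i \<inter> I2pi) k = (\<Sum>i. set_lebesgue_integral leb (A i \<inter> I2pi) k)"
    proof (rule lebesgue_integral_countable_add)
      show "A i \<inter> I2pi \<in> sets leb" for i using meas A by blast
      show "(A i \<inter> I2pi) \<inter> (A j \<inter> I2pi) = {}" if "i \<noteq> j" for i j
        using union(1) that unfolding disjoint_family_on_def by blast
      have "(\<Union>i. A i \<inter> I2pi) = (\<Union>i. A i) \<inter> I2pi" by auto
      then show "set_integrable leb (\<Union>i. A i \<inter> I2pi) k" using si[of "\<Union>i. A i"] A by auto
    qed
    then show ?case
      using union(3) restr_int[of "\<Union>i. A i"] restr_int by simp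
  qed
qed

text \<open>The fundamental lemma of the calculus of variations: a function whose integral over
  every measurable set is zero vanishes almost everywhere, and a Lebesgue set is a Borel set up to a
  null set.\<close>

lemma weak_zero:
  fixes k :: "real \<Rightarrow> 'a::euclidean_space"
  assumes k: "integrable leb k" and test: "\<And>\<phi>. test_function \<phi> \<Longrightarrow> (LINT x|leb. \<phi> x *\<^sub>R k x) = 0"
  shows "AE x in leb. k x = 0"
proof -
  have "finite_measure leb"
    by (intro finite_measure_lebesgue_on) (metis cbox_interval lmeasurable_cbox)
  then interpret finite_measure leb .
  show ?thesis
  proof (rule density_zero[OF k])
    fix A assume "A \<in> sets leb"
    then have "A \<in> sets lebesgue" by (auto simp: sets_restrict_space)
    then obtain S N N' where SN: "A = S \<union> N" "N \<subseteq> N'" "N' \<in> null_sets lborel" "S \<in> sets lborel"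
      by (rule sets_completionE)
    have "negligible N'" using SN(3) null_sets_completionI negligible_iff_null_sets by blast
    then have "AE x in leb. x \<notin> N'"
      unfolding AE_leb_iff by (rule negligible_subset) auto
    then have "AE x in leb. indicator A x *\<^sub>R k x = indicator S x *\<^sub>R k x"
      by eventually_elim (use SN in \<open>auto simp: indicator_def\<close>)
    then have "set_lebesgue_integral leb A k = set_lebesgue_integral leb S k"
      unfolding set_lebesgue_integral_def by (rule integral_leb_cong_AE)
    also have "\<dots> = 0" using SN(4) by (intro integral_indicator_borel_0[OF k test]) auto
    finally show "set_lebesgue_integral leb A k = 0" .
  qed
qed

lemma integrable_test_scaleR:
  fixes f :: "real \<Rightarrow> 'a::euclidean_space"
  assumes "test_function \<phi>" "integrable leb f"
  shows "integrable leb (\<lambda>x. \<phi> x *\<^sub>R f x)"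
  by (rule integrable_prod_continuous[OF bounded_bilinear_scaleR test_continuous[OF assms(1)] assms(2)])

text \<open>The lemma of du Bois-Reymond. Subtracting a multiple of a fixed bump
  \<open>\<rho>\<close> makes any test function mean zero, hence the derivative of a test function;
  the constant is the \<open>\<rho>\<close>-weighted mean of \<open>k\<close>.\<close>

lemma weak_constant:
  fixes k :: "real \<Rightarrow> 'a::euclidean_space"
  assumes k: "integrable leb k" and test: "\<And>\<phi>. test_function \<phi> \<Longrightarrow> (LINT x|leb. deriv \<phi> x *\<^sub>R k x) = 0"
  shows "\<exists>c. AE x in leb. k x = c"
proof -
  \<comment> \<open>Any bump supported inside (0, 2 pi) serves; its integral is nonzero because it
    is positive at the midpoint 3/2.\<close>
  define \<rho> where "\<rho> = bump 1 2 0"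
  have \<rho>: "test_function \<rho>" unfolding \<rho>_def using pi_gt3 by (intro test_bump) auto
  define m where "m \<psi> = (LINT x|leb. \<psi> x)" for \<psi> :: "real \<Rightarrow> real"
  have itest: "integrable leb \<psi>" if "test_function \<psi>" for \<psi>
    using that by (intro continuous_integrable_leb test_continuous)
  have "m \<rho> \<noteq> 0"
  proof
    assume "m \<rho> = 0"
    then have "integral I2pi \<rho> = 0" using LINT_leb[OF itest[OF \<rho>]] by (simp add: m_def)
    then have "(\<rho> has_integral 0) I2pi"
      using integrable_integral[OF integrable_continuous_real[OF test_continuous[OF \<rho>]], of 0 "2 * pi"] by simp
    then have "\<rho> (3/2) = 0"
      using pi_gt3 by (intro has_integral_0_cbox_imp_0[of 0 "2 * pi" \<rho>])
        (use test_continuous[OF \<rho>] in \<open>auto simp: \<rho>_def bump_bounds\<close>)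
    then show False by (simp add: \<rho>_def bump_def flat_def)
  qed
  define c where "c = (LINT x|leb. \<rho> x *\<^sub>R k x) /\<^sub>R m \<rho>"
  have "AE x in leb. k x - c = 0"
  proof (rule weak_zero)
    show "integrable leb (\<lambda>x. k x - c)" using k by simp
    fix \<psi> assume \<psi>: "test_function \<psi>"
    define \<beta> where "\<beta> = - (m \<psi> / m \<rho>)"
    have t: "test_function (\<lambda>x. \<psi> x + \<beta> * \<rho> x)" by (rule test_lincomb[OF \<psi> \<rho>])
    have "(LINT x|leb. \<psi> x + \<beta> * \<rho> x) = m \<psi> + \<beta> * m \<rho>"
      unfolding m_def using itest[OF \<psi>] itest[OF \<rho>] by simp
    then have "integral I2pi (\<lambda>x. \<psi> x + \<beta> * \<rho> x) = 0"
      using \<open>m \<rho> \<noteq> 0\<close> LINT_leb[OF itest[OF t]] by (simp add: \<beta>_def)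
    then obtain \<phi> where \<phi>: "test_function \<phi>" "deriv \<phi> = (\<lambda>x. \<psi> x + \<beta> * \<rho> x)"
      by (rule test_antideriv[OF t])
    have "0 = (LINT x|leb. (\<psi> x + \<beta> * \<rho> x) *\<^sub>R k x)" using test[OF \<phi>(1)] \<phi>(2) by simp
    also have "\<dots> = (LINT x|leb. \<psi> x *\<^sub>R k x + \<beta> *\<^sub>R (\<rho> x *\<^sub>R k x))"
      by (simp add: scaleR_add_left)
    also have "\<dots> = (LINT x|leb. \<psi> x *\<^sub>R k x) + \<beta> *\<^sub>R (LINT x|leb. \<rho> x *\<^sub>R k x)"
      using integrable_test_scaleR[OF \<psi> k] integrable_test_scaleR[OF \<rho> k]
      by (subst Bochner_Integration.integral_add)
        (auto simp: integral_scaleR_right integrable_scaleR_right simp del: scaleR_scaleR)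
    also have "\<beta> *\<^sub>R (LINT x|leb. \<rho> x *\<^sub>R k x) = - (m \<psi> *\<^sub>R c)"
      by (simp add: c_def \<beta>_def divide_inverse)
    finally have *: "(LINT x|leb. \<psi> x *\<^sub>R k x) = m \<psi> *\<^sub>R c" by simp
    have "(LINT x|leb. \<psi> x *\<^sub>R (k x - c)) = (LINT x|leb. \<psi> x *\<^sub>R k x) - (LINT x|leb. \<psi> x *\<^sub>R c)"
      using integrable_test_scaleR[OF \<psi> k] itest[OF \<psi>]
      by (subst Bochner_Integration.integral_diff[symmetric]) (auto simp: scaleR_diff_right)
    also have "(LINT x|leb. \<psi> x *\<^sub>R c) = m \<psi> *\<^sub>R c"
      unfolding m_def using itest[OF \<psi>] by (intro integral_scaleR_left) auto
    finally show "(LINT x|leb. \<psi> x *\<^sub>R (k x - c)) = 0" using * by simp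
  qed
  then show ?thesis by auto
qed

lemma weak_integrable: "has_weak_deriv l f g \<Longrightarrow> integrable leb f" "has_weak_deriv l f g \<Longrightarrow> integrable leb g"
  by (simp_all add: has_weak_deriv_def)

lemma weak_unique:
  assumes "has_weak_deriv l f g" "has_weak_deriv l f h"
  shows "AE x in leb. g x = h x"
proof -
  have "AE x in leb. g x - h x = 0"
  proof (rule weak_zero)
    show "integrable leb (\<lambda>x. g x - h x)"
      by (rule Bochner_Integration.integrable_diff[OF weak_integrable(2)[OF assms(1)] weak_integrable(2)[OF assms(2)]])
    fix \<phi> assume \<phi>: "test_function \<phi>"
    have "(LINT x|leb. \<phi> x *\<^sub>R (g x - h x)) = (LINT x|leb. \<phi> x *\<^sub>R g x) - (LINT x|leb. \<phi> x *\<^sub>R h x)"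
      using integrable_test_scaleR[OF \<phi> weak_integrable(2)[OF assms(1)]]
        integrable_test_scaleR[OF \<phi> weak_integrable(2)[OF assms(2)]]
      by (subst Bochner_Integration.integral_diff[symmetric]) (auto simp: scaleR_diff_right)
    moreover have "(-1) ^ l *\<^sub>R (LINT x|leb. \<phi> x *\<^sub>R g x) = (-1) ^ l *\<^sub>R (LINT x|leb. \<phi> x *\<^sub>R h x)"
      using assms[unfolded has_weak_deriv_def, THEN conjunct2, THEN conjunct2, rule_format, OF \<phi>] by argo
    then have "(LINT x|leb. \<phi> x *\<^sub>R g x) = (LINT x|leb. \<phi> x *\<^sub>R h x)" by simp
    ultimately show "(LINT x|leb. \<phi> x *\<^sub>R (g x - h x)) = 0" by simp
  qed
  then show ?thesis by simp
qed

lemma weak_cong: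
  assumes "has_weak_deriv l f g" "AE x in leb. f x = f' x" "AE x in leb. g x = g' x"
  shows "has_weak_deriv l f' g'"
proof -
  have "(LINT x|leb. \<phi> x *\<^sub>R f x) = (LINT x|leb. \<phi> x *\<^sub>R f' x)" for \<phi> :: "real \<Rightarrow> real"
    by (rule integral_leb_cong_AE) (use assms(2) in auto)
  moreover have "(LINT x|leb. \<phi> x *\<^sub>R g x) = (LINT x|leb. \<phi> x *\<^sub>R g' x)" for \<phi> :: "real \<Rightarrow> real"
    by (rule integral_leb_cong_AE) (use assms(3) in auto)
  moreover have "integrable leb f'" by (rule integrable_leb_cong_AE[OF assms(2) weak_integrable(1)[OF assms(1)]])
  moreover have "integrable leb g'" by (rule integrable_leb_cong_AE[OF assms(3) weak_integrable(2)[OF assms(1)]])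
  ultimately show ?thesis
    using assms(1) unfolding has_weak_deriv_def by simp
qed

lemma weak_0: "integrable leb f \<Longrightarrow> has_weak_deriv 0 f f"
  by (simp add: has_weak_deriv_def)

lemma weak_Suc:
  assumes "has_weak_deriv l f g" "has_weak_deriv 1 g h"
  shows "has_weak_deriv (Suc l) f h"
proof -
  have "(LINT x|leb. (deriv ^^ Suc l) \<phi> x *\<^sub>R f x) = (-1) ^ Suc l *\<^sub>R (LINT x|leb. \<phi> x *\<^sub>R h x)"
    if \<phi>: "test_function \<phi>" for \<phi>
  proof -
    have "(LINT x|leb. (deriv ^^ Suc l) \<phi> x *\<^sub>R f x) = (-1) ^ l *\<^sub>R (LINT x|leb. deriv \<phi> x *\<^sub>R g x)"
      using assms(1) test_deriv[OF \<phi>] unfolding has_weak_deriv_def by (simp add: funpow_Suc_right del: funpow.simps)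
    also have "(LINT x|leb. deriv \<phi> x *\<^sub>R g x) = - (LINT x|leb. \<phi> x *\<^sub>R h x)"
      using assms(2) \<phi> unfolding has_weak_deriv_def by simp
    finally show ?thesis by simp
  qed
  then show ?thesis using assms by (simp add: has_weak_deriv_def)
qed

text \<open>\<open>deriv \<phi>\<close> is itself a test function, so it can be inserted into the
  identity of order \<open>l\<close>. This links \<open>wderiv 1\<close> and \<open>wderiv 2\<close>
  of the same function.\<close>

lemma weak_SucD:
  assumes "has_weak_deriv l f g" "has_weak_deriv (Suc l) f h"
  shows "has_weak_deriv 1 g h"
proof -
  have "(LINT x|leb. deriv \<phi> x *\<^sub>R g x) = - (LINT x|leb. \<phi> x *\<^sub>R h x)" if \<phi>: "test_function \<phi>" for \<phi>
  proof -
    have "(LINT x|leb. (deriv ^^ Suc l) \<phi> x *\<^sub>R f x) = (-1) ^ l *\<^sub>R (LINT x|leb. deriv \<phi> x *\<^sub>R g x)"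
      using assms(1) test_deriv[OF \<phi>] unfolding has_weak_deriv_def by (simp add: funpow_Suc_right del: funpow.simps)
    moreover have "(LINT x|leb. (deriv ^^ Suc l) \<phi> x *\<^sub>R f x) = (-1) ^ Suc l *\<^sub>R (LINT x|leb. \<phi> x *\<^sub>R h x)"
      using assms(2) \<phi> unfolding has_weak_deriv_def by blast
    ultimately have "(-1) ^ l *\<^sub>R (LINT x|leb. deriv \<phi> x *\<^sub>R g x) = (-1) ^ l *\<^sub>R (- (LINT x|leb. \<phi> x *\<^sub>R h x))"
      by simp
    then show ?thesis by (simp del: scaleR_minus_right)
  qed
  then show ?thesis using assms by (simp add: has_weak_deriv_def)
qed

lemma test_ac:
  assumes "test_function \<phi>" shows "ac \<phi> (deriv \<phi>)"
proof (rule ac_of_vector_derivative)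
  have "(\<phi> has_real_derivative deriv \<phi> x) (at x)" for x
    using assms by (simp add: smooth_DERIV test_function_alt)
  then show "(\<phi> has_vector_derivative deriv \<phi> x) (at x within I2pi)" for x
    unfolding has_real_derivative_iff_has_vector_derivative by (rule has_vector_derivative_at_within)
qed (rule test_continuous[OF test_deriv[OF assms]])

text \<open>Integration by parts; the boundary terms vanish because a test function is zero at both
  ends.\<close>

lemma ac_weak:
  assumes "ac f g" shows "has_weak_deriv 1 f g"
proof -
  note f = continuous_integrable_leb[OF ac_continuous[OF assms]] and g = ac_integrable[OF assms]
  have "(LINT x|leb. deriv \<phi> x *\<^sub>R f x) = - (LINT x|leb. \<phi> x *\<^sub>R g x)" if \<phi>: "test_function \<phi>" for \<phi>
  proof -
    have "(LINT x|leb. deriv \<phi> x *\<^sub>R f x) + (LINT x|leb. \<phi> x *\<^sub>R g x) =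
        (LINT x|leb. deriv \<phi> x *\<^sub>R f x + \<phi> x *\<^sub>R g x)"
      by (intro Bochner_Integration.integral_add[symmetric] integrable_test_scaleR \<phi> f g test_deriv)
    also have "\<dots> = 0"
      using ac_total[OF ac_prod[OF bounded_bilinear_scaleR test_ac[OF \<phi>] assms]] test_ends[OF \<phi>] by simp
    finally show ?thesis by (simp add: eq_neg_iff_add_eq_0)
  qed
  then show ?thesis using f g by (simp add: has_weak_deriv_def)
qed

text \<open>The difference of \<open>f\<close> and a primitive of \<open>g\<close> has weak
  derivative zero, so \<open>weak_constant\<close> applies.\<close>

lemma weak_ac_AE:
  assumes "has_weak_deriv 1 f g"
  obtains f' where "ac f' g" "AE x in leb. f x = f' x"
proof -
  note g = weak_integrable(2)[OF assms] and f = weak_integrable(1)[OF assms]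
  define F where "F x = 0 + integral {0..x} g" for x
  have F: "ac F g" unfolding F_def using g by (rule ac_primitive)
  note Fi = continuous_integrable_leb[OF ac_continuous[OF F]]
  obtain c where c: "AE x in leb. f x - F x = c"
  proof -
    have "\<exists>c. AE x in leb. f x - F x = c"
    proof (rule weak_constant)
      show "integrable leb (\<lambda>x. f x - F x)" using f Fi by simp
      fix \<phi> assume \<phi>: "test_function \<phi>"
      note d = test_deriv[OF \<phi>]
      have "(LINT x|leb. deriv \<phi> x *\<^sub>R (f x - F x)) = (LINT x|leb. deriv \<phi> x *\<^sub>R f x) - (LINT x|leb. deriv \<phi> x *\<^sub>R F x)"
        using integrable_test_scaleR[OF d f] integrable_test_scaleR[OF d Fi]
        by (subst Bochner_Integration.integral_diff[symmetric]) (auto simp: scaleR_diff_right)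
      also have "\<dots> = 0"
        using assms ac_weak[OF F] \<phi> by (simp add: has_weak_deriv_def)
      finally show "(LINT x|leb. deriv \<phi> x *\<^sub>R (f x - F x)) = 0" .
    qed
    then show thesis using that by blast
  qed
  have "ac (\<lambda>x. c + integral {0..x} g) g" by (rule ac_primitive[OF g])
  moreover have "AE x in leb. f x = c + integral {0..x} g"
    using c by eventually_elim (simp add: F_def algebra_simps)
  ultimately show thesis by (rule that)
qed

lemma weak_ac_continuous:
  assumes "has_weak_deriv 1 f g" "continuous_on I2pi f"
  shows "ac f g"
proof -
  obtain f' where f': "ac f' g" "AE x in leb. f x = f' x" by (rule weak_ac_AE[OF assms(1)])
  show ?thesis
    by (rule ac_cong[OF f'(1)]) (use continuous_AE_eq[OF assms(2) ac_continuous[OF f'(1)] f'(2)] in auto)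
qed

section \<open>The chosen derivative \<open>wderiv\<close> and the periodic spaces\<close>

lemma wderiv_props:
  assumes "has_weak_deriv l f g"
  shows "has_weak_deriv l f (wderiv l f)" "continuous_on I2pi g \<Longrightarrow> continuous_on I2pi (wderiv l f)"
proof -
  define Q where "Q g \<longleftrightarrow> has_weak_deriv l f g \<and>
     ((\<exists>h. has_weak_deriv l f h \<and> continuous_on I2pi h) \<longrightarrow> continuous_on I2pi g)" for g
  \<comment> \<open>The choice predicate is satisfiable either way: by a continuous weak derivative
    if there is one, and otherwise by \<open>g\<close>, the implication then being vacuous.\<close>
  have "\<exists>g. Q g"
  proof (cases "\<exists>h. has_weak_deriv l f h \<and> continuous_on I2pi h")
    case True
    then show ?thesis unfolding Q_def by blast
  next
    case False
    then show ?thesis unfolding Q_def using assms by blast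
  qed
  then have "Q (wderiv l f)"
    unfolding wderiv_def Q_def[symmetric] by (rule someI_ex)
  then show "has_weak_deriv l f (wderiv l f)" "continuous_on I2pi g \<Longrightarrow> continuous_on I2pi (wderiv l f)"
    unfolding Q_def using assms by blast+
qed

lemma wderiv_AE: "has_weak_deriv l f g \<Longrightarrow> AE x in leb. wderiv l f x = g x"
  by (rule weak_unique[OF wderiv_props(1)]; assumption)

lemma wderiv_eq:
  assumes "has_weak_deriv l f g" "continuous_on I2pi g" "x \<in> I2pi"
  shows "wderiv l f x = g x"
  by (rule continuous_AE_eq[OF wderiv_props(2)[OF assms(1,2)] assms(2) wderiv_AE[OF assms(1)] assms(3)])

lemma L2_measurable: "f \<in> L2 \<Longrightarrow> f \<in> borel_measurable leb"
  and L2_square: "f \<in> L2 \<Longrightarrow> integrable leb (\<lambda>x. (norm (f x))\<^sup>2)"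
  by (simp_all add: L2_def)

lemma integrable_leb_bound:
  fixes f :: "real \<Rightarrow> 'a::euclidean_space" and g :: "real \<Rightarrow> real"
  assumes "integrable leb g" "f \<in> borel_measurable leb" "\<And>x. x \<in> I2pi \<Longrightarrow> norm (f x) \<le> g x"
  shows "integrable leb f"
proof (rule Bochner_Integration.integrable_bound[OF assms(1,2)])
  show "AE x in leb. norm (f x) \<le> norm (g x)"
  proof (rule AE_leb_I)
    fix x assume "x \<in> I2pi"
    from assms(3)[OF this] show "norm (f x) \<le> norm (g x)" by simp
  qed
qed

lemma L2_I:
  fixes f :: "real \<Rightarrow> 'a::euclidean_space" and g :: "real \<Rightarrow> real"
  assumes "integrable leb g" "f \<in> borel_measurable leb" "\<And>x. x \<in> I2pi \<Longrightarrow> (norm (f x))\<^sup>2 \<le> g x"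
  shows "f \<in> L2"
proof -
  have "(\<lambda>x. (norm (f x))\<^sup>2) \<in> borel_measurable leb" using assms(2) by measurable
  then have "integrable leb (\<lambda>x. (norm (f x))\<^sup>2)"
    by (rule integrable_leb_bound[OF assms(1)]) (use assms(3) in simp)
  then show ?thesis using assms(2) by (simp add: L2_def)
qed

lemma continuous_L2:
  fixes f :: "real \<Rightarrow> 'a::euclidean_space"
  shows "continuous_on I2pi f \<Longrightarrow> f \<in> L2"
  by (simp add: L2_def continuous_measurable_leb continuous_integrable_leb continuous_on_power continuous_on_norm)

lemma L2_cong_AE:
  fixes f :: "real \<Rightarrow> 'a::euclidean_space"
  assumes "f \<in> L2" "AE x in leb. f x = g x"
  shows "g \<in> L2"
proof -
  have "AE x in leb. (norm (f x))\<^sup>2 = (norm (g x))\<^sup>2" using assms(2) by auto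
  then have "integrable leb (\<lambda>x. (norm (g x))\<^sup>2)" by (rule integrable_leb_cong_AE[OF _ L2_square[OF assms(1)]])
  moreover have "g \<in> borel_measurable leb" by (rule measurable_leb_cong_AE[OF L2_measurable[OF assms(1)] assms(2)])
  ultimately show ?thesis by (simp add: L2_def)
qed

lemma sobolev_wderiv:
  assumes "f \<in> sobolev L2 k" "l \<le> k"
  shows "has_weak_deriv l f (wderiv l f)" "wderiv l f \<in> L2"
proof -
  obtain g where g: "g \<in> L2" "has_weak_deriv l f g" using assms unfolding sobolev_def by blast
  show "has_weak_deriv l f (wderiv l f)" by (rule wderiv_props(1)[OF g(2)])
  have "AE x in leb. g x = wderiv l f x" using wderiv_AE[OF g(2)] by auto
  then show "wderiv l f \<in> L2" by (rule L2_cong_AE[OF g(1)])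
qed

lemma wderiv_0_eq:
  assumes "continuous_on I2pi f" "x \<in> I2pi" shows "wderiv 0 f x = f x"
  by (rule wderiv_eq[OF weak_0 assms(1,2)]) (rule continuous_integrable_leb[OF assms(1)])

lemma Hper1_D:
  assumes "f \<in> Hper 1"
  shows "ac f (wderiv 1 f)" "wderiv 1 f \<in> L2" "f 0 = f (2 * pi)"
proof -
  have s: "f \<in> sobolev L2 1" and c: "continuous_on I2pi f" and p: "wderiv 0 f 0 = wderiv 0 f (2 * pi)"
    using assms[unfolded Hper_def mem_Collect_eq] zero_less_one by blast+
  show "wderiv 1 f \<in> L2" using sobolev_wderiv(2)[OF s] by simp
  show "ac f (wderiv 1 f)" by (rule weak_ac_continuous[OF sobolev_wderiv(1)[OF s] c]) simp
  show "f 0 = f (2 * pi)" using p wderiv_0_eq[OF c, of 0] wderiv_0_eq[OF c, of "2 * pi"] by simp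
qed

text \<open>The first weak derivative agrees almost everywhere with an absolutely continuous
  function. So a continuous representative exists, \<open>wderiv\<close> picks it, and its values at
  single points make sense.\<close>

lemma Hper2_D:
  assumes "f \<in> Hper 2"
  shows "ac f (wderiv 1 f)" "ac (wderiv 1 f) (wderiv 2 f)" "wderiv 2 f \<in> L2"
    "f 0 = f (2 * pi)" "wderiv 1 f 0 = wderiv 1 f (2 * pi)"
proof -
  have s: "f \<in> sobolev L2 2" and c: "continuous_on I2pi f" and p: "\<And>l. l < 2 \<Longrightarrow> wderiv l f 0 = wderiv l f (2 * pi)"
    using assms[unfolded Hper_def mem_Collect_eq] by blast+
  have w1: "has_weak_deriv 1 f (wderiv 1 f)" and w2: "has_weak_deriv 2 f (wderiv 2 f)"
    using sobolev_wderiv(1)[OF s] by auto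
  show "wderiv 2 f \<in> L2" using sobolev_wderiv(2)[OF s] by simp
  show "ac f (wderiv 1 f)" by (rule weak_ac_continuous[OF w1 c])
  have w12: "has_weak_deriv 1 (wderiv 1 f) (wderiv 2 f)"
    by (rule weak_SucD[OF w1]) (use w2 in \<open>simp add: numeral_2_eq_2\<close>)
  obtain g where g: "ac g (wderiv 2 f)" "AE x in leb. wderiv 1 f x = g x" by (rule weak_ac_AE[OF w12])
  have "has_weak_deriv 1 f g" by (rule weak_cong[OF w1 _ g(2)]) simp
  then have "continuous_on I2pi (wderiv 1 f)" by (rule wderiv_props(2)[OF _ ac_continuous[OF g(1)]])
  then show "ac (wderiv 1 f) (wderiv 2 f)" by (rule weak_ac_continuous[OF w12])
  show "f 0 = f (2 * pi)" using p[of 0] wderiv_0_eq[OF c, of 0] wderiv_0_eq[OF c, of "2 * pi"] by simp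
  show "wderiv 1 f 0 = wderiv 1 f (2 * pi)" using p[of 1] by simp
qed

lemma Hper1_I:
  assumes "ac f g" "g \<in> L2" "f 0 = f (2 * pi)"
  shows "f \<in> Hper 1" "AE x in leb. wderiv 1 f x = g x"
proof -
  note c = ac_continuous[OF assms(1)] and w = ac_weak[OF assms(1)]
  have "\<exists>g\<in>L2. has_weak_deriv l f g" if "l \<le> 1" for l
  proof -
    have "l = 0 \<or> l = 1" using that by arith
    then consider "l = 0" | "l = 1" by blast
    then show ?thesis
      using weak_0[OF continuous_integrable_leb[OF c]] continuous_L2[OF c] w assms(2) by cases blast+
  qed
  then show "f \<in> Hper 1"
    unfolding Hper_def sobolev_def using c assms(3) wderiv_0_eq[OF c, of 0] wderiv_0_eq[OF c, of "2 * pi"] by simp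
  show "AE x in leb. wderiv 1 f x = g x" by (rule wderiv_AE[OF w])
qed

lemma Hper2_I:
  assumes "ac f g" "ac g h" "h \<in> L2" "f 0 = f (2 * pi)" "g 0 = g (2 * pi)"
  shows "f \<in> Hper 2" "\<And>x. x \<in> I2pi \<Longrightarrow> wderiv 1 f x = g x" "AE x in leb. wderiv 2 f x = h x"
proof -
  note c = ac_continuous[OF assms(1)] and w1 = ac_weak[OF assms(1)] and cg = ac_continuous[OF assms(2)]
  have w2: "has_weak_deriv 2 f h" using weak_Suc[OF w1 ac_weak[OF assms(2)]] by (simp add: numeral_2_eq_2)
  have "\<exists>g\<in>L2. has_weak_deriv l f g" if "l \<le> 2" for l
  proof -
    have "l = 0 \<or> l = 1 \<or> l = 2" using that by arith
    then consider "l = 0" | "l = 1" | "l = 2" by blast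
    then show ?thesis
      using weak_0[OF continuous_integrable_leb[OF c]] continuous_L2[OF c] w1 w2 assms(3) continuous_L2[OF cg]
      by cases blast+
  qed
  moreover show eq: "wderiv 1 f x = g x" if "x \<in> I2pi" for x by (rule wderiv_eq[OF w1 cg that])
  moreover have "wderiv l f 0 = wderiv l f (2 * pi)" if "l < 2" for l
  proof -
    have "l = 0 \<or> l = 1" using that by arith
    then consider "l = 0" | "l = 1" by blast
    then show ?thesis
      using eq[of 0] eq[of "2 * pi"] wderiv_0_eq[OF c, of 0] wderiv_0_eq[OF c, of "2 * pi"] assms(4,5)
      by cases simp_all
  qed
  ultimately show "f \<in> Hper 2"
    unfolding Hper_def sobolev_def using c by blast
  show "AE x in leb. wderiv 2 f x = h x" by (rule wderiv_AE[OF w2])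
qed

section \<open>The energy as an integral of a Lagrangian\<close>

lemma inner2: "(u::real^2) \<bullet> v = u $ 1 * v $ 1 + u $ 2 * v $ 2"
  by (simp add: inner_vec_def sum_2)

lemma rot_nth [simp]: "rot v $ 1 = - (v $ 2)" "rot v $ 2 = v $ 1"
  by (simp_all add: rot_def vector_2)

lemma vec2_eq_iff: "(u::real^2) = v \<longleftrightarrow> u $ 1 = v $ 1 \<and> u $ 2 = v $ 2"
  by (simp add: vec_eq_iff forall_2)

lemma rot_add: "rot (u + v) = rot u + rot v"
  and rot_scaleR: "rot (c *\<^sub>R u) = c *\<^sub>R rot u"
  by (simp_all add: vec2_eq_iff)

lemma inner_rot_rot: "rot u \<bullet> rot v = u \<bullet> v"
  and inner_rot_self: "u \<bullet> rot u = 0"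
  and inner_rot_left: "rot u \<bullet> v = - (u \<bullet> rot v)"
  by (simp_all add: inner2)

lemma norm_rot [simp]: "norm (rot v) = norm v"
  by (simp add: norm_eq_sqrt_inner inner_rot_rot)

lemma bounded_linear_rot: "bounded_linear rot"
  by (rule bounded_linear_intro[where K = 1]) (simp_all add: rot_add rot_scaleR)

lemma rot_measurable [measurable]: "rot \<in> borel_measurable borel"
  by (rule borel_measurable_continuous_onI[OF linear_continuous_on[OF bounded_linear_rot]])

lemma norm_tensor_sq: "(norm (tensor u v))\<^sup>2 = (norm u)\<^sup>2 * (norm v)\<^sup>2"
  unfolding power2_norm_eq_inner
  by (simp add: tensor_def inner_vec_def sum_2 algebra_simps power2_eq_square)

lemma norm_sq_vec2: "(norm (p::real^2))\<^sup>2 = p $ 1 * p $ 1 + p $ 2 * p $ 2"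
  unfolding power2_norm_eq_inner by (simp add: inner2)

text \<open>The left side is the arc length derivative of p/|p| when p' = q. It rests on expanding q
  in the orthogonal basis p, Jp: |p|^2 q - (p.q) p = (q.Jp) Jp.\<close>

lemma curvature_algebra:
  fixes p q :: "real^2"
  assumes "p \<noteq> 0"
  shows "inverse (norm p) *\<^sub>R ((- (p \<bullet> q) / norm p ^ 3) *\<^sub>R p + inverse (norm p) *\<^sub>R q)
    = ((q \<bullet> rot p) / norm p ^ 3) *\<^sub>R rot (inverse (norm p) *\<^sub>R p)"
proof -
  define n where "n = norm p"
  have n: "n \<noteq> 0" "n * n = p $ 1 * p $ 1 + p $ 2 * p $ 2"
    using assms norm_sq_vec2[of p] by (auto simp: n_def power2_eq_square)
  have e: "inverse n * ((- (p \<bullet> q) / n ^ 3) * a + inverse n * b) = (n * n * b - (p \<bullet> q) * a) / n ^ 4" for a b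
    using n(1) by (simp add: field_simps power_numeral_reduce)
  have e2: "((q \<bullet> rot p) / n ^ 3) * (inverse n * a) = (q \<bullet> rot p) * a / n ^ 4" for a
    using n(1) by (simp add: field_simps power_numeral_reduce)
  have "n * n * q $ 1 - (p \<bullet> q) * p $ 1 = (q \<bullet> rot p) * (- (p $ 2))"
    "n * n * q $ 2 - (p \<bullet> q) * p $ 2 = (q \<bullet> rot p) * p $ 1"
    unfolding n(2) by (simp_all add: inner2 algebra_simps)
  then show ?thesis
    unfolding n_def[symmetric] vec2_eq_iff rot_scaleR
    by (simp only: vector_add_component vector_scaleR_component rot_nth real_scaleR_def e e2)
qed

text \<open>For p, q, r the derivatives \<gamma>', \<gamma>'', \<eta>' this is \<kappa> + \<delta>
  div \<eta> in an arbitrary parametrisation, as needed for variations that destroy constant speed.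
  In \<open>lagr\<close> the length element ds = |p| dx is already included.\<close>

definition wfun :: "real \<Rightarrow> real^2 \<Rightarrow> real^2 \<Rightarrow> real^2 \<Rightarrow> real" where
  "wfun \<delta> p q r = (q \<bullet> rot p) / norm p ^ 3 + \<delta> * ((r \<bullet> p) / norm p ^ 2)"

definition lagr :: "real \<Rightarrow> real \<Rightarrow> real^2 \<Rightarrow> real^2 \<Rightarrow> real^2 \<Rightarrow> real" where
  "lagr \<delta> lam p q r = 1/2 * ((wfun \<delta> p q r)\<^sup>2 * norm p) + lam/2 * ((norm r)\<^sup>2 / norm p) + norm p"

lemma ac_inner: "ac f f' \<Longrightarrow> ac g g' \<Longrightarrow> ac (\<lambda>x. f x \<bullet> g x) (\<lambda>x. f' x \<bullet> g x + f x \<bullet> g' x)"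
  by (rule ac_prod[OF bounded_bilinear_inner])

lemma continuous_nonzero_bounds:
  fixes p :: "real \<Rightarrow> 'a::euclidean_space"
  assumes "continuous_on I2pi p" "\<And>x. x \<in> I2pi \<Longrightarrow> p x \<noteq> 0"
  obtains m M where "0 < m" "m \<le> M" "\<And>x. x \<in> I2pi \<Longrightarrow> m \<le> norm (p x)" "\<And>x. x \<in> I2pi \<Longrightarrow> norm (p x) \<le> M"
proof -
  have c: "continuous_on I2pi (\<lambda>x. norm (p x))" by (rule continuous_on_norm[OF assms(1)])
  obtain a where a: "a \<in> I2pi" "\<forall>x\<in>I2pi. norm (p a) \<le> norm (p x)"
    using continuous_attains_inf[OF compact_Icc _ c] by auto
  obtain b where b: "b \<in> I2pi" "\<forall>x\<in>I2pi. norm (p x) \<le> norm (p b)"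
    using continuous_attains_sup[OF compact_Icc _ c] by auto
  show thesis using a b assms(2)[OF a(1)] by (intro that[of "norm (p a)" "norm (p b)"]) auto
qed

text \<open>The chain rule is applied to 1/sqrt and the bilinear expression p.p, whose range
  [m^2, M^2] avoids the singularity at 0.\<close>

lemma ac_inverse_norm:
  fixes p q :: "real \<Rightarrow> 'a::euclidean_space"
  assumes pq: "ac p q" and nz: "\<And>x. x \<in> I2pi \<Longrightarrow> p x \<noteq> 0"
  shows "ac (\<lambda>x. inverse (norm (p x))) (\<lambda>x. - (p x \<bullet> q x) / norm (p x) ^ 3)"
proof -
  obtain m M where mM: "0 < m" "m \<le> M" "\<And>x. x \<in> I2pi \<Longrightarrow> m \<le> norm (p x)" "\<And>x. x \<in> I2pi \<Longrightarrow> norm (p x) \<le> M"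
    by (rule continuous_nonzero_bounds[OF ac_continuous[OF pq] nz]) blast+
  have "ac (\<lambda>x. inverse (sqrt (p x \<bullet> p x))) (\<lambda>x. (- (1 / (2 * (p x \<bullet> p x) * sqrt (p x \<bullet> p x)))) * (q x \<bullet> p x + p x \<bullet> q x))"
  proof (rule ac_chain[OF ac_inner[OF pq pq], where m = "m\<^sup>2" and M = "M\<^sup>2"])
    fix x :: real assume x: "x \<in> I2pi"
    show "p x \<bullet> p x \<in> {m\<^sup>2..M\<^sup>2}"
      unfolding power2_norm_eq_inner[symmetric] using mM(1) mM(3,4)[OF x] by (auto intro!: power_mono)
  next
    fix z assume "z \<in> {m\<^sup>2..M\<^sup>2}"
    then have z: "z > 0" using mM(1) by (auto intro: less_le_trans[of 0 "m\<^sup>2"])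
    have "((\<lambda>z. inverse (sqrt z)) has_real_derivative - (1 / (2 * z * sqrt z))) (at z)"
      using z by (auto intro!: derivative_eq_intros simp: field_simps power2_eq_square)
    then show "((\<lambda>z. inverse (sqrt z)) has_real_derivative - (1 / (2 * z * sqrt z))) (at z within {m\<^sup>2..M\<^sup>2})"
      by (rule DERIV_subset) simp
  next
    have "0 < m\<^sup>2" using mM(1) by simp
    then show "continuous_on {m\<^sup>2..M\<^sup>2} (\<lambda>z. - (1 / (2 * z * sqrt z)))"
      by (intro continuous_intros) auto
  qed
  then show ?thesis
  proof (rule ac_cong)
    show "AE x in leb. - (1 / (2 * (p x \<bullet> p x) * sqrt (p x \<bullet> p x))) * (q x \<bullet> p x + p x \<bullet> q x) = - (p x \<bullet> q x) / norm (p x) ^ 3"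
    proof (rule AE_leb_I)
      fix x assume "x \<in> I2pi"
      then have "norm (p x) \<noteq> 0" using nz by simp
      then show "- (1 / (2 * (p x \<bullet> p x) * sqrt (p x \<bullet> p x))) * (q x \<bullet> p x + p x \<bullet> q x) = - (p x \<bullet> q x) / norm (p x) ^ 3"
        unfolding norm_eq_sqrt_inner[symmetric] power2_norm_eq_inner[symmetric] inner_commute[of "q x"]
        by (simp add: field_simps power_numeral_reduce)
    qed
  qed (simp add: norm_eq_sqrt_inner)
qed

lemma wderiv1_ac: "ac f g \<Longrightarrow> continuous_on I2pi g \<Longrightarrow> x \<in> I2pi \<Longrightarrow> wderiv 1 f x = g x"
  by (rule wderiv_eq[OF ac_weak])

lemma wderiv1_ac_AE: "ac f g \<Longrightarrow> AE x in leb. wderiv 1 f x = g x"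
  by (rule wderiv_AE[OF ac_weak])

text \<open>The tangent is absolutely continuous, so its derivative is known almost everywhere from
  the product rule. \<open>curvature_algebra\<close> then gives existence for the
  \<open>THE\<close>, and the nonvanishing normal gives uniqueness.\<close>

lemma curvature_AE:
  assumes \<gamma>: "ac \<gamma> p" and p: "ac p q" and nz: "\<And>x. x \<in> I2pi \<Longrightarrow> p x \<noteq> 0"
  shows "AE x in leb. curvature \<gamma> x = (q x \<bullet> rot (p x)) / norm (p x) ^ 3"
proof -
  have w: "wderiv 1 \<gamma> x = p x" if "x \<in> I2pi" for x by (rule wderiv1_ac[OF \<gamma> ac_continuous[OF p] that])
  have tan: "tangent \<gamma> x = inverse (norm (p x)) *\<^sub>R p x" if "x \<in> I2pi" for x
    unfolding tangent_def ds_def using w[OF that] by simp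
  have "ac (\<lambda>x. inverse (norm (p x)) *\<^sub>R p x)
      (\<lambda>x. (- (p x \<bullet> q x) / norm (p x) ^ 3) *\<^sub>R p x + inverse (norm (p x)) *\<^sub>R q x)"
    by (rule ac_prod[OF bounded_bilinear_scaleR ac_inverse_norm[OF p nz] p])
  then have "ac (tangent \<gamma>) (\<lambda>x. (- (p x \<bullet> q x) / norm (p x) ^ 3) *\<^sub>R p x + inverse (norm (p x)) *\<^sub>R q x)"
    by (rule ac_cong) (simp_all add: tan)
  from wderiv1_ac_AE[OF this] AE_leb_I[of "\<lambda>x. x \<in> I2pi", OF _]
  have "AE x in leb. wderiv 1 (tangent \<gamma>) x = (- (p x \<bullet> q x) / norm (p x) ^ 3) *\<^sub>R p x + inverse (norm (p x)) *\<^sub>R q x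
      \<and> x \<in> I2pi" by auto
  then show ?thesis
  proof eventually_elim
    case (elim x)
    then have x: "x \<in> I2pi" by simp
    note pn = nz[OF x]
    have n: "normal \<gamma> x = rot (inverse (norm (p x)) *\<^sub>R p x)" by (simp add: normal_def tan[OF x])
    have n0: "normal \<gamma> x \<noteq> 0"
    proof
      assume "normal \<gamma> x = 0"
      then have "norm (rot (inverse (norm (p x)) *\<^sub>R p x)) = 0" by (simp add: n)
      then show False using pn by simp
    qed
    have eq: "ds \<gamma> (tangent \<gamma>) x = ((q x \<bullet> rot (p x)) / norm (p x) ^ 3) *\<^sub>R normal \<gamma> x"
      unfolding n ds_def w[OF x] conjunct1[OF elim] by (rule curvature_algebra[OF pn])
    show ?case
      unfolding curvature_def
    proof (rule the_equality, rule eq)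
      fix c assume "ds \<gamma> (tangent \<gamma>) x = c *\<^sub>R normal \<gamma> x"
      then show "c = q x \<bullet> rot (p x) / norm (p x) ^ 3" using eq n0 by simp
    qed
  qed
qed

section \<open>Square integrable functions and the energy integral\<close>

lemma L2_add:
  fixes f g :: "real \<Rightarrow> 'a::euclidean_space"
  assumes "f \<in> L2" "g \<in> L2" shows "(\<lambda>x. f x + g x) \<in> L2"
proof (rule L2_I[where g = "\<lambda>x. 2 * (norm (f x))\<^sup>2 + 2 * (norm (g x))\<^sup>2"])
  show "integrable leb (\<lambda>x. 2 * (norm (f x))\<^sup>2 + 2 * (norm (g x))\<^sup>2)"
    using L2_square[OF assms(1)] L2_square[OF assms(2)] by simp
  show "(\<lambda>x. f x + g x) \<in> borel_measurable leb"
    using L2_measurable[OF assms(1)] L2_measurable[OF assms(2)] by simp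
  fix x :: real
  have "(norm (f x + g x))\<^sup>2 \<le> (norm (f x) + norm (g x))\<^sup>2"
    by (intro power_mono norm_triangle_ineq) simp
  also have "\<dots> \<le> 2 * (norm (f x))\<^sup>2 + 2 * (norm (g x))\<^sup>2"
    using sum_squares_ge_zero[of "norm (f x) - norm (g x)" 0] by (simp add: power2_eq_square algebra_simps)
  finally show "(norm (f x + g x))\<^sup>2 \<le> 2 * (norm (f x))\<^sup>2 + 2 * (norm (g x))\<^sup>2" .
qed

lemma L2_dominated:
  fixes f :: "real \<Rightarrow> 'a::euclidean_space" and h :: "real \<Rightarrow> 'b::euclidean_space"
  assumes "f \<in> L2" "h \<in> borel_measurable leb" "\<And>x. x \<in> I2pi \<Longrightarrow> norm (h x) \<le> C * norm (f x)"
  shows "h \<in> L2"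
proof (rule L2_I[where g = "\<lambda>x. C\<^sup>2 * (norm (f x))\<^sup>2"])
  show "integrable leb (\<lambda>x. C\<^sup>2 * (norm (f x))\<^sup>2)" using L2_square[OF assms(1)] by simp
  fix x :: real assume "x \<in> I2pi"
  from power_mono[OF assms(3)[OF this], of 2] show "(norm (h x))\<^sup>2 \<le> C\<^sup>2 * (norm (f x))\<^sup>2"
    by (simp add: power_mult_distrib)
qed (fact assms(2))

lemma L2_norm: "f \<in> L2 \<Longrightarrow> (\<lambda>x. norm (f x)) \<in> L2"
  by (auto simp: L2_def)

lemma L2_const: "(\<lambda>x. c) \<in> L2"
  by (rule continuous_L2) (rule continuous_on_const)

lemma L2_scaleR: "f \<in> L2 \<Longrightarrow> (\<lambda>x. c *\<^sub>R f x) \<in> L2"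
  by (rule L2_dominated[where f = f and C = "\<bar>c\<bar>"]) (auto dest: L2_measurable)

lemma L2_product_integrable:
  fixes f :: "real \<Rightarrow> 'a::euclidean_space" and g :: "real \<Rightarrow> 'b::euclidean_space"
    and h :: "real \<Rightarrow> 'c::euclidean_space"
  assumes "f \<in> L2" "g \<in> L2" "h \<in> borel_measurable leb" "\<And>x. x \<in> I2pi \<Longrightarrow> norm (h x) \<le> norm (f x) * norm (g x)"
  shows "integrable leb h"
proof (rule integrable_leb_bound[OF _ assms(3), where g = "\<lambda>x. (norm (f x))\<^sup>2 + (norm (g x))\<^sup>2"])
  show "integrable leb (\<lambda>x. (norm (f x))\<^sup>2 + (norm (g x))\<^sup>2)"
    using L2_square[OF assms(1)] L2_square[OF assms(2)] by simp
  fix x :: real assume "x \<in> I2pi"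
  from assms(4)[OF this] have "norm (h x) \<le> norm (f x) * norm (g x)" .
  also have "\<dots> \<le> (norm (f x))\<^sup>2 + (norm (g x))\<^sup>2"
  proof -
    have "0 \<le> (norm (f x) - norm (g x))\<^sup>2 + 2 * ((norm (f x))\<^sup>2 + (norm (g x))\<^sup>2)" by simp
    moreover have "0 \<le> norm (f x) * norm (g x)" by simp
    moreover have "(norm (f x) - norm (g x))\<^sup>2 = (norm (f x))\<^sup>2 + (norm (g x))\<^sup>2 - 2 * (norm (f x) * norm (g x))"
      by (simp add: power2_diff)
    ultimately show ?thesis using zero_le_power2[of "norm (f x) - norm (g x)"] by linarith
  qed
  finally show "norm (h x) \<le> (norm (f x))\<^sup>2 + (norm (g x))\<^sup>2" .
qed

lemma L2_integrable: "f \<in> L2 \<Longrightarrow> integrable leb f"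
  by (rule L2_product_integrable[where f = f and g = "\<lambda>x. 1::real"]) (auto dest: L2_measurable intro: L2_const)

lemma wfun_L2:
  assumes p: "continuous_on I2pi p" and nz: "\<And>x. x \<in> I2pi \<Longrightarrow> p x \<noteq> 0" and q: "q \<in> L2" and r: "r \<in> L2"
  shows "(\<lambda>x. wfun \<delta> (p x) (q x) (r x)) \<in> L2"
proof -
  obtain m M where mM: "0 < m" "m \<le> M" "\<And>x. x \<in> I2pi \<Longrightarrow> m \<le> norm (p x)" "\<And>x. x \<in> I2pi \<Longrightarrow> norm (p x) \<le> M"
    by (rule continuous_nonzero_bounds[OF p nz]) blast+
  note [measurable] = continuous_measurable_leb[OF p] L2_measurable[OF q] L2_measurable[OF r]
  have 1: "(\<lambda>x. (q x \<bullet> rot (p x)) / norm (p x) ^ 3) \<in> L2"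
  proof (rule L2_dominated[OF q, where C = "1 / m\<^sup>2"])
    fix x :: real assume x: "x \<in> I2pi"
    have n: "norm (p x) > 0" using nz[OF x] by simp
    have "\<bar>q x \<bullet> rot (p x)\<bar> \<le> norm (q x) * norm (p x)" using Cauchy_Schwarz_ineq2[of "q x" "rot (p x)"] by simp
    then have "norm ((q x \<bullet> rot (p x)) / norm (p x) ^ 3) \<le> norm (q x) * norm (p x) / norm (p x) ^ 3"
      by (simp add: divide_right_mono)
    also have "\<dots> = norm (q x) * (1 / norm (p x) ^ 2)" using n by (simp add: field_simps power_numeral_reduce)
    also have "\<dots> \<le> norm (q x) * (1 / m\<^sup>2)"
      using mM(1) mM(3)[OF x] n by (intro mult_left_mono divide_left_mono power_mono) auto
    finally show "norm ((q x \<bullet> rot (p x)) / norm (p x) ^ 3) \<le> 1 / m\<^sup>2 * norm (q x)" by (simp add: mult.commute)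
  qed measurable
  have 2: "(\<lambda>x. (r x \<bullet> p x) / norm (p x) ^ 2) \<in> L2"
  proof (rule L2_dominated[OF r, where C = "1 / m"])
    fix x :: real assume x: "x \<in> I2pi"
    have n: "norm (p x) > 0" using nz[OF x] by simp
    have "\<bar>r x \<bullet> p x\<bar> \<le> norm (r x) * norm (p x)" by (rule Cauchy_Schwarz_ineq2)
    then have "norm ((r x \<bullet> p x) / norm (p x) ^ 2) \<le> norm (r x) * norm (p x) / norm (p x) ^ 2"
      by (simp add: divide_right_mono)
    also have "\<dots> = norm (r x) * (1 / norm (p x))" using n by (simp add: field_simps power_numeral_reduce)
    also have "\<dots> \<le> norm (r x) * (1 / m)"
      using mM(1) mM(3)[OF x] n by (intro mult_left_mono divide_left_mono) auto
    finally show "norm ((r x \<bullet> p x) / norm (p x) ^ 2) \<le> 1 / m * norm (r x)" by (simp add: mult.commute)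
  qed measurable
  show ?thesis unfolding wfun_def using L2_add[OF 1 L2_scaleR[OF 2, of \<delta>]] by simp
qed

text \<open>Both variations keep to curves and fields of this kind, so they can work with
  \<open>lagr\<close> and never return to the geometric definitions.\<close>

lemma energy_formula:
  assumes \<gamma>: "ac \<gamma> p" and p: "ac p q" and nz: "\<And>x. x \<in> I2pi \<Longrightarrow> p x \<noteq> 0" and \<eta>: "ac \<eta> r"
    and q: "q \<in> L2" and r: "r \<in> L2"
  shows "energy_LM \<delta> lam \<gamma> \<eta> = (LINT x|leb. lagr \<delta> lam (p x) (q x) (r x))"
    and "integrable leb (\<lambda>x. lagr \<delta> lam (p x) (q x) (r x))"
proof -
  note pc = ac_continuous[OF p]
  have w: "wderiv 1 \<gamma> x = p x" if "x \<in> I2pi" for x by (rule wderiv1_ac[OF \<gamma> pc that])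
  have tan: "tangent \<gamma> x = inverse (norm (p x)) *\<^sub>R p x" if "x \<in> I2pi" for x
    unfolding tangent_def ds_def using w[OF that] by simp
  have pm: "p \<in> borel_measurable leb" by (rule continuous_measurable_leb[OF pc])
  obtain m M where mM: "0 < m" "m \<le> M" "\<And>x. x \<in> I2pi \<Longrightarrow> m \<le> norm (p x)" "\<And>x. x \<in> I2pi \<Longrightarrow> norm (p x) \<le> M"
    by (rule continuous_nonzero_bounds[OF pc nz]) blast+
  note wL = wfun_L2[OF pc nz q r, of \<delta>]
  have "AE x in leb. curvature \<gamma> x = (q x \<bullet> rot (p x)) / norm (p x) ^ 3 \<and> wderiv 1 \<eta> x = r x \<and> x \<in> I2pi"
    using curvature_AE[OF \<gamma> p nz] wderiv1_ac_AE[OF \<eta>] AE_leb_I[of "\<lambda>x. x \<in> I2pi"] by auto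
  then have AE: "AE x in leb. (curvature \<gamma> x + \<delta> * curve_div \<gamma> \<eta> x)\<^sup>2 * norm (wderiv 1 \<gamma> x) = (wfun \<delta> (p x) (q x) (r x))\<^sup>2 * norm (p x)
     \<and> (norm (curve_grad \<gamma> \<eta> x))\<^sup>2 * norm (wderiv 1 \<gamma> x) = (norm (r x))\<^sup>2 / norm (p x)
     \<and> 1 * norm (wderiv 1 \<gamma> x) = norm (p x)"
  proof eventually_elim
    case (elim x)
    then have x: "x \<in> I2pi" and r: "wderiv 1 \<eta> x = r x" and \<kappa>: "curvature \<gamma> x = (q x \<bullet> rot (p x)) / norm (p x) ^ 3" by auto
    have n: "norm (p x) \<noteq> 0" using nz[OF x] by simp
    have d: "curve_div \<gamma> \<eta> x = (r x \<bullet> p x) / norm (p x) ^ 2"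
      unfolding curve_div_def ds_def tan[OF x] w[OF x] r by (simp add: field_simps power2_eq_square)
    have g: "(norm (curve_grad \<gamma> \<eta> x))\<^sup>2 = (norm (r x))\<^sup>2 / (norm (p x))\<^sup>2"
      unfolding curve_grad_def norm_tensor_sq ds_def tan[OF x] w[OF x] r
      using n by (simp add: power_mult_distrib field_simps)
    show ?case
      unfolding w[OF x] d g \<kappa> wfun_def using n by (simp add: power2_eq_square)
  qed
  have E1: "curve_integral \<gamma> (\<lambda>x. (curvature \<gamma> x + \<delta> * curve_div \<gamma> \<eta> x)\<^sup>2) = (LINT x|leb. (wfun \<delta> (p x) (q x) (r x))\<^sup>2 * norm (p x))"
    unfolding curve_integral_def by (rule integral_leb_cong_AE) (use AE in auto)
  have E2: "curve_integral \<gamma> (\<lambda>x. (norm (curve_grad \<gamma> \<eta> x))\<^sup>2) = (LINT x|leb. (norm (r x))\<^sup>2 / norm (p x))"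
    unfolding curve_integral_def by (rule integral_leb_cong_AE) (use AE in auto)
  have E3: "curve_length \<gamma> = (LINT x|leb. norm (p x))"
    unfolding curve_length_def curve_integral_def by (rule integral_leb_cong_AE) (use AE in auto)
  have I1: "integrable leb (\<lambda>x. (wfun \<delta> (p x) (q x) (r x))\<^sup>2 * norm (p x))"
  proof (rule integrable_leb_bound[where g = "\<lambda>x. (norm (wfun \<delta> (p x) (q x) (r x)))\<^sup>2 * M"])
    show "integrable leb (\<lambda>x. (norm (wfun \<delta> (p x) (q x) (r x)))\<^sup>2 * M)" using L2_square[OF wL] by simp
    show "(\<lambda>x. (wfun \<delta> (p x) (q x) (r x))\<^sup>2 * norm (p x)) \<in> borel_measurable leb"
      using L2_measurable[OF wL] pm by measurable
    show "norm ((wfun \<delta> (p x) (q x) (r x))\<^sup>2 * norm (p x)) \<le> (norm (wfun \<delta> (p x) (q x) (r x)))\<^sup>2 * M" if "x \<in> I2pi" for x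
      using mM(4)[OF that] by (simp add: mult_left_mono)
  qed
  have I2: "integrable leb (\<lambda>x. (norm (r x))\<^sup>2 / norm (p x))"
  proof (rule integrable_leb_bound[where g = "\<lambda>x. (norm (r x))\<^sup>2 * (1 / m)"])
    show "integrable leb (\<lambda>x. (norm (r x))\<^sup>2 * (1 / m))" using L2_square[OF r] by simp
    show "(\<lambda>x. (norm (r x))\<^sup>2 / norm (p x)) \<in> borel_measurable leb"
      using L2_measurable[OF r] pm by measurable
    show "norm ((norm (r x))\<^sup>2 / norm (p x)) \<le> (norm (r x))\<^sup>2 * (1 / m)" if "x \<in> I2pi" for x
      using mM(1) mM(3)[OF that] by (simp add: frac_le)
  qed
  have I3: "integrable leb (\<lambda>x. norm (p x))"
    by (rule continuous_integrable_leb[OF continuous_on_norm[OF pc]])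
  show "integrable leb (\<lambda>x. lagr \<delta> lam (p x) (q x) (r x))"
    unfolding lagr_def using I1 I2 I3 by (intro Bochner_Integration.integrable_add integrable_mult_right) auto
  show "energy_LM \<delta> lam \<gamma> \<eta> = (LINT x|leb. lagr \<delta> lam (p x) (q x) (r x))"
    unfolding energy_LM_def E1 E2 E3 lagr_def
    using Bochner_Integration.integral_add[OF Bochner_Integration.integrable_add[OF
        integrable_mult_right[OF I1, of "1/2"] integrable_mult_right[OF I2, of "lam/2"]] I3]
      Bochner_Integration.integral_add[OF integrable_mult_right[OF I1, of "1/2"] integrable_mult_right[OF I2, of "lam/2"]]
    by (simp only: integral_mult_right_zero)
qed

section \<open>First variations\<close>

text \<open>\<open>wfun\<close> is affine in r and |r|^2 is quadratic, so the energy is a quadratic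
  polynomial in \<open>\<epsilon>\<close> and the derivative at 0 is its linear coefficient; no
  limit is interchanged with the integral.\<close>

lemma eta_variation:
  assumes \<gamma>: "ac \<gamma> p" and p: "ac p q" and nz: "\<And>x. x \<in> I2pi \<Longrightarrow> p x \<noteq> 0" and \<eta>: "ac \<eta> r"
    and q: "q \<in> L2" and r: "r \<in> L2" and \<psi>: "ac \<psi> s" and s: "s \<in> L2"
    and crit: "((\<lambda>\<epsilon>. energy_LM \<delta> lam \<gamma> (\<lambda>x. \<eta> x + \<epsilon> *\<^sub>R \<psi> x)) has_real_derivative 0) (at 0)"
  shows "(LINT x|leb. \<delta> * wfun \<delta> (p x) (q x) (r x) * ((s x \<bullet> p x) / norm (p x)) + lam * ((r x \<bullet> s x) / norm (p x))) = 0"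
proof -
  define l where "l \<epsilon> x = lagr \<delta> lam (p x) (q x) (r x + \<epsilon> *\<^sub>R s x)" for \<epsilon> x
  have E: "energy_LM \<delta> lam \<gamma> (\<lambda>x. \<eta> x + \<epsilon> *\<^sub>R \<psi> x) = (LINT x|leb. l \<epsilon> x)"
    and I: "integrable leb (l \<epsilon>)" for \<epsilon>
    unfolding l_def
    using energy_formula[OF \<gamma> p nz ac_add[OF \<eta> ac_scaleR[OF \<psi>, of \<epsilon>]] q L2_add[OF r L2_scaleR[OF s, of \<epsilon>]], of \<delta> lam]
    by auto
  have w: "wfun \<delta> p q (r + \<epsilon> *\<^sub>R s) = wfun \<delta> p q r + \<epsilon> * (\<delta> * ((s \<bullet> p) / norm p ^ 2))" for p q r s :: "real^2" and \<epsilon>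
    by (simp add: wfun_def inner_add_left add_divide_distrib distrib_left)
  have n: "(norm (r + \<epsilon> *\<^sub>R s))\<^sup>2 = (norm r)\<^sup>2 + 2 * \<epsilon> * (r \<bullet> s) + \<epsilon>\<^sup>2 * (norm s)\<^sup>2" for r s :: "real^2" and \<epsilon>
    unfolding power2_norm_eq_inner
    by (simp add: inner_add_left inner_add_right inner_commute power2_eq_square algebra_simps)
  \<comment> \<open>Interpolation at -1, 0, 1 expresses the coefficients by values of the density,
    so their integrability comes for free.\<close>
  have quad: "l \<epsilon> x = l 0 x + \<epsilon> * (1/2 * (l 1 x - l (-1) x)) + \<epsilon>\<^sup>2 * (1/2 * (l 1 x + l (-1) x) - l 0 x)" for \<epsilon> x
    unfolding l_def lagr_def w n by (simp add: field_simps power2_eq_square)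
  define A B C where "A = (LINT x|leb. l 0 x)" and "B = (LINT x|leb. 1/2 * (l 1 x - l (-1) x))"
    and "C = (LINT x|leb. 1/2 * (l 1 x + l (-1) x) - l 0 x)"
  have EE: "energy_LM \<delta> lam \<gamma> (\<lambda>x. \<eta> x + \<epsilon> *\<^sub>R \<psi> x) = A + \<epsilon> * B + \<epsilon>\<^sup>2 * C" for \<epsilon>
  proof -
    have "(LINT x|leb. l \<epsilon> x) = (LINT x|leb. l 0 x + \<epsilon> * (1/2 * (l 1 x - l (-1) x)) + \<epsilon>\<^sup>2 * (1/2 * (l 1 x + l (-1) x) - l 0 x))"
      by (rule arg_cong[where f = "integral\<^sup>L leb"]) (rule ext, rule quad)
    also have "\<dots> = A + \<epsilon> * B + \<epsilon>\<^sup>2 * C"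
    proof -
      have i1: "integrable leb (\<lambda>x. \<epsilon> * (1/2 * (l 1 x - l (-1) x)))"
        by (intro integrable_mult_right Bochner_Integration.integrable_diff I)
      have i2: "integrable leb (\<lambda>x. \<epsilon>\<^sup>2 * (1/2 * (l 1 x + l (-1) x) - l 0 x))"
        by (intro integrable_mult_right Bochner_Integration.integrable_diff Bochner_Integration.integrable_add I)
      show ?thesis
        unfolding Bochner_Integration.integral_add[OF Bochner_Integration.integrable_add[OF I i1] i2]
          Bochner_Integration.integral_add[OF I i1] A_def B_def C_def
        by (simp only: integral_mult_right_zero)
    qed
    finally show ?thesis using E by simp
  qed
  have "((\<lambda>\<epsilon>. A + \<epsilon> * B + \<epsilon>\<^sup>2 * C) has_real_derivative B) (at 0)"
    by (auto intro!: derivative_eq_intros)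
  then have "B = 0"
    using crit unfolding EE by (rule DERIV_unique)
  moreover have "1/2 * (l 1 x - l (-1) x) = \<delta> * wfun \<delta> (p x) (q x) (r x) * ((s x \<bullet> p x) / norm (p x)) + lam * ((r x \<bullet> s x) / norm (p x))"
    if "x \<in> I2pi" for x
    using nz[OF that] unfolding l_def lagr_def w n by (simp add: field_simps power2_eq_square)
  then have "B = (LINT x|leb. \<delta> * wfun \<delta> (p x) (q x) (r x) * ((s x \<bullet> p x) / norm (p x)) + lam * ((r x \<bullet> s x) / norm (p x)))"
    unfolding B_def by (intro Bochner_Integration.integral_cong) simp_all
  ultimately show ?thesis by simp
qed

text \<open>Since \<open>E\<close> is assumed differentiable at 0, it is enough to follow the
  difference quotients along one null sequence, where dominated convergence applies.\<close>

lemma derivative_of_integral_0: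
  fixes \<Phi> :: "real \<Rightarrow> real \<Rightarrow> real"
  assumes "e0 > 0" and E: "(E has_real_derivative 0) (at 0)"
    and EI: "\<And>e. \<bar>e\<bar> < e0 \<Longrightarrow> E e = (LINT x|leb. \<Phi> e x)"
    and I: "\<And>e. \<bar>e\<bar> < e0 \<Longrightarrow> integrable leb (\<Phi> e)"
    and D: "\<And>x. x \<in> I2pi \<Longrightarrow> ((\<lambda>e. \<Phi> e x) has_real_derivative D x) (at 0)"
    and G: "integrable leb G" "\<And>e x. \<bar>e\<bar> < e0 \<Longrightarrow> x \<in> I2pi \<Longrightarrow> \<bar>\<Phi> e x - \<Phi> 0 x\<bar> \<le> \<bar>e\<bar> * G x"
  shows "(LINT x|leb. D x) = 0"
proof -
  define a where "a n = e0 / 2 * inverse (real (Suc n))" for n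
  have a0: "a n > 0" "a n < e0" for n
  proof -
    show "a n > 0" using \<open>e0 > 0\<close> by (simp add: a_def)
    have "inverse (real (Suc n)) \<le> 1" by (simp add: inverse_le_1_iff)
    then have "a n \<le> e0 / 2 * 1" unfolding a_def using \<open>e0 > 0\<close> by (intro mult_left_mono) auto
    then show "a n < e0" using \<open>e0 > 0\<close> by simp
  qed
  have "a \<longlonglongrightarrow> e0 / 2 * 0" unfolding a_def by (intro tendsto_intros LIMSEQ_inverse_real_of_nat)
  then have alim: "filterlim a (at 0) sequentially"
    using a0 by (auto simp: filterlim_at less_imp_neq intro!: always_eventually) (metis less_irrefl)
  have quot: "(\<lambda>n. (f (a n) - f 0) / a n) \<longlonglongrightarrow> d" if "(f has_real_derivative d) (at 0)" for f :: "real \<Rightarrow> real" and d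
    using filterlim_compose[OF that[unfolded DERIV_def] alim] by simp
  have L1: "(\<lambda>n. LINT x|leb. (\<Phi> (a n) x - \<Phi> 0 x) / a n) \<longlonglongrightarrow> (LINT x|leb. D x)"
  proof (rule integral_dominated_convergence[where w = G])
    show m: "(\<lambda>x. (\<Phi> (a n) x - \<Phi> 0 x) / a n) \<in> borel_measurable leb" for n
      using I[of "a n"] I[of 0] a0[of n] \<open>e0 > 0\<close> by auto
    have lim: "(\<lambda>n. (\<Phi> (a n) x - \<Phi> 0 x) / a n) \<longlonglongrightarrow> D x" if "x \<in> I2pi" for x
      by (rule quot[OF D[OF that]])
    then show "AE x in leb. (\<lambda>n. (\<Phi> (a n) x - \<Phi> 0 x) / a n) \<longlonglongrightarrow> D x"
      by (rule AE_leb_I)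
    show "D \<in> borel_measurable leb"
      by (rule borel_measurable_LIMSEQ_real[OF lim m]) simp
    show "AE x in leb. norm ((\<Phi> (a n) x - \<Phi> 0 x) / a n) \<le> G x" for n
    proof (rule AE_leb_I)
      fix x assume "x \<in> I2pi"
      from G(2)[of "a n", OF _ this] show "norm ((\<Phi> (a n) x - \<Phi> 0 x) / a n) \<le> G x"
        using a0[of n] by (simp add: divide_le_eq mult.commute)
    qed
  qed (fact G(1))
  have eq: "(LINT x|leb. (\<Phi> (a n) x - \<Phi> 0 x) / a n) = (E (a n) - E 0) / a n" for n
    using EI[of "a n"] EI[of 0] I[of "a n"] I[of 0] a0[of n] \<open>e0 > 0\<close>
    by (simp add: Bochner_Integration.integral_diff)
  show ?thesis by (rule LIMSEQ_unique[OF L1[unfolded eq] quot[OF E]])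
qed

text \<open>
  The constant does not depend on \<open>x\<close>, so a square integrable weight \<open>X\<close> yields the integrable
  majorant for the difference quotients of the energy density.
\<close>

definition lipschitz_at_0 :: "real \<Rightarrow> (real \<Rightarrow> real \<Rightarrow> 'a::real_normed_vector) \<Rightarrow> (real \<Rightarrow> real) \<Rightarrow> bool" where
  "lipschitz_at_0 e0 f X \<longleftrightarrow> (\<exists>C\<ge>0. \<forall>x\<in>I2pi. \<forall>e. \<bar>e\<bar> < e0 \<longrightarrow>
     0 \<le> X x \<and> norm (f e x) \<le> C * X x \<and> norm (f e x - f 0 x) \<le> C * \<bar>e\<bar> * X x)"

lemma lipschitz_at_0_I:
  assumes "C \<ge> 0" "\<And>x e. x \<in> I2pi \<Longrightarrow> \<bar>e\<bar> < e0 \<Longrightarrow> 0 \<le> X x"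
    "\<And>x e. x \<in> I2pi \<Longrightarrow> \<bar>e\<bar> < e0 \<Longrightarrow> norm (f e x) \<le> C * X x"
    "\<And>x e. x \<in> I2pi \<Longrightarrow> \<bar>e\<bar> < e0 \<Longrightarrow> norm (f e x - f 0 x) \<le> C * \<bar>e\<bar> * X x"
  shows "lipschitz_at_0 e0 f X"
  unfolding lipschitz_at_0_def using assms by blast

lemma lipschitz_at_0_E:
  assumes "lipschitz_at_0 e0 f X"
  obtains C where "C \<ge> 0" "\<And>x e. x \<in> I2pi \<Longrightarrow> \<bar>e\<bar> < e0 \<Longrightarrow> 0 \<le> X x"
    "\<And>x e. x \<in> I2pi \<Longrightarrow> \<bar>e\<bar> < e0 \<Longrightarrow> norm (f e x) \<le> C * X x"
    "\<And>x e. x \<in> I2pi \<Longrightarrow> \<bar>e\<bar> < e0 \<Longrightarrow> norm (f e x - f 0 x) \<le> C * \<bar>e\<bar> * X x"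
  using assms unfolding lipschitz_at_0_def by blast

section \<open>Closure properties of the Lipschitz estimate at parameter 0\<close>

lemma lipschitz_at_0_add:
  assumes f: "lipschitz_at_0 e0 f X" and g: "lipschitz_at_0 e0 g X"
  shows "lipschitz_at_0 e0 (\<lambda>e x. f e x + g e x) X"
proof -
  obtain C where C: "C \<ge> 0" "\<And>x e. x \<in> I2pi \<Longrightarrow> \<bar>e\<bar> < e0 \<Longrightarrow> 0 \<le> X x"
    "\<And>x e. x \<in> I2pi \<Longrightarrow> \<bar>e\<bar> < e0 \<Longrightarrow> norm (f e x) \<le> C * X x"
    "\<And>x e. x \<in> I2pi \<Longrightarrow> \<bar>e\<bar> < e0 \<Longrightarrow> norm (f e x - f 0 x) \<le> C * \<bar>e\<bar> * X x"
    using f by (rule lipschitz_at_0_E) blast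
  obtain D where D: "D \<ge> 0"
    "\<And>x e. x \<in> I2pi \<Longrightarrow> \<bar>e\<bar> < e0 \<Longrightarrow> norm (g e x) \<le> D * X x"
    "\<And>x e. x \<in> I2pi \<Longrightarrow> \<bar>e\<bar> < e0 \<Longrightarrow> norm (g e x - g 0 x) \<le> D * \<bar>e\<bar> * X x"
    using g by (rule lipschitz_at_0_E) blast
  show ?thesis
  proof (rule lipschitz_at_0_I[where C = "C + D"])
    fix x e :: real assume x: "x \<in> I2pi" "\<bar>e\<bar> < e0"
    show "0 \<le> X x" using C(2)[OF x] .
    show "norm (f e x + g e x) \<le> (C + D) * X x"
      using norm_triangle_ineq[of "f e x" "g e x"] C(3)[OF x] D(2)[OF x] by (simp add: distrib_right)
    show "norm (f e x + g e x - (f 0 x + g 0 x)) \<le> (C + D) * \<bar>e\<bar> * X x"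
      using norm_diff_triangle_ineq[of "f e x" "g e x" "f 0 x" "g 0 x"] C(4)[OF x] D(3)[OF x] by (simp add: distrib_right)
  qed (use C(1) D(1) in simp)
qed

text \<open>The constants and the weights multiply, so expressions quadratic in factors of weight
  \<open>X\<close> get weight \<open>X\<^sup>2\<close>. The factor 2 counts the two terms of the
  Leibniz splitting.\<close>

lemma lipschitz_at_0_prod:
  fixes prod :: "'a::real_normed_vector \<Rightarrow> 'b::real_normed_vector \<Rightarrow> 'c::real_normed_vector"
  assumes bl: "bounded_bilinear prod" and contr: "\<And>a b. norm (prod a b) \<le> norm a * norm b"
    and f: "lipschitz_at_0 e0 f X" and g: "lipschitz_at_0 e0 g Y"
  shows "lipschitz_at_0 e0 (\<lambda>e x. prod (f e x) (g e x)) (\<lambda>x. X x * Y x)"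
proof -
  interpret bounded_bilinear prod by fact
  obtain C where C: "C \<ge> 0" "\<And>x e. x \<in> I2pi \<Longrightarrow> \<bar>e\<bar> < e0 \<Longrightarrow> 0 \<le> X x"
    "\<And>x e. x \<in> I2pi \<Longrightarrow> \<bar>e\<bar> < e0 \<Longrightarrow> norm (f e x) \<le> C * X x"
    "\<And>x e. x \<in> I2pi \<Longrightarrow> \<bar>e\<bar> < e0 \<Longrightarrow> norm (f e x - f 0 x) \<le> C * \<bar>e\<bar> * X x"
    using f by (rule lipschitz_at_0_E) blast
  obtain D where D: "D \<ge> 0" "\<And>x e. x \<in> I2pi \<Longrightarrow> \<bar>e\<bar> < e0 \<Longrightarrow> 0 \<le> Y x"
    "\<And>x e. x \<in> I2pi \<Longrightarrow> \<bar>e\<bar> < e0 \<Longrightarrow> norm (g e x) \<le> D * Y x"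
    "\<And>x e. x \<in> I2pi \<Longrightarrow> \<bar>e\<bar> < e0 \<Longrightarrow> norm (g e x - g 0 x) \<le> D * \<bar>e\<bar> * Y x"
    using g by (rule lipschitz_at_0_E) blast
  show ?thesis
  proof (rule lipschitz_at_0_I[where C = "2 * (C * D)"])
    fix x e :: real assume x: "x \<in> I2pi" "\<bar>e\<bar> < e0"
    then have x0: "x \<in> I2pi" "\<bar>0::real\<bar> < e0" by auto
    note X = C(2)[OF x] and Y = D(2)[OF x]
    show "0 \<le> X x * Y x" using X Y by simp
    have "norm (prod (f e x) (g e x)) \<le> (C * X x) * (D * Y x)"
      using C(1) D(1) X Y by (intro order_trans[OF contr] mult_mono C(3) D(3) x) auto
    moreover have "0 \<le> (C * X x) * (D * Y x)" using C(1) D(1) X Y by simp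
    ultimately show "norm (prod (f e x) (g e x)) \<le> 2 * (C * D) * (X x * Y x)" by (simp add: algebra_simps)
    have "norm (prod (f e x - f 0 x) (g e x)) \<le> (C * \<bar>e\<bar> * X x) * (D * Y x)"
      using C(1) D(1) X Y by (intro order_trans[OF contr] mult_mono C(4) D(3) x) auto
    moreover have "norm (prod (f 0 x) (g e x - g 0 x)) \<le> (C * X x) * (D * \<bar>e\<bar> * Y x)"
      using C(1) D(1) X Y by (intro order_trans[OF contr] mult_mono C(3)[OF x0] D(4)[OF x]) auto
    moreover have eq: "prod (f e x) (g e x) - prod (f 0 x) (g 0 x) = prod (f e x - f 0 x) (g e x) + prod (f 0 x) (g e x - g 0 x)"
      by (simp add: diff_left diff_right)
    ultimately show "norm (prod (f e x) (g e x) - prod (f 0 x) (g 0 x)) \<le> 2 * (C * D) * \<bar>e\<bar> * (X x * Y x)"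
      unfolding eq using norm_triangle_ineq[of "prod (f e x - f 0 x) (g e x)" "prod (f 0 x) (g e x - g 0 x)"]
      by (simp add: algebra_simps)
  qed (use C(1) D(1) in simp)
qed

lemma lipschitz_at_0_mult:
  fixes f g :: "real \<Rightarrow> real \<Rightarrow> real"
  shows "lipschitz_at_0 e0 f X \<Longrightarrow> lipschitz_at_0 e0 g Y \<Longrightarrow> lipschitz_at_0 e0 (\<lambda>e x. f e x * g e x) (\<lambda>x. X x * Y x)"
  by (rule lipschitz_at_0_prod[OF bounded_bilinear_mult]) (simp_all add: abs_mult)

lemma lipschitz_at_0_inner:
  fixes f g :: "real \<Rightarrow> real \<Rightarrow> 'a::real_inner"
  shows "lipschitz_at_0 e0 f X \<Longrightarrow> lipschitz_at_0 e0 g Y \<Longrightarrow> lipschitz_at_0 e0 (\<lambda>e x. f e x \<bullet> g e x) (\<lambda>x. X x * Y x)"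
  by (rule lipschitz_at_0_prod[OF bounded_bilinear_inner]) (simp_all add: Cauchy_Schwarz_ineq2)

lemma lipschitz_at_0_affine:
  fixes g h :: "real \<Rightarrow> 'a::real_normed_vector"
  assumes "e0 \<le> 1" "0 \<le> C" "\<And>x. x \<in> I2pi \<Longrightarrow> 0 \<le> X x"
    "\<And>x. x \<in> I2pi \<Longrightarrow> norm (g x) \<le> C * X x" "\<And>x. x \<in> I2pi \<Longrightarrow> norm (h x) \<le> C * X x"
  shows "lipschitz_at_0 e0 (\<lambda>e x. g x + e *\<^sub>R h x) X"
proof (rule lipschitz_at_0_I[where C = "2 * C"])
  fix x e :: real assume x: "x \<in> I2pi" "\<bar>e\<bar> < e0"
  note g = assms(4)[OF x(1)] and h = assms(5)[OF x(1)] and X = assms(3)[OF x(1)]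
  have "norm (e *\<^sub>R h x) \<le> 1 * (C * X x)"
    unfolding norm_scaleR using x assms(1,2) X h by (intro mult_mono) auto
  then show "norm (g x + e *\<^sub>R h x) \<le> 2 * C * X x"
    using norm_triangle_ineq[of "g x" "e *\<^sub>R h x"] g by simp
  have "norm (e *\<^sub>R h x) \<le> \<bar>e\<bar> * (C * X x)"
    unfolding norm_scaleR using h by (intro mult_left_mono) auto
  moreover have "0 \<le> \<bar>e\<bar> * (C * X x)" using assms(2) X by simp
  ultimately show "norm (g x + e *\<^sub>R h x - (g x + 0 *\<^sub>R h x)) \<le> 2 * C * \<bar>e\<bar> * X x"
    by (simp add: algebra_simps)
qed (use assms in auto)

lemma lipschitz_at_0_const:
  fixes g :: "real \<Rightarrow> 'a::real_normed_vector"
  assumes "0 \<le> C" "\<And>x. x \<in> I2pi \<Longrightarrow> 0 \<le> X x" "\<And>x. x \<in> I2pi \<Longrightarrow> norm (g x) \<le> C * X x"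
  shows "lipschitz_at_0 e0 (\<lambda>e. g) X"
  by (rule lipschitz_at_0_I[where C = C]) (use assms in auto)

lemma lipschitz_at_0_norm:
  assumes "lipschitz_at_0 e0 f X" shows "lipschitz_at_0 e0 (\<lambda>e x. norm (f e x)) X"
proof -
  obtain C where C: "C \<ge> 0" "\<And>x e. x \<in> I2pi \<Longrightarrow> \<bar>e\<bar> < e0 \<Longrightarrow> 0 \<le> X x"
    "\<And>x e. x \<in> I2pi \<Longrightarrow> \<bar>e\<bar> < e0 \<Longrightarrow> norm (f e x) \<le> C * X x"
    "\<And>x e. x \<in> I2pi \<Longrightarrow> \<bar>e\<bar> < e0 \<Longrightarrow> norm (f e x - f 0 x) \<le> C * \<bar>e\<bar> * X x"
    using assms by (rule lipschitz_at_0_E) blast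
  show ?thesis
  proof (rule lipschitz_at_0_I[OF C(1,2)])
    fix x e :: real assume x: "x \<in> I2pi" "\<bar>e\<bar> < e0"
    show "norm (norm (f e x)) \<le> C * X x" using C(3)[OF x] by simp
    show "norm (norm (f e x) - norm (f 0 x)) \<le> C * \<bar>e\<bar> * X x"
      using C(4)[OF x] norm_triangle_ineq3[of "f e x" "f 0 x"] by simp
  qed
qed

lemma lipschitz_at_0_rot:
  assumes "lipschitz_at_0 e0 f X" shows "lipschitz_at_0 e0 (\<lambda>e x. rot (f e x)) X"
proof -
  have "rot u - rot v = rot (u - v)" for u v
    by (simp add: vec2_eq_iff)
  then have "norm (rot u - rot v) = norm (u - v)" for u v by simp
  then show ?thesis using assms by (simp add: lipschitz_at_0_def)
qed

text \<open>1/m bounds the values, and C/m^2 bounds the difference through 1/v - 1/v0 = -(v - v0)/(v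
  v0).\<close>

lemma lipschitz_at_0_inverse:
  fixes v :: "real \<Rightarrow> real \<Rightarrow> real"
  assumes v: "lipschitz_at_0 e0 v (\<lambda>x. 1)" and "m > 0" and low: "\<And>x e. x \<in> I2pi \<Longrightarrow> \<bar>e\<bar> < e0 \<Longrightarrow> m \<le> v e x"
  shows "lipschitz_at_0 e0 (\<lambda>e x. inverse (v e x)) (\<lambda>x. 1)"
proof -
  obtain C where C: "C \<ge> 0" "\<And>x e. x \<in> I2pi \<Longrightarrow> \<bar>e\<bar> < e0 \<Longrightarrow> norm (v e x - v 0 x) \<le> C * \<bar>e\<bar> * 1"
    using v by (rule lipschitz_at_0_E) blast
  show ?thesis
  proof (rule lipschitz_at_0_I[where C = "1 / m + C / m\<^sup>2"])
    fix x e :: real assume x: "x \<in> I2pi" "\<bar>e\<bar> < e0"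
    then have x0: "x \<in> I2pi" "\<bar>0::real\<bar> < e0" by auto
    note l = low[OF x] low[OF x0]
    have pos: "v e x > 0" "v 0 x > 0" using l \<open>m > 0\<close> by auto
    have "norm (inverse (v e x)) \<le> 1 / m"
      using l \<open>m > 0\<close> by (simp add: inverse_eq_divide frac_le)
    then show "norm (inverse (v e x)) \<le> (1 / m + C / m\<^sup>2) * 1"
      using C(1) \<open>m > 0\<close> by (simp add: add_increasing2)
    have "inverse (v e x) - inverse (v 0 x) = - (v e x - v 0 x) / (v e x * v 0 x)"
      using pos by (simp add: field_simps)
    then have "norm (inverse (v e x) - inverse (v 0 x)) = norm (v e x - v 0 x) / (v e x * v 0 x)"
      using pos by (simp add: abs_mult)
    also have "\<dots> \<le> (C * \<bar>e\<bar>) / (m * m)"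
      using C(2)[OF x] l pos \<open>m > 0\<close> C(1) by (intro frac_le mult_mono) auto
    also have "\<dots> = C / m\<^sup>2 * \<bar>e\<bar>" by (simp add: power2_eq_square)
    also have "\<dots> \<le> (1 / m + C / m\<^sup>2) * \<bar>e\<bar>"
      using \<open>m > 0\<close> by (intro mult_right_mono) auto
    finally show "norm (inverse (v e x) - inverse (v 0 x)) \<le> (1 / m + C / m\<^sup>2) * \<bar>e\<bar> * 1" by simp
  qed (use C(1) \<open>m > 0\<close> in auto)
qed

lemma lipschitz_at_0_mono:
  assumes f: "lipschitz_at_0 e0 f X" and XY: "\<And>x. x \<in> I2pi \<Longrightarrow> X x \<le> Y x"
  shows "lipschitz_at_0 e0 f Y"
proof -
  obtain C where C: "C \<ge> 0" "\<And>x e. x \<in> I2pi \<Longrightarrow> \<bar>e\<bar> < e0 \<Longrightarrow> 0 \<le> X x"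
    "\<And>x e. x \<in> I2pi \<Longrightarrow> \<bar>e\<bar> < e0 \<Longrightarrow> norm (f e x) \<le> C * X x"
    "\<And>x e. x \<in> I2pi \<Longrightarrow> \<bar>e\<bar> < e0 \<Longrightarrow> norm (f e x - f 0 x) \<le> C * \<bar>e\<bar> * X x"
    using f by (rule lipschitz_at_0_E) blast
  show ?thesis
  proof (rule lipschitz_at_0_I[OF C(1)])
    fix x e :: real assume x: "x \<in> I2pi" "\<bar>e\<bar> < e0"
    show "0 \<le> Y x" using C(2)[OF x] XY[OF x(1)] by simp
    show "norm (f e x) \<le> C * Y x"
      using C(3)[OF x] mult_left_mono[OF XY[OF x(1)] C(1)] by linarith
    show "norm (f e x - f 0 x) \<le> C * \<bar>e\<bar> * Y x"
      using C(4)[OF x] mult_left_mono[OF XY[OF x(1)], of "C * \<bar>e\<bar>"] C(1) by simp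
  qed
qed

text \<open>The derivative at 0 of \<open>lagr\<close> along p + e\<zeta>, q + eh with r fixed. The
  large parenthesis is the derivative of \<open>wfun\<close>; the other terms come from the factors
  |p| and 1/|p|.\<close>

definition dlagr :: "real \<Rightarrow> real \<Rightarrow> real^2 \<Rightarrow> real^2 \<Rightarrow> real^2 \<Rightarrow> real^2 \<Rightarrow> real^2 \<Rightarrow> real" where
  "dlagr \<delta> lam p q r \<zeta> h = wfun \<delta> p q r * norm p *
       ((h \<bullet> rot p + q \<bullet> rot \<zeta>) / norm p ^ 3 - 3 * (q \<bullet> rot p) * (p \<bullet> \<zeta>) / norm p ^ 5
        + \<delta> * ((r \<bullet> \<zeta>) / norm p ^ 2 - 2 * (r \<bullet> p) * (p \<bullet> \<zeta>) / norm p ^ 4))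
     + 1/2 * (wfun \<delta> p q r)\<^sup>2 * (p \<bullet> \<zeta>) / norm p
     - lam/2 * (norm r)\<^sup>2 * (p \<bullet> \<zeta>) / norm p ^ 3 + (p \<bullet> \<zeta>) / norm p"

lemma DERIV_norm_line:
  fixes p \<zeta> :: "'a::real_inner"
  assumes "p \<noteq> 0"
  shows "((\<lambda>e. norm (p + e *\<^sub>R \<zeta>)) has_real_derivative (p \<bullet> \<zeta>) / norm p) (at 0)"
proof -
  have "(\<lambda>e. norm (p + e *\<^sub>R \<zeta>)) = (\<lambda>e. sqrt (p \<bullet> p + 2 * e * (p \<bullet> \<zeta>) + e\<^sup>2 * (\<zeta> \<bullet> \<zeta>)))"
    by (simp add: norm_eq_sqrt_inner inner_add_left inner_add_right inner_commute power2_eq_square algebra_simps)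
  moreover have "((\<lambda>e. sqrt (a + 2 * e * b + e\<^sup>2 * c)) has_real_derivative b / sqrt a) (at 0)"
    if "a > 0" for a b c :: real
    using that by (auto intro!: derivative_eq_intros simp: field_simps)
  from this[of "p \<bullet> p" "p \<bullet> \<zeta>" "\<zeta> \<bullet> \<zeta>"]
  have "((\<lambda>e. sqrt (p \<bullet> p + 2 * e * (p \<bullet> \<zeta>) + e\<^sup>2 * (\<zeta> \<bullet> \<zeta>))) has_real_derivative
      (p \<bullet> \<zeta>) / norm p) (at 0)"
    using assms by (simp add: norm_eq_sqrt_inner)
  ultimately show ?thesis by simp
qed

lemma lagr_DERIV:
  assumes "p \<noteq> 0"
  shows "((\<lambda>e. lagr \<delta> lam (p + e *\<^sub>R \<zeta>) (q + e *\<^sub>R h) r) has_real_derivative dlagr \<delta> lam p q r \<zeta> h) (at 0)"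
proof -
  define v where "v e = norm (p + e *\<^sub>R \<zeta>)" for e
  define K where "K e = (q + e *\<^sub>R h) \<bullet> rot (p + e *\<^sub>R \<zeta>)" for e
  define D where "D e = r \<bullet> (p + e *\<^sub>R \<zeta>)" for e
  have v: "(v has_real_derivative (p \<bullet> \<zeta>) / norm p) (at 0)"
    unfolding v_def by (rule DERIV_norm_line[OF assms])
  have K: "(K has_real_derivative (h \<bullet> rot p + q \<bullet> rot \<zeta>)) (at 0)"
    unfolding K_def by (auto simp: inner_add_left inner_add_right rot_add rot_scaleR intro!: derivative_eq_intros)
  have D: "(D has_real_derivative (r \<bullet> \<zeta>)) (at 0)"
    unfolding D_def by (auto simp: inner_add_right intro!: derivative_eq_intros)
  have z: "v 0 = norm p" "K 0 = q \<bullet> rot p" "D 0 = r \<bullet> p" by (simp_all add: v_def K_def D_def)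
  have n0: "norm p \<noteq> 0" using assms by simp
  have W1: "((\<lambda>e. K e / v e ^ 3) has_real_derivative
     (h \<bullet> rot p + q \<bullet> rot \<zeta>) / norm p ^ 3 - 3 * (q \<bullet> rot p) * (p \<bullet> \<zeta>) / norm p ^ 5) (at 0)"
    by (rule DERIV_cong[OF DERIV_divide[OF K DERIV_power[OF v, of 3]]])
      (use n0 in \<open>simp_all add: z field_simps power_numeral_reduce\<close>)
  have W2: "((\<lambda>e. D e / v e ^ 2) has_real_derivative
     (r \<bullet> \<zeta>) / norm p ^ 2 - 2 * (r \<bullet> p) * (p \<bullet> \<zeta>) / norm p ^ 4) (at 0)"
    by (rule DERIV_cong[OF DERIV_divide[OF D DERIV_power[OF v, of 2]]])
      (use n0 in \<open>simp_all add: z field_simps power_numeral_reduce\<close>)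
  define w' where "w' = (h \<bullet> rot p + q \<bullet> rot \<zeta>) / norm p ^ 3 - 3 * (q \<bullet> rot p) * (p \<bullet> \<zeta>) / norm p ^ 5
        + \<delta> * ((r \<bullet> \<zeta>) / norm p ^ 2 - 2 * (r \<bullet> p) * (p \<bullet> \<zeta>) / norm p ^ 4)"
  define W where "W e = K e / v e ^ 3 + \<delta> * (D e / v e ^ 2)" for e
  have W: "(W has_real_derivative w') (at 0)"
    unfolding W_def w'_def by (rule DERIV_add[OF W1 DERIV_cmult[OF W2]])
  have W0: "W 0 = wfun \<delta> p q r" by (simp add: W_def z wfun_def)
  have dl: "dlagr \<delta> lam p q r \<zeta> h = wfun \<delta> p q r * norm p * w' + 1/2 * (wfun \<delta> p q r)\<^sup>2 * (p \<bullet> \<zeta>) / norm p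
     - lam/2 * (norm r)\<^sup>2 * (p \<bullet> \<zeta>) / norm p ^ 3 + (p \<bullet> \<zeta>) / norm p"
    by (simp only: dlagr_def w'_def)
  have V1: "((\<lambda>e. (norm r)\<^sup>2 / v e) has_real_derivative - ((norm r)\<^sup>2 * (p \<bullet> \<zeta>) / norm p ^ 3)) (at 0)"
    by (rule DERIV_cong[OF DERIV_divide[OF DERIV_const v]])
      (use n0 in \<open>simp_all add: z field_simps power_numeral_reduce\<close>)
  have "((\<lambda>e. 1/2 * ((W e)\<^sup>2 * v e) + lam/2 * ((norm r)\<^sup>2 / v e) + v e)
      has_real_derivative dlagr \<delta> lam p q r \<zeta> h) (at 0)"
    by (rule DERIV_cong[OF DERIV_add[OF DERIV_add[OF DERIV_cmult[OF DERIV_mult[OF DERIV_power[OF W, of 2] v]]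
          DERIV_cmult[OF V1]] v]])
      (simp add: W0 z(1) dl algebra_simps)
  then show ?thesis
    unfolding lagr_def wfun_def W_def v_def K_def D_def by simp
qed

text \<open>Near parameter 0 the speed stays bounded below, so the density is Lipschitz in the
  parameter with weight \<open>X\<^sup>2\<close>, where X is square integrable. That weight is the
  majorant in \<open>derivative_of_integral_0\<close>.\<close>

lemma gamma_variation:
  assumes \<gamma>: "ac \<gamma> p" and p: "ac p q" and nz: "\<And>x. x \<in> I2pi \<Longrightarrow> p x \<noteq> 0" and \<eta>: "ac \<eta> r"
    and q: "q \<in> L2" and r: "r \<in> L2" and \<phi>: "ac \<phi> \<zeta>" and \<zeta>: "ac \<zeta> h" and h: "h \<in> L2"
    and crit: "((\<lambda>\<epsilon>. energy_LM \<delta> lam (\<lambda>x. \<gamma> x + \<epsilon> *\<^sub>R \<phi> x) \<eta>) has_real_derivative 0) (at 0)"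
  shows "(LINT x|leb. dlagr \<delta> lam (p x) (q x) (r x) (\<zeta> x) (h x)) = 0"
proof -
  obtain m M where mM: "0 < m" "m \<le> M" "\<And>x. x \<in> I2pi \<Longrightarrow> m \<le> norm (p x)" "\<And>x. x \<in> I2pi \<Longrightarrow> norm (p x) \<le> M"
    by (rule continuous_nonzero_bounds[OF ac_continuous[OF p] nz]) blast+
  obtain Z where Z: "Z > 0" "\<And>x. x \<in> I2pi \<Longrightarrow> norm (\<zeta> x) \<le> Z"
    by (rule continuous_bounded_I2pi[OF ac_continuous[OF \<zeta>]]) blast
  \<comment> \<open>Below \<open>e0\<close> the perturbation of p has norm at most m/2, which leaves
    |p + e\<zeta>| at least m/2; the bound 1 serves \<open>lipschitz_at_0_affine\<close>.\<close>
  define e0 where "e0 = min 1 (m / (2 * Z))"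
  have e0: "e0 > 0" "e0 \<le> 1" "e0 * Z \<le> m / 2"
  proof -
    show "e0 > 0" "e0 \<le> 1" using mM Z by (auto simp: e0_def)
    have "e0 * Z \<le> m / (2 * Z) * Z" using Z by (intro mult_right_mono) (auto simp: e0_def)
    then show "e0 * Z \<le> m / 2" using Z by simp
  qed
  have low: "m / 2 \<le> norm (p x + e *\<^sub>R \<zeta> x)" if "x \<in> I2pi" "\<bar>e\<bar> < e0" for x e
  proof -
    have "norm (e *\<^sub>R \<zeta> x) \<le> e0 * Z"
      unfolding norm_scaleR using that Z by (intro mult_mono) auto
    then show ?thesis
      using norm_diff_ineq[of "p x" "e *\<^sub>R \<zeta> x"] mM(3)[OF that(1)] e0(3) by linarith
  qed
  define \<Phi> where "\<Phi> e x = lagr \<delta> lam (p x + e *\<^sub>R \<zeta> x) (q x + e *\<^sub>R h x) (r x)" for e x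
  \<comment> \<open>The summand 1 makes \<open>X\<close> at least 1, so that the length term of
    weight 1 also fits under \<open>X\<^sup>2\<close>.\<close>
  define X where "X x = 1 + norm (q x) + norm (h x) + norm (r x)" for x
  have X1: "1 \<le> X x" for x by (simp add: X_def)
  have XL2: "X \<in> L2"
    unfolding X_def by (intro L2_add L2_const L2_norm q h r)
  have lipp: "lipschitz_at_0 e0 (\<lambda>e x. p x + e *\<^sub>R \<zeta> x) (\<lambda>x. 1)"
    using mM Z by (intro lipschitz_at_0_affine[where C = "M + Z"] e0(2)) (auto intro: add_increasing add_increasing2)
  have lipq: "lipschitz_at_0 e0 (\<lambda>e x. q x + e *\<^sub>R h x) X"
    by (rule lipschitz_at_0_affine[where C = 1]) (auto simp: X_def e0(2))
  have lipr: "lipschitz_at_0 e0 (\<lambda>e. r) X"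
    by (rule lipschitz_at_0_const[where C = 1]) (auto simp: X_def)
  have lipc: "lipschitz_at_0 e0 (\<lambda>e x. c) (\<lambda>x. 1)" for c :: real
    by (rule lipschitz_at_0_const[where C = "\<bar>c\<bar>"]) auto
  note lipv = lipschitz_at_0_norm[OF lipp]
  define iv where "iv e x = inverse (norm (p x + e *\<^sub>R \<zeta> x))" for e x
  have lipiv: "lipschitz_at_0 e0 iv (\<lambda>x. 1)"
    unfolding iv_def using mM(1) by (intro lipschitz_at_0_inverse[OF lipv, of "m/2"] low) auto
  note M = lipschitz_at_0_mult
  have A: "lipschitz_at_0 e0 (\<lambda>e x. ((q x + e *\<^sub>R h x) \<bullet> rot (p x + e *\<^sub>R \<zeta> x)) * (iv e x * (iv e x * iv e x))) X"
    using M[OF lipschitz_at_0_inner[OF lipq lipschitz_at_0_rot[OF lipp]] M[OF lipiv M[OF lipiv lipiv]]] by simp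
  have B: "lipschitz_at_0 e0 (\<lambda>e x. \<delta> * ((r x \<bullet> (p x + e *\<^sub>R \<zeta> x)) * (iv e x * iv e x))) X"
    using M[OF lipc[of \<delta>] M[OF lipschitz_at_0_inner[OF lipr lipp] M[OF lipiv lipiv]]] by simp
  have lipw: "lipschitz_at_0 e0 (\<lambda>e x. wfun \<delta> (p x + e *\<^sub>R \<zeta> x) (q x + e *\<^sub>R h x) (r x)) X"
    using lipschitz_at_0_add[OF A B]
    by (simp add: wfun_def iv_def divide_inverse power2_eq_square power3_eq_cube mult.assoc)
  have "lipschitz_at_0 e0 (\<lambda>e x. 1/2 * ((wfun \<delta> (p x + e *\<^sub>R \<zeta> x) (q x + e *\<^sub>R h x) (r x) *
      wfun \<delta> (p x + e *\<^sub>R \<zeta> x) (q x + e *\<^sub>R h x) (r x)) * norm (p x + e *\<^sub>R \<zeta> x))) (\<lambda>x. (X x)\<^sup>2)"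
    using M[OF lipc[of "1/2"] M[OF M[OF lipw lipw] lipv]] by (simp add: power2_eq_square)
  moreover have "lipschitz_at_0 e0 (\<lambda>e x. lam/2 * ((norm (r x) * norm (r x)) * iv e x)) (\<lambda>x. (X x)\<^sup>2)"
    using M[OF lipc[of "lam/2"] M[OF M[OF lipschitz_at_0_norm[OF lipr] lipschitz_at_0_norm[OF lipr]] lipiv]]
    by (simp add: power2_eq_square)
  moreover have "lipschitz_at_0 e0 (\<lambda>e x. norm (p x + e *\<^sub>R \<zeta> x)) (\<lambda>x. (X x)\<^sup>2)"
    by (rule lipschitz_at_0_mono[OF lipv]) (use X1 in \<open>simp add: power2_eq_square mult_ge1_I\<close>)
  ultimately have "lipschitz_at_0 e0 (\<lambda>e x. 1/2 * ((wfun \<delta> (p x + e *\<^sub>R \<zeta> x) (q x + e *\<^sub>R h x) (r x) *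
      wfun \<delta> (p x + e *\<^sub>R \<zeta> x) (q x + e *\<^sub>R h x) (r x)) * norm (p x + e *\<^sub>R \<zeta> x))
      + lam/2 * ((norm (r x) * norm (r x)) * iv e x) + norm (p x + e *\<^sub>R \<zeta> x)) (\<lambda>x. (X x)\<^sup>2)"
    by (intro lipschitz_at_0_add)
  then have lip: "lipschitz_at_0 e0 \<Phi> (\<lambda>x. (X x)\<^sup>2)"
    unfolding \<Phi>_def[abs_def] lagr_def iv_def power2_eq_square divide_inverse by simp
  then obtain C where C: "C \<ge> 0"
    "\<And>x e. x \<in> I2pi \<Longrightarrow> \<bar>e\<bar> < e0 \<Longrightarrow> norm (\<Phi> e x - \<Phi> 0 x) \<le> C * \<bar>e\<bar> * (X x)\<^sup>2"
    by (rule lipschitz_at_0_E) blast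
  have ep: "energy_LM \<delta> lam (\<lambda>x. \<gamma> x + e *\<^sub>R \<phi> x) \<eta> = (LINT x|leb. \<Phi> e x)" "integrable leb (\<Phi> e)"
    if e: "\<bar>e\<bar> < e0" for e
  proof -
    have nz': "p x + e *\<^sub>R \<zeta> x \<noteq> 0" if "x \<in> I2pi" for x
      using low[OF that e] mM(1) by auto
    show "energy_LM \<delta> lam (\<lambda>x. \<gamma> x + e *\<^sub>R \<phi> x) \<eta> = (LINT x|leb. \<Phi> e x)" "integrable leb (\<Phi> e)"
      unfolding \<Phi>_def[abs_def]
      using energy_formula[OF ac_add[OF \<gamma> ac_scaleR[OF \<phi>, of e]] ac_add[OF p ac_scaleR[OF \<zeta>, of e]] nz' \<eta>
          L2_add[OF q L2_scaleR[OF h, of e]] r, of \<delta> lam] by simp_all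
  qed
  show ?thesis
  proof (rule derivative_of_integral_0[OF e0(1) crit ep])
    show "((\<lambda>e. \<Phi> e x) has_real_derivative dlagr \<delta> lam (p x) (q x) (r x) (\<zeta> x) (h x)) (at 0)" if "x \<in> I2pi" for x
      unfolding \<Phi>_def by (rule lagr_DERIV[OF nz[OF that]])
    show "integrable leb (\<lambda>x. C * (X x)\<^sup>2)" using L2_square[OF XL2] by simp
    show "\<bar>\<Phi> e x - \<Phi> 0 x\<bar> \<le> \<bar>e\<bar> * (C * (X x)\<^sup>2)" if "\<bar>e\<bar> < e0" "x \<in> I2pi" for e x
      using C(2)[OF that(2,1)] by (simp add: mult_ac)
  qed
qed

section \<open>The Euler--Lagrange equations\<close>

lemma integrable_leb_const:
  fixes c :: "'a::euclidean_space"
  shows "integrable leb (\<lambda>x. c)"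
  by (rule continuous_integrable_leb[OF continuous_on_const])

lemma LINT_const:
  fixes c :: "'a::euclidean_space"
  shows "(LINT x|leb. c) = (2 * pi) *\<^sub>R c"
  by (subst LINT_leb) simp_all

lemma LINT_minus_mean:
  fixes f :: "real \<Rightarrow> 'a::euclidean_space"
  assumes "integrable leb f"
  shows "(LINT x|leb. f x - (1 / (2 * pi)) *\<^sub>R (LINT x|leb. f x)) = 0"
  unfolding Bochner_Integration.integral_diff[OF assms integrable_leb_const] LINT_const by simp

lemma L2_zero:
  fixes s :: "real \<Rightarrow> 'a::euclidean_space"
  assumes "s \<in> L2" "(LINT x|leb. s x \<bullet> s x) = 0"
  shows "AE x in leb. s x = 0"
proof -
  have "integrable leb (\<lambda>x. s x \<bullet> s x)" using L2_square[OF assms(1)] by (simp add: power2_norm_eq_inner)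
  then have "AE x in leb. s x \<bullet> s x = 0"
    using assms(2) by (subst (asm) integral_nonneg_eq_0_iff_AE) auto
  then show ?thesis by simp
qed

lemma L2_inner_integrable:
  fixes f g :: "real \<Rightarrow> 'a::euclidean_space"
  assumes "f \<in> L2" "g \<in> L2" shows "integrable leb (\<lambda>x. f x \<bullet> g x)"
  by (rule L2_product_integrable[OF assms])
    (use L2_measurable[OF assms(1)] L2_measurable[OF assms(2)] in \<open>auto simp: Cauchy_Schwarz_ineq2\<close>)

lemma L2_diff:
  fixes f g :: "real \<Rightarrow> 'a::euclidean_space"
  assumes "f \<in> L2" "g \<in> L2" shows "(\<lambda>x. f x - g x) \<in> L2"
  using L2_add[OF assms(1) L2_scaleR[OF assms(2), of "-1"]] by simp

lemma L2_bounded_scaleR: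
  fixes f :: "real \<Rightarrow> real" and g :: "real \<Rightarrow> 'a::euclidean_space"
  assumes f: "f \<in> L2" and g: "continuous_on I2pi g"
  shows "(\<lambda>x. f x *\<^sub>R g x) \<in> L2"
proof -
  obtain C where C: "C > 0" "\<And>x. x \<in> I2pi \<Longrightarrow> norm (g x) \<le> C"
    by (rule continuous_bounded_I2pi[OF g]) blast
  show ?thesis
  proof (rule L2_dominated[OF f, where C = C])
    show "(\<lambda>x. f x *\<^sub>R g x) \<in> borel_measurable leb"
      using L2_measurable[OF f] continuous_measurable_leb[OF g] by measurable
    show "norm (f x *\<^sub>R g x) \<le> C * norm (f x)" if "x \<in> I2pi" for x
      using mult_right_mono[OF C(2)[OF that], of "norm (f x)"] by (simp add: mult.commute)
  qed
qed

lemma LINT_norm_le: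
  fixes f :: "real \<Rightarrow> 'a::euclidean_space" and g :: "real \<Rightarrow> real"
  assumes "integrable leb f" "integrable leb g" "AE x in leb. norm (f x) \<le> g x"
  shows "norm (LINT x|leb. f x) \<le> (LINT x|leb. g x)"
proof -
  have "norm (LINT x|leb. f x) \<le> (LINT x|leb. norm (f x))" by (rule integral_norm_bound)
  also have "\<dots> \<le> (LINT x|leb. g x)" using assms by (intro integral_mono_AE) auto
  finally show ?thesis .
qed

lemma primitive_norm_le:
  fixes f :: "real \<Rightarrow> 'a::euclidean_space"
  assumes "integrable leb f" "x \<in> I2pi"
  shows "norm (integral {0..x} f) \<le> (LINT t|leb. norm (f t))"
proof -
  have "norm (integral {0..x} f) \<le> integral {0..x} (\<lambda>t. norm (f t))"
    using assms by (intro integral_norm_bound_integral integrable_sub_hk) auto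
  also have "\<dots> \<le> integral I2pi (\<lambda>t. norm (f t))"
    using assms by (intro integral_subset_le integrable_sub_hk) auto
  also have "\<dots> = (LINT t|leb. norm (f t))" using assms by (intro LINT_leb[symmetric]) simp
  finally show ?thesis .
qed

text \<open>Mean zero of \<open>h\<close> makes the primitive periodic. Normalising the mean of the
  primitive allows a second integration, as needed to build variations with prescribed second
  derivative.\<close>

lemma mean_zero_primitive:
  fixes h :: "real \<Rightarrow> 'a::euclidean_space"
  assumes "integrable leb h" "(LINT x|leb. h x) = 0"
  obtains H where "ac H h" "H 0 = H (2 * pi)" "(LINT x|leb. H x) = 0"
proof -
  define H0 where "H0 x = 0 + integral {0..x} h" for x
  have a: "ac H0 h" unfolding H0_def by (rule ac_primitive[OF assms(1)])
  define \<mu> where "\<mu> = (1 / (2 * pi)) *\<^sub>R (LINT x|leb. H0 x)"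
  have "ac (\<lambda>x. H0 x + (- \<mu>)) (\<lambda>x. h x + 0)" by (rule ac_add[OF a ac_const])
  then have "ac (\<lambda>x. H0 x - \<mu>) h" by simp
  moreover have "(LINT x|leb. H0 x - \<mu>) = 0"
    unfolding \<mu>_def by (rule LINT_minus_mean[OF continuous_integrable_leb[OF ac_continuous[OF a]]])
  moreover have "H0 0 = H0 (2 * pi)" using ac_total[OF a] assms(2) by simp
  ultimately show thesis by (intro that[of "\<lambda>x. H0 x - \<mu>"]) auto
qed

text \<open>Linking p, q, r by \<open>ac\<close> detaches the argument from the particular functions
  chosen by \<open>wderiv\<close>.\<close>

locale critical_curve =
  fixes \<delta> lam c :: real and \<gamma> \<eta> p q r :: "real \<Rightarrow> real^2"
  assumes lam_pos: "lam > 0" and c_pos: "c > 0"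
    and ac_\<gamma>: "ac \<gamma> p" and ac_p: "ac p q" and ac_\<eta>: "ac \<eta> r"
    and q_L2: "q \<in> L2" and r_L2: "r \<in> L2"
    and speed: "\<And>x. x \<in> I2pi \<Longrightarrow> norm (p x) = c"
    and \<gamma>_per: "\<gamma> 0 = \<gamma> (2 * pi)" and p_per: "p 0 = p (2 * pi)"
    and crit_\<gamma>: "\<And>\<phi>. \<phi> \<in> Hper 2 \<Longrightarrow>
        ((\<lambda>\<epsilon>. energy_LM \<delta> lam (\<lambda>x. \<gamma> x + \<epsilon> *\<^sub>R \<phi> x) \<eta>) has_real_derivative 0) (at 0)"
    and crit_\<eta>: "\<And>\<psi>. \<psi> \<in> Hper 1 \<Longrightarrow>
        ((\<lambda>\<epsilon>. energy_LM \<delta> lam \<gamma> (\<lambda>x. \<eta> x + \<epsilon> *\<^sub>R \<psi> x)) has_real_derivative 0) (at 0)"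
begin

definition "\<tau> x = (1 / c) *\<^sub>R p x"
definition "e x = (1 / c) *\<^sub>R r x"
definition "w x = wfun \<delta> (p x) (q x) (r x)"
definition "\<sigma> x = (\<delta> * w x) *\<^sub>R \<tau> x + lam *\<^sub>R e x"
definition "a = (1 / (2 * pi)) *\<^sub>R (LINT x|leb. \<sigma> x)"
text \<open>In the first variation at constant speed, \<open>Fp\<close> is the coefficient of
  \<phi>' and \<open>Fq\<close> that of \<phi>''.\<close>

definition "Fp x = (1 - 3/2 * (w x)\<^sup>2 - lam/2 * (norm (e x))\<^sup>2) *\<^sub>R \<tau> x + (\<delta> * w x) *\<^sub>R e x"
definition "Fq x = (w x / c) *\<^sub>R rot (\<tau> x)"
definition "m = (1 / (2 * pi)) *\<^sub>R (LINT x|leb. Fp x)"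
text \<open>Subtracting the mean makes \<open>P\<close> vanish at both ends. \<open>d\<close> is the
  constant of integration in the once integrated equation Fq = P + d.\<close>

definition "P x = 0 + integral {0..x} (\<lambda>t. Fp t - m)"
definition "d = (1 / (2 * pi)) *\<^sub>R (LINT x|leb. Fq x - P x)"
text \<open>\<open>W\<close> is the continuous representative of \<open>w\<close>, and \<open>\<kappa>\<close> that of the curvature.\<close>

definition "W x = (P x + d) \<bullet> rot (p x)"
definition "\<kappa> x = ((lam + \<delta>\<^sup>2) * W x - \<delta> * (a \<bullet> \<tau> x)) / lam"

lemma nz: "x \<in> I2pi \<Longrightarrow> p x \<noteq> 0"
  using speed c_pos by (metis less_irrefl norm_zero)

lemma p_eq: "p x = c *\<^sub>R \<tau> x" and r_eq: "r x = c *\<^sub>R e x"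
  using c_pos by (simp_all add: \<tau>_def e_def)

lemma rot_p: "rot (p x) = c *\<^sub>R rot (\<tau> x)"
  by (simp add: p_eq rot_scaleR)

lemma p_inner: "p x \<bullet> v = c * (\<tau> x \<bullet> v)" and inner_p: "v \<bullet> p x = c * (v \<bullet> \<tau> x)"
  and r_inner: "r x \<bullet> v = c * (e x \<bullet> v)" and norm_r: "norm (r x) = c * norm (e x)"
  using c_pos by (simp_all add: p_eq r_eq)

lemma norm_\<tau>: "x \<in> I2pi \<Longrightarrow> norm (\<tau> x) = 1"
  using speed[of x] c_pos by (simp add: \<tau>_def)

lemma \<tau>_\<tau>: "x \<in> I2pi \<Longrightarrow> \<tau> x \<bullet> \<tau> x = 1"
  using norm_\<tau>[of x] by (simp add: norm_eq_1)

lemma p_cont: "continuous_on I2pi p" by (rule ac_continuous[OF ac_p])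

lemma \<tau>_cont: "continuous_on I2pi \<tau>"
  unfolding \<tau>_def[abs_def] by (intro continuous_on_scaleR continuous_on_const p_cont)

lemma rot_\<tau>_cont: "continuous_on I2pi (\<lambda>x. rot (\<tau> x))"
  by (rule bounded_linear.continuous_on[OF bounded_linear_rot \<tau>_cont])

lemma w_L2: "w \<in> L2"
  unfolding w_def[abs_def] by (rule wfun_L2[OF p_cont nz q_L2 r_L2])

lemma e_L2: "e \<in> L2"
  unfolding e_def[abs_def] by (rule L2_scaleR[OF r_L2])

lemma \<sigma>_L2: "\<sigma> \<in> L2"
  unfolding \<sigma>_def[abs_def]
  using L2_add[OF L2_scaleR[OF L2_bounded_scaleR[OF w_L2 \<tau>_cont], of \<delta>] L2_scaleR[OF e_L2, of lam]] by simp

lemma Fq_L2: "Fq \<in> L2"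
  unfolding Fq_def[abs_def]
  using L2_scaleR[OF L2_bounded_scaleR[OF w_L2 rot_\<tau>_cont], of "1 / c"] by simp

lemma sq_integrable: "integrable leb (\<lambda>x. (w x)\<^sup>2)" "integrable leb (\<lambda>x. (norm (e x))\<^sup>2)"
  using L2_square[OF w_L2] L2_square[OF e_L2] by simp_all

lemma Fp_norm: "norm (Fp x) \<le> 1 + 3/2 * (w x)\<^sup>2 + lam/2 * (norm (e x))\<^sup>2 + \<bar>\<delta>\<bar> * ((w x)\<^sup>2 + (norm (e x))\<^sup>2)"
  if "x \<in> I2pi" for x
proof -
  have "norm (Fp x) \<le> \<bar>1 - 3/2 * (w x)\<^sup>2 - lam/2 * (norm (e x))\<^sup>2\<bar> * 1 + \<bar>\<delta>\<bar> * (\<bar>w x\<bar> * norm (e x))"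
    unfolding Fp_def using norm_triangle_ineq[of "(1 - 3/2 * (w x)\<^sup>2 - lam/2 * (norm (e x))\<^sup>2) *\<^sub>R \<tau> x" "(\<delta> * w x) *\<^sub>R e x"]
    by (simp add: norm_\<tau>[OF that] abs_mult mult.assoc)
  also have "\<bar>1 - 3/2 * (w x)\<^sup>2 - lam/2 * (norm (e x))\<^sup>2\<bar> \<le> 1 + 3/2 * (w x)\<^sup>2 + lam/2 * (norm (e x))\<^sup>2"
  proof -
    have "0 \<le> lam/2 * (norm (e x))\<^sup>2" "0 \<le> 3/2 * (w x)\<^sup>2" using lam_pos by simp_all
    then show ?thesis by linarith
  qed
  also have "\<bar>w x\<bar> * norm (e x) \<le> (w x)\<^sup>2 + (norm (e x))\<^sup>2"
  proof -
    have "0 \<le> (\<bar>w x\<bar> - norm (e x))\<^sup>2" by simp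
    then have "2 * (\<bar>w x\<bar> * norm (e x)) \<le> (w x)\<^sup>2 + (norm (e x))\<^sup>2" by (simp add: power2_diff)
    moreover have "0 \<le> \<bar>w x\<bar> * norm (e x)" by simp
    ultimately show ?thesis by linarith
  qed
  finally show ?thesis by (simp add: mult_left_mono)
qed

lemma Fp_bound_integrable:
  "integrable leb (\<lambda>x. 1 + 3/2 * (w x)\<^sup>2 + lam/2 * (norm (e x))\<^sup>2 + \<bar>\<delta>\<bar> * ((w x)\<^sup>2 + (norm (e x))\<^sup>2))"
  by (intro Bochner_Integration.integrable_add integrable_mult_right sq_integrable integrable_leb_const)

lemma Fp_integrable: "integrable leb Fp"
proof (rule integrable_leb_bound[OF Fp_bound_integrable _ Fp_norm])
  show "Fp \<in> borel_measurable leb"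
    unfolding Fp_def[abs_def]
    using L2_measurable[OF w_L2] L2_measurable[OF e_L2] continuous_measurable_leb[OF \<tau>_cont] by measurable
qed

text \<open>|p|^2 is the constant c^2, so its weak derivatives 2 p.q and 0 coincide almost
  everywhere.\<close>

lemma p_orthogonal_q: "AE x in leb. p x \<bullet> q x = 0"
proof -
  have 1: "ac (\<lambda>x. p x \<bullet> p x) (\<lambda>x. q x \<bullet> p x + p x \<bullet> q x)" by (rule ac_inner[OF ac_p ac_p])
  have 2: "ac (\<lambda>x. p x \<bullet> p x) (\<lambda>x. 0)"
    by (rule ac_cong[OF ac_const[of "c\<^sup>2"]]) (use speed in \<open>auto simp: power2_norm_eq_inner[symmetric]\<close>)
  from weak_unique[OF ac_weak[OF 1] ac_weak[OF 2]] show ?thesis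
    by eventually_elim (simp add: inner_commute)
qed

lemma w_eq: "x \<in> I2pi \<Longrightarrow> w x = (q x \<bullet> rot (\<tau> x)) / c\<^sup>2 + \<delta> * (e x \<bullet> \<tau> x)"
proof -
  assume x: "x \<in> I2pi"
  have 1: "q x \<bullet> rot (p x) = c * (q x \<bullet> rot (\<tau> x))" by (simp add: p_eq rot_scaleR)
  have 2: "r x \<bullet> p x = c\<^sup>2 * (e x \<bullet> \<tau> x)" by (simp add: p_eq r_eq power2_eq_square)
  have "c * A / c ^ 3 = A / c\<^sup>2" "c\<^sup>2 * A / c\<^sup>2 = A" for A
    using c_pos by (simp_all add: power3_eq_cube power2_eq_square)
  then show ?thesis unfolding w_def wfun_def speed[OF x] 1 2 by simp
qed

text \<open>Orthogonality to \<tau> leaves only the normal component of \<gamma>'', which is c^2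
  times the curvature w - \<delta> div \<eta>.\<close>

lemma q_eq: "AE x in leb. x \<in> I2pi \<and> q x = (c\<^sup>2 * (w x - \<delta> * (e x \<bullet> \<tau> x))) *\<^sub>R rot (\<tau> x)"
proof -
  have "AE x in leb. x \<in> I2pi" by (rule AE_leb_I)
  with p_orthogonal_q show ?thesis
  proof eventually_elim
    case (elim x)
    then have x: "x \<in> I2pi" and o: "\<tau> x \<bullet> q x = 0" using c_pos by (auto simp: p_eq)
    have cw: "c\<^sup>2 * (w x - \<delta> * (e x \<bullet> \<tau> x)) = q x \<bullet> rot (\<tau> x)"
      unfolding w_eq[OF x] using c_pos by simp
    have "q x = (\<tau> x \<bullet> \<tau> x) *\<^sub>R q x" using \<tau>_\<tau>[OF x] by simp
    also have "\<dots> = (\<tau> x \<bullet> q x) *\<^sub>R \<tau> x + (q x \<bullet> rot (\<tau> x)) *\<^sub>R rot (\<tau> x)"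
      by (simp add: vec2_eq_iff inner2 algebra_simps)
    finally show ?case using x o cw by simp
  qed
qed

text \<open>The variation is a primitive of s = \<sigma> - a itself, periodic because s has mean
  zero. It yields that the integral of \<sigma>.s vanishes; that of a.s does too, hence so does that
  of |s|^2.\<close>

lemma \<sigma>_const: "AE x in leb. \<sigma> x = a"
proof -
  define s where "s x = \<sigma> x - a" for x
  have sL2: "s \<in> L2" unfolding s_def[abs_def] by (rule L2_diff[OF \<sigma>_L2 L2_const])
  note \<sigma>i = L2_integrable[OF \<sigma>_L2] and si = L2_integrable[OF sL2]
  have s0: "(LINT x|leb. s x) = 0"
    unfolding s_def a_def by (rule LINT_minus_mean[OF \<sigma>i])
  obtain \<psi> where \<psi>: "ac \<psi> s" "\<psi> 0 = \<psi> (2 * pi)" by (rule mean_zero_primitive[OF si s0])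
  have "(LINT x|leb. \<delta> * wfun \<delta> (p x) (q x) (r x) * ((s x \<bullet> p x) / norm (p x)) + lam * ((r x \<bullet> s x) / norm (p x))) = 0"
    by (rule eta_variation[OF ac_\<gamma> ac_p nz ac_\<eta> q_L2 r_L2 \<psi>(1) sL2 crit_\<eta>[OF Hper1_I(1)[OF \<psi>(1) sL2 \<psi>(2)]]])
  also have "(LINT x|leb. \<delta> * wfun \<delta> (p x) (q x) (r x) * ((s x \<bullet> p x) / norm (p x)) + lam * ((r x \<bullet> s x) / norm (p x)))
    = (LINT x|leb. \<sigma> x \<bullet> s x)"
  proof (rule Bochner_Integration.integral_cong)
    fix x assume "x \<in> space leb"
    then have x: "x \<in> I2pi" by simp
    show "\<delta> * wfun \<delta> (p x) (q x) (r x) * ((s x \<bullet> p x) / norm (p x)) + lam * ((r x \<bullet> s x) / norm (p x)) = \<sigma> x \<bullet> s x"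
    proof -
      have 1: "s x \<bullet> p x / c = \<tau> x \<bullet> s x" by (simp add: \<tau>_def inner_commute)
      have 2: "r x \<bullet> s x / c = e x \<bullet> s x" by (simp add: e_def)
      show ?thesis
        unfolding w_def[symmetric] speed[OF x] 1 2 by (simp add: \<sigma>_def inner_add_left)
    qed
  qed simp
  finally have "(LINT x|leb. \<sigma> x \<bullet> s x) = 0" .
  moreover have "(LINT x|leb. s x \<bullet> s x) = (LINT x|leb. \<sigma> x \<bullet> s x) - (LINT x|leb. a \<bullet> s x)"
    using L2_inner_integrable[OF \<sigma>_L2 sL2] L2_inner_integrable[OF L2_const sL2, of a]
    by (subst Bochner_Integration.integral_diff[symmetric]) (auto simp: s_def inner_diff_left)
  moreover have "(LINT x|leb. a \<bullet> s x) = a \<bullet> (LINT x|leb. s x)"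
    using si by (intro integral_inner_right) auto
  ultimately have "(LINT x|leb. s x \<bullet> s x) = 0" using s0 by simp
  from L2_zero[OF sL2 this] show ?thesis by (simp add: s_def)
qed

text \<open>The quantifiers over directions stand inside the \<open>AE\<close>: one null set serves
  all of them, so directions depending on x can be inserted.\<close>

lemma dlagr_eq:
  "AE x in leb. \<forall>\<zeta> h. dlagr \<delta> lam (p x) (q x) (r x) \<zeta> h = Fp x \<bullet> \<zeta> + Fq x \<bullet> h"
  using q_eq
proof eventually_elim
  case (elim x)
  define k where "k = w x - \<delta> * (e x \<bullet> \<tau> x)"
  have x: "x \<in> I2pi" and q: "q x = (c\<^sup>2 * k) *\<^sub>R rot (\<tau> x)" using elim by (auto simp: k_def)
  have qp: "q x \<bullet> rot (p x) = c ^ 3 * k"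
  proof -
    have "q x \<bullet> rot (p x) = (c\<^sup>2 * k) *\<^sub>R rot (\<tau> x) \<bullet> rot (c *\<^sub>R \<tau> x)" by (simp only: q p_eq)
    then show ?thesis
      using \<tau>_\<tau>[OF x] by (simp add: rot_scaleR inner_rot_rot power2_eq_square power3_eq_cube)
  qed
  have qz: "q x \<bullet> rot \<zeta> = c\<^sup>2 * k * (\<tau> x \<bullet> \<zeta>)" for \<zeta>
    by (simp only: q) (simp add: inner_rot_rot)
  have wk: "w x = k + \<delta> * (e x \<bullet> \<tau> x)" by (simp add: k_def)
  show ?case
  proof (intro allI)
    fix \<zeta> h
    have "dlagr \<delta> lam (p x) (q x) (r x) \<zeta> h =
      w x * c * ((c * (h \<bullet> rot (\<tau> x)) + c\<^sup>2 * k * (\<tau> x \<bullet> \<zeta>)) / c ^ 3 - 3 * (c ^ 3 * k) * (c * (\<tau> x \<bullet> \<zeta>)) / c ^ 5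
        + \<delta> * ((c * (e x \<bullet> \<zeta>)) / c\<^sup>2 - 2 * (c\<^sup>2 * (e x \<bullet> \<tau> x)) * (c * (\<tau> x \<bullet> \<zeta>)) / c ^ 4))
     + 1/2 * (w x)\<^sup>2 * (c * (\<tau> x \<bullet> \<zeta>)) / c
     - lam/2 * (c\<^sup>2 * (norm (e x))\<^sup>2) * (c * (\<tau> x \<bullet> \<zeta>)) / c ^ 3 + (c * (\<tau> x \<bullet> \<zeta>)) / c"
      by (simp only: dlagr_def w_def[symmetric] speed[OF x] qp, simp only: qz,
          simp only: rot_p p_inner r_inner inner_p norm_r inner_scaleR_right)
        (simp add: power2_eq_square mult_ac)
    also have "\<dots> = w x * (h \<bullet> rot (\<tau> x)) / c + (\<tau> x \<bullet> \<zeta>) * (- 2 * w x * k - 2 * \<delta> * w x * (e x \<bullet> \<tau> x) + 1/2 * (w x)\<^sup>2 - lam/2 * (norm (e x))\<^sup>2 + 1)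
        + \<delta> * w x * (e x \<bullet> \<zeta>)"
    proof -
      have "W * c * ((c * A + c\<^sup>2 * k * T) / c ^ 3 - 3 * (c ^ 3 * k) * (c * T) / c ^ 5
          + \<delta> * ((c * E) / c\<^sup>2 - 2 * (c\<^sup>2 * D) * (c * T) / c ^ 4))
          + 1/2 * W\<^sup>2 * (c * T) / c - lam/2 * (c\<^sup>2 * N) * (c * T) / c ^ 3 + (c * T) / c
        = W * A / c + T * (- 2 * W * k - 2 * \<delta> * W * D + 1/2 * W\<^sup>2 - lam/2 * N + 1) + \<delta> * W * E"
        for W A T E D N :: real
        using c_pos by (simp add: field_simps power_numeral_reduce)
      then show ?thesis by blast
    qed
    \<comment> \<open>Since k + \<delta> e.\<tau> = w, the first two terms add up to -2w^2; this is
      where the coefficient -3/2 comes from.\<close>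
    also have "- 2 * w x * k - 2 * \<delta> * w x * (e x \<bullet> \<tau> x) + 1/2 * (w x)\<^sup>2 - lam/2 * (norm (e x))\<^sup>2 + 1 =
       1 - 3/2 * (w x)\<^sup>2 - lam/2 * (norm (e x))\<^sup>2"
      by (simp add: k_def power2_eq_square algebra_simps)
    finally show "dlagr \<delta> lam (p x) (q x) (r x) \<zeta> h = Fp x \<bullet> \<zeta> + Fq x \<bullet> h"
      by (simp add: Fp_def Fq_def inner_add_left inner_add_right inner_commute mult_ac)
  qed
qed

lemma first_variation:
  assumes \<phi>: "ac \<phi> \<zeta>" and \<zeta>: "ac \<zeta> h" and h: "h \<in> L2" and per: "\<phi> 0 = \<phi> (2 * pi)" "\<zeta> 0 = \<zeta> (2 * pi)"
  shows "(LINT x|leb. Fp x \<bullet> \<zeta> x + Fq x \<bullet> h x) = 0"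
proof -
  have "(LINT x|leb. dlagr \<delta> lam (p x) (q x) (r x) (\<zeta> x) (h x)) = 0"
    by (rule gamma_variation[OF ac_\<gamma> ac_p nz ac_\<eta> q_L2 r_L2 \<phi> \<zeta> h crit_\<gamma>[OF Hper2_I(1)[OF \<phi> \<zeta> h per]]])
  moreover have "(LINT x|leb. dlagr \<delta> lam (p x) (q x) (r x) (\<zeta> x) (h x)) = (LINT x|leb. Fp x \<bullet> \<zeta> x + Fq x \<bullet> h x)"
    by (rule integral_leb_cong_AE) (use dlagr_eq in auto)
  ultimately show ?thesis by simp
qed

text \<open>The variation \<open>\<phi> = \<gamma>\<close> is the derivative of the energy under scaling.\<close>

lemma scaling_identity: "(LINT x|leb. 1/2 * (w x)\<^sup>2 + lam/2 * (norm (e x))\<^sup>2) = 2 * pi"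
proof -
  have "(LINT x|leb. Fp x \<bullet> p x + Fq x \<bullet> q x) = 0"
    by (rule first_variation[OF ac_\<gamma> ac_p q_L2 \<gamma>_per p_per])
  \<comment> \<open>The terms with \<delta> w e.\<tau> cancel between the two products, and Fq.q
    contributes c w^2.\<close>
  moreover have "AE x in leb. Fp x \<bullet> p x + Fq x \<bullet> q x = c * (1 - (1/2 * (w x)\<^sup>2 + lam/2 * (norm (e x))\<^sup>2))"
    using q_eq
  proof eventually_elim
    case (elim x)
    then have x: "x \<in> I2pi" and q: "q x = (c\<^sup>2 * (w x - \<delta> * (e x \<bullet> \<tau> x))) *\<^sub>R rot (\<tau> x)" by auto
    have "Fp x \<bullet> p x = c * (1 - 3/2 * (w x)\<^sup>2 - lam/2 * (norm (e x))\<^sup>2) + c * \<delta> * w x * (e x \<bullet> \<tau> x)"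
      using \<tau>_\<tau>[OF x] by (simp add: inner_p Fp_def inner_add_left distrib_left mult.assoc)
    moreover have "Fq x \<bullet> q x = c * w x * (w x - \<delta> * (e x \<bullet> \<tau> x))"
    proof -
      have "Fq x \<bullet> q x = (w x / c) *\<^sub>R rot (\<tau> x) \<bullet> ((c\<^sup>2 * (w x - \<delta> * (e x \<bullet> \<tau> x))) *\<^sub>R rot (\<tau> x))"
        by (simp only: Fq_def q)
      then show ?thesis using \<tau>_\<tau>[OF x] c_pos by (simp add: inner_rot_rot power2_eq_square)
    qed
    ultimately show ?case by (simp add: power2_eq_square algebra_simps)
  qed
  then have "(LINT x|leb. Fp x \<bullet> p x + Fq x \<bullet> q x) = (LINT x|leb. c * (1 - (1/2 * (w x)\<^sup>2 + lam/2 * (norm (e x))\<^sup>2)))"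
    by (rule integral_leb_cong_AE)
  ultimately have "(LINT x|leb. 1 - (1/2 * (w x)\<^sup>2 + lam/2 * (norm (e x))\<^sup>2)) = 0"
    using c_pos by simp
  moreover have "integrable leb (\<lambda>x. 1/2 * (w x)\<^sup>2 + lam/2 * (norm (e x))\<^sup>2)"
    by (intro Bochner_Integration.integrable_add integrable_mult_right sq_integrable)
  ultimately show ?thesis
    using Bochner_Integration.integral_diff[OF integrable_leb_const[of "1::real"]] LINT_const[of "1::real"] by simp
qed

text \<open>Both terms of the scaling identity are nonnegative, so each is at most 2 pi. The third
  combination, which occurs in \<open>Fp_norm\<close>, is at most three times their sum.\<close>

lemma w_square: "(LINT x|leb. (w x)\<^sup>2) \<le> 4 * pi" and e_square: "(LINT x|leb. (norm (e x))\<^sup>2) \<le> 4 * pi / lam"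
  and half_square: "3/2 * (LINT x|leb. (w x)\<^sup>2) + lam/2 * (LINT x|leb. (norm (e x))\<^sup>2) \<le> 6 * pi"
proof -
  define A B where "A = (LINT x|leb. (w x)\<^sup>2)" and "B = (LINT x|leb. (norm (e x))\<^sup>2)"
  have AB: "A \<ge> 0" "B \<ge> 0" unfolding A_def B_def by simp_all
  have "1/2 * A + lam/2 * B = 2 * pi"
    using scaling_identity Bochner_Integration.integral_add[OF integrable_mult_right[OF sq_integrable(1), of "1/2"]
      integrable_mult_right[OF sq_integrable(2), of "lam/2"]]
    unfolding A_def B_def by (simp only: integral_mult_right_zero)
  moreover have "lam * B \<ge> 0" using AB lam_pos by simp
  ultimately have 1: "A \<le> 4 * pi" and 2: "lam * B \<le> 4 * pi" and 3: "3/2 * A + lam/2 * B \<le> 6 * pi"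
    using AB by linarith+
  show "A \<le> 4 * pi" "B \<le> 4 * pi / lam" "3/2 * A + lam/2 * B \<le> 6 * pi"
    using 1 2 3 lam_pos by (simp_all add: field_simps)
qed

lemma P_ac: "ac P (\<lambda>x. Fp x - m)"
  unfolding P_def[abs_def] by (rule ac_primitive) (use Fp_integrable in simp)

lemma P_ends: "P 0 = 0" "P (2 * pi) = 0"
proof -
  show "P 0 = 0" by (simp add: P_def)
  have "P (2 * pi) - P 0 = (LINT x|leb. Fp x - m)" by (rule ac_total[OF P_ac])
  also have "\<dots> = 0"
    unfolding m_def by (rule LINT_minus_mean[OF Fp_integrable])
  finally show "P (2 * pi) = 0" by (simp add: P_def)
qed

lemma P_L2: "P \<in> L2" by (rule continuous_L2[OF ac_continuous[OF P_ac]])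

text \<open>The variation has second derivative h = Fq - P - d, of mean zero by the choice of
  \<open>d\<close>, so two periodic integrations are possible. Integrating P.\<zeta> by parts trades
  Fp.\<zeta> for -P.h up to m.\<zeta>, and what remains is that the integral of |h|^2
  vanishes.\<close>

lemma Fq_eq: "AE x in leb. Fq x = P x + d"
proof -
  define h where "h x = Fq x - P x - d" for x
  have hL2: "h \<in> L2" unfolding h_def[abs_def] by (intro L2_diff Fq_L2 P_L2 L2_const)
  have FPi: "integrable leb (\<lambda>x. Fq x - P x)" by (rule L2_integrable[OF L2_diff[OF Fq_L2 P_L2]])
  have h0: "(LINT x|leb. h x) = 0"
    unfolding h_def d_def by (rule LINT_minus_mean[OF FPi])
  obtain \<zeta> where \<zeta>: "ac \<zeta> h" "\<zeta> 0 = \<zeta> (2 * pi)" "(LINT x|leb. \<zeta> x) = 0"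
    by (rule mean_zero_primitive[OF L2_integrable[OF hL2] h0])
  note \<zeta>i = continuous_integrable_leb[OF ac_continuous[OF \<zeta>(1)]]
  have \<zeta>L2: "\<zeta> \<in> L2" by (rule continuous_L2[OF ac_continuous[OF \<zeta>(1)]])
  obtain \<phi> where \<phi>: "ac \<phi> \<zeta>" "\<phi> 0 = \<phi> (2 * pi)"
    by (rule mean_zero_primitive[OF \<zeta>i \<zeta>(3)])
  have v: "(LINT x|leb. Fp x \<bullet> \<zeta> x + Fq x \<bullet> h x) = 0"
    by (rule first_variation[OF \<phi>(1) \<zeta>(1) hL2 \<phi>(2) \<zeta>(2)])
  \<comment> \<open>The integrand is the derivative of P.\<zeta>, and \<open>P\<close> is zero at
    both ends.\<close>
  have v2: "(LINT x|leb. (Fp x - m) \<bullet> \<zeta> x + P x \<bullet> h x) = 0"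
    using ac_total[OF ac_inner[OF P_ac \<zeta>(1)]] P_ends by simp
  have i1: "integrable leb (\<lambda>x. Fp x \<bullet> \<zeta> x)"
    using integrable_prod_continuous[OF bounded_bilinear_inner ac_continuous[OF \<zeta>(1)] Fp_integrable]
    by (simp add: inner_commute)
  have i2: "integrable leb (\<lambda>x. Fq x \<bullet> h x)" "integrable leb (\<lambda>x. P x \<bullet> h x)" "integrable leb (\<lambda>x. m \<bullet> \<zeta> x)"
      "integrable leb (\<lambda>x. d \<bullet> h x)"
    by (intro L2_inner_integrable Fq_L2 P_L2 hL2 L2_const \<zeta>L2)+
  have "(LINT x|leb. h x \<bullet> h x) = (LINT x|leb. (Fp x \<bullet> \<zeta> x + Fq x \<bullet> h x) - ((Fp x - m) \<bullet> \<zeta> x + P x \<bullet> h x) - m \<bullet> \<zeta> x - d \<bullet> h x)"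
    by (simp add: h_def inner_diff_left)
  also have "\<dots> = (LINT x|leb. Fp x \<bullet> \<zeta> x + Fq x \<bullet> h x) - (LINT x|leb. (Fp x - m) \<bullet> \<zeta> x + P x \<bullet> h x)
      - (LINT x|leb. m \<bullet> \<zeta> x) - (LINT x|leb. d \<bullet> h x)"
  proof -
    have j1: "integrable leb (\<lambda>x. Fp x \<bullet> \<zeta> x + Fq x \<bullet> h x)" using i1 i2 by simp
    have j2: "integrable leb (\<lambda>x. (Fp x - m) \<bullet> \<zeta> x + P x \<bullet> h x)" using i1 i2 by (simp add: inner_diff_left)
    note k1 = Bochner_Integration.integrable_diff[OF j1 j2]
    note k2 = Bochner_Integration.integrable_diff[OF k1 i2(3)]
    show ?thesis
      unfolding Bochner_Integration.integral_diff[OF k2 i2(4)] Bochner_Integration.integral_diff[OF k1 i2(3)]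
        Bochner_Integration.integral_diff[OF j1 j2] ..
  qed
  also have "(LINT x|leb. m \<bullet> \<zeta> x) = 0" using \<zeta>i \<zeta>(3) integral_inner_right[of m leb \<zeta>] by simp
  also have "(LINT x|leb. d \<bullet> h x) = 0" using L2_integrable[OF hL2] h0 integral_inner_right[of d leb h] by simp
  finally have "(LINT x|leb. h x \<bullet> h x) = 0" using v v2 by simp
  from L2_zero[OF hL2 this] show ?thesis by eventually_elim (simp add: h_def algebra_simps)
qed

text \<open>Fq is (w/c) J\<tau>, and its product with Jp = c J\<tau> recovers w; replacing Fq by P +
  d makes the expression continuous.\<close>

lemma W_AE: "AE x in leb. w x = W x"
proof -
  have "AE x in leb. x \<in> I2pi" by (rule AE_leb_I)
  with Fq_eq show ?thesis
  proof eventually_elim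
    case (elim x)
    then have "W x = Fq x \<bullet> rot (p x)" by (simp add: W_def)
    also have "\<dots> = w x" using c_pos \<tau>_\<tau>[of x] elim(2) by (simp add: rot_p Fq_def inner_rot_rot)
    finally show ?case by simp
  qed
qed

lemma ac_Pd: "ac (\<lambda>x. P x + d) (\<lambda>x. Fp x - m)"
  using ac_add[OF P_ac ac_const[of d]] by simp

lemma ac_rot_p: "ac (\<lambda>x. rot (p x)) (\<lambda>x. rot (q x))"
  by (rule ac_linear[OF ac_p bounded_linear_rot])

lemma W_ac0: "ac W (\<lambda>x. (Fp x - m) \<bullet> rot (p x) + (P x + d) \<bullet> rot (q x))"
  unfolding W_def[abs_def] by (rule ac_inner[OF ac_Pd ac_rot_p])

lemma W_cont: "continuous_on I2pi W" by (rule ac_continuous[OF W_ac0])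

text \<open>Continuity turns the almost everywhere identity into a pointwise one: P + d has no
  tangential part.\<close>

lemma Pd_eq: "x \<in> I2pi \<Longrightarrow> P x + d = (W x / c) *\<^sub>R rot (\<tau> x)"
proof (rule continuous_AE_eq)
  show "continuous_on I2pi (\<lambda>x. P x + d)" by (rule ac_continuous[OF ac_Pd])
  have "continuous_on I2pi (\<lambda>x. W x / c)" using c_pos by (intro continuous_on_divide W_cont continuous_on_const) auto
  then show "continuous_on I2pi (\<lambda>x. (W x / c) *\<^sub>R rot (\<tau> x))"
    by (intro continuous_on_scaleR rot_\<tau>_cont)
  show "AE x in leb. P x + d = (W x / c) *\<^sub>R rot (\<tau> x)"
    using Fq_eq W_AE by eventually_elim (simp add: Fq_def)
qed

lemma e_eq: "AE x in leb. x \<in> I2pi \<and> w x = W x \<and> e x = (1 / lam) *\<^sub>R (a - (\<delta> * W x) *\<^sub>R \<tau> x)"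
proof -
  have "AE x in leb. x \<in> I2pi" by (rule AE_leb_I)
  with \<sigma>_const W_AE show ?thesis
  proof eventually_elim
    case (elim x)
    have "a - (\<delta> * W x) *\<^sub>R \<tau> x = lam *\<^sub>R e x" using elim by (simp add: \<sigma>_def algebra_simps)
    then show ?case using elim lam_pos by simp
  qed
qed

text \<open>Inserting the tangential component (a.\<tau> - \<delta>W)/lam of e into w - \<delta>
  e.\<tau> produces the formula in \<open>\<kappa>_def\<close>, so \<gamma>'' is a continuous
  function of \<tau> and \<open>W\<close>.\<close>

lemma all_eq: "AE x in leb. x \<in> I2pi \<and> w x = W x \<and> e x = (1 / lam) *\<^sub>R (a - (\<delta> * W x) *\<^sub>R \<tau> x) \<and>
    q x = (c\<^sup>2 * \<kappa> x) *\<^sub>R rot (\<tau> x)"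
  using e_eq q_eq
proof eventually_elim
  case (elim x)
  then have x: "x \<in> I2pi" by simp
  have "w x - \<delta> * (e x \<bullet> \<tau> x) = \<kappa> x"
  proof -
    have wx: "w x = W x" and ex: "e x = (1 / lam) *\<^sub>R (a - (\<delta> * W x) *\<^sub>R \<tau> x)" using elim(1) by blast+
    have eq: "e x \<bullet> \<tau> x = (1 / lam) * (a \<bullet> \<tau> x - \<delta> * W x)"
      by (simp only: ex) (simp add: inner_diff_left \<tau>_\<tau>[OF x])
    show ?thesis
      unfolding wx \<kappa>_def eq using lam_pos by (simp add: field_simps power2_eq_square)
  qed
  then show ?case using elim by simp
qed

section \<open>Classical derivatives: the closed system for \<open>\<tau>\<close> and
  \<open>W\<close>\<close>

lemma \<kappa>_cont: "continuous_on I2pi \<kappa>"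
  unfolding \<kappa>_def[abs_def] using lam_pos
  by (intro continuous_on_divide continuous_on_diff continuous_on_mult continuous_on_inner continuous_on_const W_cont \<tau>_cont) auto

lemma \<gamma>_deriv: "x \<in> I2pi \<Longrightarrow> (\<gamma> has_vector_derivative c *\<^sub>R \<tau> x) (at x within I2pi)"
  using ac_vector_derivative[OF ac_\<gamma> p_cont] p_eq by simp

lemma \<tau>_deriv: "x \<in> I2pi \<Longrightarrow> (\<tau> has_vector_derivative (c * \<kappa> x) *\<^sub>R rot (\<tau> x)) (at x within I2pi)"
proof (rule ac_vector_derivative)
  have "ac \<tau> (\<lambda>x. (1 / c) *\<^sub>R q x)" unfolding \<tau>_def[abs_def] by (rule ac_scaleR[OF ac_p])
  then show "ac \<tau> (\<lambda>x. (c * \<kappa> x) *\<^sub>R rot (\<tau> x))"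
    by (rule ac_cong) (use all_eq c_pos in \<open>auto simp: power2_eq_square elim: AE_mp\<close>)
  show "continuous_on I2pi (\<lambda>x. (c * \<kappa> x) *\<^sub>R rot (\<tau> x))"
    by (intro continuous_on_scaleR continuous_on_mult continuous_on_const \<kappa>_cont rot_\<tau>_cont)
qed

lemma \<eta>_deriv: "x \<in> I2pi \<Longrightarrow> (\<eta> has_vector_derivative (c / lam) *\<^sub>R (a - (\<delta> * W x) *\<^sub>R \<tau> x)) (at x within I2pi)"
proof (rule ac_vector_derivative)
  show "ac \<eta> (\<lambda>x. (c / lam) *\<^sub>R (a - (\<delta> * W x) *\<^sub>R \<tau> x))"
  proof (rule ac_cong[OF ac_\<eta>])
    show "AE x in leb. r x = (c / lam) *\<^sub>R (a - (\<delta> * W x) *\<^sub>R \<tau> x)"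
      using e_eq by eventually_elim (simp add: r_eq)
  qed simp
  show "continuous_on I2pi (\<lambda>x. (c / lam) *\<^sub>R (a - (\<delta> * W x) *\<^sub>R \<tau> x))"
    by (intro continuous_on_scaleR continuous_on_diff continuous_on_mult continuous_on_const W_cont \<tau>_cont)
qed

text \<open>Differentiating (P + d).Jp, the term (P + d).Jq vanishes: P + d is normal while Jq is
  tangential. In Fp.Jp the whole \<tau> part drops, and of e only the normal part of a/lam
  survives.\<close>

lemma W_deriv: "x \<in> I2pi \<Longrightarrow>
  (W has_vector_derivative c * (\<delta> / lam * W x * (a \<bullet> rot (\<tau> x)) - m \<bullet> rot (\<tau> x))) (at x within I2pi)"
proof (rule ac_vector_derivative)
  show "ac W (\<lambda>x. c * (\<delta> / lam * W x * (a \<bullet> rot (\<tau> x)) - m \<bullet> rot (\<tau> x)))"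
  proof (rule ac_cong[OF W_ac0])
    show "AE x in leb. (Fp x - m) \<bullet> rot (p x) + (P x + d) \<bullet> rot (q x) =
        c * (\<delta> / lam * W x * (a \<bullet> rot (\<tau> x)) - m \<bullet> rot (\<tau> x))"
      using all_eq
    proof eventually_elim
      case (elim x)
      then have x: "x \<in> I2pi" by simp
      have "(P x + d) \<bullet> rot (q x) = 0"
        unfolding Pd_eq[OF x] using elim by (simp add: rot_scaleR inner_rot_rot inner_rot_left inner_rot_self inner_commute)
      moreover have "Fp x \<bullet> rot (p x) = c * (\<delta> / lam * W x * (a \<bullet> rot (\<tau> x)))"
        using elim by (simp add: rot_p Fp_def inner_add_left inner_diff_left inner_rot_self)
      moreover have "m \<bullet> rot (p x) = c * (m \<bullet> rot (\<tau> x))" by (simp add: rot_p)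
      ultimately show ?case by (simp add: inner_diff_left right_diff_distrib)
    qed
  qed simp
  show "continuous_on I2pi (\<lambda>x. c * (\<delta> / lam * W x * (a \<bullet> rot (\<tau> x)) - m \<bullet> rot (\<tau> x)))"
    by (intro continuous_on_diff continuous_on_mult continuous_on_inner continuous_on_const W_cont rot_\<tau>_cont)
qed

lemma \<tau>_per: "\<tau> 0 = \<tau> (2 * pi)" and W_per: "W 0 = W (2 * pi)"
  using p_per P_ends by (simp_all add: \<tau>_def W_def)

section \<open>Bounds in terms of \<open>\<delta>\<close>, \<open>lam\<close> and
  \<open>c\<close>\<close>

lemma le_one_plus_square: "\<bar>t\<bar> \<le> 1 + t\<^sup>2" for t :: real
  using zero_le_power2[of "\<bar>t\<bar> - 1"] by (simp add: power2_diff)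

text \<open>The mean of |\<sigma>| is estimated with |t| \<le> 1 + t^2: the 1 gives |\<delta>| +
  lam, and the means of w^2 and lam |e|^2, each at most 2, give 2|\<delta>| + 2.\<close>

lemma a_bound: "norm a \<le> 3 * \<bar>\<delta>\<bar> + lam + 2"
proof -
  have "norm (LINT x|leb. \<sigma> x) \<le> (LINT x|leb. (\<bar>\<delta>\<bar> + lam) + \<bar>\<delta>\<bar> * (w x)\<^sup>2 + lam * (norm (e x))\<^sup>2)"
  proof (rule LINT_norm_le[OF L2_integrable[OF \<sigma>_L2]])
    show "AE x in leb. norm (\<sigma> x) \<le> (\<bar>\<delta>\<bar> + lam) + \<bar>\<delta>\<bar> * (w x)\<^sup>2 + lam * (norm (e x))\<^sup>2"
    proof (rule AE_leb_I)
      fix x :: real assume x: "x \<in> I2pi"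
      have "norm (\<sigma> x) \<le> \<bar>\<delta>\<bar> * \<bar>w x\<bar> + lam * norm (e x)"
        unfolding \<sigma>_def using norm_triangle_ineq[of "(\<delta> * w x) *\<^sub>R \<tau> x" "lam *\<^sub>R e x"] lam_pos
        by (simp add: norm_\<tau>[OF x] abs_mult)
      also have "\<dots> \<le> \<bar>\<delta>\<bar> * (1 + (w x)\<^sup>2) + lam * (1 + (norm (e x))\<^sup>2)"
        using lam_pos le_one_plus_square[of "w x"] le_one_plus_square[of "norm (e x)"]
        by (intro add_mono mult_left_mono) auto
      finally show "norm (\<sigma> x) \<le> (\<bar>\<delta>\<bar> + lam) + \<bar>\<delta>\<bar> * (w x)\<^sup>2 + lam * (norm (e x))\<^sup>2"
        by (simp add: algebra_simps)
    qed
  qed (intro Bochner_Integration.integrable_add integrable_mult_right sq_integrable integrable_leb_const)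
  also have "\<dots> = (2 * pi) * (\<bar>\<delta>\<bar> + lam) + \<bar>\<delta>\<bar> * (LINT x|leb. (w x)\<^sup>2) + lam * (LINT x|leb. (norm (e x))\<^sup>2)"
    using LINT_const[of "\<bar>\<delta>\<bar> + lam"]
    by (simp only: Bochner_Integration.integral_add[OF Bochner_Integration.integrable_add[OF integrable_leb_const
            integrable_mult_right[OF sq_integrable(1)]] integrable_mult_right[OF sq_integrable(2)]]
          Bochner_Integration.integral_add[OF integrable_leb_const integrable_mult_right[OF sq_integrable(1)]]
          integral_mult_right_zero real_scaleR_def)
  also have "\<dots> \<le> (2 * pi) * (\<bar>\<delta>\<bar> + lam) + \<bar>\<delta>\<bar> * (4 * pi) + lam * (4 * pi / lam)"
    using lam_pos by (intro add_mono mult_left_mono w_square e_square order_refl) auto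
  also have "\<dots> = (2 * pi) * (3 * \<bar>\<delta>\<bar> + lam + 2)" using lam_pos by (simp add: algebra_simps)
  finally show ?thesis by (simp add: a_def divide_le_eq mult.commute)
qed

text \<open>A bound for the mean of |Fp|: 1 + 3 from the constant and \<open>half_square\<close>,
  rounded up to 5, and the rest from the mixed term.\<close>

definition "B = 5 + 2 * \<bar>\<delta>\<bar> * (1 + 1 / lam)"

lemma Fp_norm_integral: "(LINT x|leb. norm (Fp x)) \<le> 2 * pi * B"
proof -
  have "(LINT x|leb. norm (Fp x)) \<le>
     (LINT x|leb. 1 + 3/2 * (w x)\<^sup>2 + lam/2 * (norm (e x))\<^sup>2 + \<bar>\<delta>\<bar> * ((w x)\<^sup>2 + (norm (e x))\<^sup>2))"
    using Fp_integrable Fp_bound_integrable by (intro integral_mono_AE AE_leb_I Fp_norm) auto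
  also have "\<dots> = 2 * pi + (3/2 * (LINT x|leb. (w x)\<^sup>2) + lam/2 * (LINT x|leb. (norm (e x))\<^sup>2))
      + \<bar>\<delta>\<bar> * ((LINT x|leb. (w x)\<^sup>2) + (LINT x|leb. (norm (e x))\<^sup>2))"
  proof -
    note i = integrable_mult_right[OF sq_integrable(1), of "3/2"] integrable_mult_right[OF sq_integrable(2), of "lam/2"]
    note j = Bochner_Integration.integrable_add[OF sq_integrable]
    have k: "integrable leb (\<lambda>x. 1::real)" by (rule integrable_leb_const)
    note l = Bochner_Integration.integrable_add[OF k i(1)]
    show ?thesis
      unfolding Bochner_Integration.integral_add[OF Bochner_Integration.integrable_add[OF l i(2)] integrable_mult_right[OF j, of "\<bar>\<delta>\<bar>"]]
        Bochner_Integration.integral_add[OF l i(2)] Bochner_Integration.integral_add[OF k i(1)]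
      unfolding LINT_const integral_mult_right_zero Bochner_Integration.integral_add[OF sq_integrable] by simp
  qed
  also have "\<dots> \<le> 2 * pi + 6 * pi + \<bar>\<delta>\<bar> * (4 * pi + 4 * pi / lam)"
    by (intro add_mono mult_left_mono w_square e_square half_square order_refl) auto
  also have "\<dots> \<le> 2 * pi * B" using pi_gt_zero by (simp add: B_def algebra_simps)
  finally show ?thesis .
qed

lemma B_pos: "B > 0"
  unfolding B_def using lam_pos by (intro add_pos_nonneg) auto

lemma m_bound: "norm m \<le> B"
proof -
  have "norm (LINT x|leb. Fp x) \<le> 2 * pi * B"
    using integral_norm_bound[of leb Fp] Fp_norm_integral by linarith
  then show ?thesis by (simp add: m_def divide_le_eq mult.commute)
qed

lemma P_bound: "x \<in> I2pi \<Longrightarrow> norm (P x) \<le> 4 * pi * B"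
proof -
  assume x: "x \<in> I2pi"
  have i: "integrable leb (\<lambda>x. Fp x - m)" using Fp_integrable by simp
  have "norm (P x) \<le> (LINT t|leb. norm (Fp t - m))"
    unfolding P_def using primitive_norm_le[OF i x] by simp
  also have "\<dots> \<le> (LINT t|leb. norm (Fp t) + norm m)"
    using i Fp_integrable by (intro integral_mono_AE AE_leb_I norm_triangle_ineq4) auto
  also have "\<dots> = (LINT t|leb. norm (Fp t)) + 2 * pi * norm m"
    unfolding Bochner_Integration.integral_add[OF integrable_norm[OF Fp_integrable] integrable_leb_const] LINT_const
    by simp
  also have "\<dots> \<le> 2 * pi * B + 2 * pi * B"
    using Fp_norm_integral m_bound by (intro add_mono mult_left_mono) auto
  finally show ?thesis by simp
qed

text \<open>|Fq| = |w|/c, and the mean of |w| is at most 1 + 2.\<close>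

lemma d_bound: "norm d \<le> 3 / c + 4 * pi * B"
proof -
  have "norm (LINT x|leb. Fq x - P x) \<le> (LINT x|leb. (1 / c + 4 * pi * B) + 1 / c * (w x)\<^sup>2)"
  proof (rule LINT_norm_le[OF L2_integrable[OF L2_diff[OF Fq_L2 P_L2]]])
    show "AE x in leb. norm (Fq x - P x) \<le> (1 / c + 4 * pi * B) + 1 / c * (w x)\<^sup>2"
    proof (rule AE_leb_I)
      fix x :: real assume x: "x \<in> I2pi"
      have "norm (Fq x) = 1 / c * \<bar>w x\<bar>"
        unfolding Fq_def using c_pos by (simp add: norm_\<tau>[OF x])
      also have "\<dots> \<le> 1 / c * (1 + (w x)\<^sup>2)"
        using c_pos le_one_plus_square[of "w x"] by (intro mult_left_mono) auto
      finally show "norm (Fq x - P x) \<le> (1 / c + 4 * pi * B) + 1 / c * (w x)\<^sup>2"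
        using P_bound[OF x] norm_triangle_ineq4[of "Fq x" "P x"] by (simp add: distrib_left)
    qed
  qed (intro Bochner_Integration.integrable_add integrable_mult_right sq_integrable integrable_leb_const)
  also have "\<dots> = 2 * pi * (1 / c + 4 * pi * B) + 1 / c * (LINT x|leb. (w x)\<^sup>2)"
    using Bochner_Integration.integral_add[OF integrable_leb_const integrable_mult_right[OF sq_integrable(1), of "1 / c"]]
      LINT_const[of "1 / c + 4 * pi * B"]
    by (simp only: integral_mult_right_zero real_scaleR_def)
  also have "\<dots> \<le> 2 * pi * (1 / c + 4 * pi * B) + 1 / c * (4 * pi)"
    using c_pos by (intro add_mono mult_left_mono w_square order_refl) auto
  also have "\<dots> = (2 * pi) * (3 / c + 4 * pi * B)" by (simp add: algebra_simps)
  finally show ?thesis by (simp add: d_def divide_le_eq mult.commute)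
qed

text \<open>The factor |Jp| = c turns the 3/c from \<open>d_bound\<close> into 3; this is why short
  curves cause no trouble.\<close>

lemma W_bound: "x \<in> I2pi \<Longrightarrow> \<bar>W x\<bar> \<le> 3 + 8 * pi * B * c"
proof -
  assume x: "x \<in> I2pi"
  have "\<bar>W x\<bar> \<le> norm (P x + d) * norm (rot (p x))" unfolding W_def by (rule Cauchy_Schwarz_ineq2)
  also have "\<dots> = norm (P x + d) * c" using speed[OF x] by simp
  also have "\<dots> \<le> (4 * pi * B + (3 / c + 4 * pi * B)) * c"
    using c_pos P_bound[OF x] d_bound norm_triangle_ineq[of "P x" d] by (intro mult_right_mono) auto
  also have "\<dots> = 3 + 8 * pi * B * c" using c_pos by (simp add: field_simps)
  finally show ?thesis .
qed

end

section \<open>The polynomial ODE and its regularity\<close>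

text \<open>Syntax rather than functions: iterated derivatives become expressions that depend on
  \<open>\<delta>\<close> and \<open>lam\<close> alone, so bounds can be read off before any
  solution is given, as the order of quantifiers for the constant demands.\<close>

datatype pexp = Var nat | Const real | Add pexp pexp | Mul pexp pexp

primrec pval :: "(nat \<Rightarrow> real) \<Rightarrow> pexp \<Rightarrow> real" where
  "pval u (Var i) = u i"
| "pval u (Const r) = r"
| "pval u (Add s t) = pval u s + pval u t"
| "pval u (Mul s t) = pval u s * pval u t"

primrec pderivation :: "(nat \<Rightarrow> pexp) \<Rightarrow> pexp \<Rightarrow> pexp" where
  "pderivation X (Var i) = X i"
| "pderivation X (Const r) = Const 0"
| "pderivation X (Add s t) = Add (pderivation X s) (pderivation X t)"
| "pderivation X (Mul s t) = Add (Mul (pderivation X s) t) (Mul s (pderivation X t))"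

primrec pbound :: "real \<Rightarrow> pexp \<Rightarrow> real" where
  "pbound R (Var i) = R"
| "pbound R (Const r) = \<bar>r\<bar>"
| "pbound R (Add s t) = pbound R s + pbound R t"
| "pbound R (Mul s t) = pbound R s * pbound R t"

lemma pval_bound:
  assumes "\<And>i. \<bar>u i\<bar> \<le> R" shows "\<bar>pval u t\<bar> \<le> pbound R t"
proof (induction t)
  case (Add s t)
  then show ?case using abs_triangle_ineq[of "pval u s" "pval u t"] by simp
next
  case (Mul s t)
  then show ?case by (simp add: abs_mult mult_mono')
qed (use assms in simp_all)

text \<open>Along a solution of u_i' = X_i the formal derivation is differentiation in x. The
  hypothesis covers all indices, so the state needs values beyond its eight variables.\<close>

lemma pval_vector_derivative:
  assumes "\<And>i. ((\<lambda>x. u x i) has_vector_derivative pval (u x) (X i)) (at x within S)"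
  shows "((\<lambda>x. pval (u x) t) has_vector_derivative pval (u x) (pderivation X t)) (at x within S)"
proof (induction t)
  case (Mul s t)
  from has_vector_derivative_mult[OF Mul] show ?case by (simp add: add.commute)
qed (use assms in \<open>simp_all add: has_vector_derivative_add\<close>)

definition vec2 :: "real \<Rightarrow> real \<Rightarrow> real^2" where
  "vec2 s t = s *\<^sub>R axis 1 1 + t *\<^sub>R axis 2 1"

lemma vec2_nth [simp]: "vec2 s t $ 1 = s" "vec2 s t $ 2 = t"
  by (simp_all add: vec2_def axis_def)

lemma norm_vec2_le: "norm (vec2 s t) \<le> \<bar>s\<bar> + \<bar>t\<bar>"
  using norm_triangle_ineq[of "s *\<^sub>R axis 1 1" "t *\<^sub>R axis 2 1 :: real^2"] by (simp add: vec2_def)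

lemma vec2_vector_derivative:
  assumes "(f has_vector_derivative f') F" "(g has_vector_derivative g') F"
  shows "((\<lambda>x. vec2 (f x) (g x)) has_vector_derivative vec2 f' g') F"
  unfolding vec2_def
  by (intro has_vector_derivative_add
      bounded_linear.has_vector_derivative[OF bounded_linear_scaleR_left] assms)

lemma component_vector_derivative:
  "((f :: real \<Rightarrow> real^2) has_vector_derivative f') F \<Longrightarrow> ((\<lambda>x. f x $ i) has_vector_derivative f' $ i) F"
  by (rule bounded_linear.has_vector_derivative[OF bounded_linear_vec_nth])

text \<open>All classical derivatives with periodicity and bounds; the smoothness claim and the norm
  estimate both follow from this, for \<gamma> and \<eta> alike.\<close>

locale derivative_tower =
  fixes G :: "nat \<Rightarrow> real \<Rightarrow> real^2" and b :: "nat \<Rightarrow> real"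
  assumes deriv: "\<And>l x. x \<in> I2pi \<Longrightarrow> (G l has_vector_derivative G (Suc l) x) (at x within I2pi)"
    and per: "\<And>l. G l 0 = G l (2 * pi)"
    and bound: "\<And>l x. x \<in> I2pi \<Longrightarrow> norm (G l x) \<le> b l"
begin

lemma G_cont: "continuous_on I2pi (G l)"
  by (rule continuous_on_vector_derivative) (rule deriv)

lemma G_weak: "has_weak_deriv l (G 0) (G l)"
proof (induction l)
  case 0
  show ?case by (rule weak_0[OF continuous_integrable_leb[OF G_cont]])
next
  case (Suc l)
  have "ac (G l) (G (Suc l))" by (rule ac_of_vector_derivative[OF deriv G_cont])
  from weak_Suc[OF Suc ac_weak[OF this]] show ?case .
qed

text \<open>The two claims are proved together: the value at the next order comes from the
  derivative at the current one. Since the functions agree on the interval only, derivatives are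
  transferred within it.\<close>

lemma G_cderiv: "x \<in> I2pi \<Longrightarrow> (cderiv ^^ l) (G 0) x = G l x"
  and G_cderiv_derivative: "x \<in> I2pi \<Longrightarrow> ((cderiv ^^ l) (G 0) has_vector_derivative G (Suc l) x) (at x within I2pi)"
proof (induction l arbitrary: x)
  case 0
  { case 1 show ?case by simp }
  { case 2 then show ?case using deriv[of x 0] by simp }
next
  case (Suc l)
  have *: "(cderiv ^^ Suc l) (G 0) x = G (Suc l) x" if x: "x \<in> I2pi" for x
    using vector_derivative_within_cbox[of 0 "2 * pi" x "(cderiv ^^ l) (G 0)" "G (Suc l) x"] Suc.IH(2)[OF x] x
    by (simp add: cderiv_def)
  { case 1 then show ?case by (rule *) }
  { case 2 then show ?case
      by (rule has_vector_derivative_transform[OF _ _ deriv]) (use * 2 in auto) }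
qed

lemma G_Cinf: "G 0 \<in> Cinf_per"
proof -
  have "(cderiv ^^ l) (G 0) differentiable_on I2pi" for l
    unfolding differentiable_on_def differentiable_def
    using G_cderiv_derivative[of _ l] unfolding has_vector_derivative_def by blast
  moreover have "(cderiv ^^ l) (G 0) 0 = (cderiv ^^ l) (G 0) (2 * pi)" for l
    using G_cderiv[of 0 l] G_cderiv[of "2 * pi" l] per[of l] by simp
  ultimately show ?thesis by (simp add: Cinf_per_def)
qed

lemma G_sobolev: "G 0 \<in> sobolev Linf k"
proof -
  have "G l \<in> Linf" for l
    unfolding Linf_def using continuous_measurable_leb[OF G_cont] bound
    by (auto intro!: exI[of _ "b l"] AE_leb_I)
  then show ?thesis unfolding sobolev_def using G_weak by blast
qed

lemma G_Winf: "Winf_norm k (G 0) \<le> ereal (\<Sum>l\<le>k. b l)"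
proof -
  have "esssup leb (\<lambda>x. ereal (norm (wderiv l (G 0) x))) \<le> ereal (b l)" for l
  proof (rule esssup_I)
    have "continuous_on I2pi (wderiv l (G 0))" by (rule wderiv_props(2)[OF G_weak G_cont])
    from continuous_measurable_leb[OF this]
    show "(\<lambda>x. ereal (norm (wderiv l (G 0) x))) \<in> borel_measurable leb" by measurable
    show "AE x in leb. ereal (norm (wderiv l (G 0) x)) \<le> ereal (b l)"
      by (rule AE_leb_I) (simp add: wderiv_eq[OF G_weak G_cont] bound)
  qed
  then show ?thesis unfolding Winf_norm_def sum_ereal[symmetric] by (rule sum_mono)
qed

end

text \<open>For mean zero, f x is the average of f x - f y over y, and each such difference is at
  most 2 pi B. This bounds \<gamma> and \<eta> themselves.\<close>

lemma norm_le_of_mean_zero: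
  fixes f g :: "real \<Rightarrow> 'a::euclidean_space"
  assumes f: "ac f g" and mean: "(LINT x|leb. f x) = 0" and g: "\<And>x. x \<in> I2pi \<Longrightarrow> norm (g x) \<le> B" and x: "x \<in> I2pi"
  shows "norm (f x) \<le> 2 * pi * B"
proof -
  have gi: "integrable leb (\<lambda>t. norm (g t))" using ac_integrable[OF f] by simp
  have osc: "norm (f y - f z) \<le> 2 * pi * B" if "z \<in> I2pi" "y \<in> I2pi" "z \<le> y" for y z
  proof -
    have "norm (f y - f z) \<le> integral {z..y} (\<lambda>t. norm (g t))" using that by (intro ac_norm_diff[OF f]) auto
    also have "\<dots> \<le> integral {z..y} (\<lambda>t. B)"
      using that g by (intro integral_le integrable_sub_hk[OF gi] integrable_const_ivl) auto
    also have "\<dots> = (y - z) * B" using that by simp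
    also have "\<dots> \<le> 2 * pi * B"
      using that order_trans[OF norm_ge_zero g[OF x]] by (intro mult_right_mono) auto
    finally show ?thesis .
  qed
  have osc': "norm (f x - f y) \<le> 2 * pi * B" if y: "y \<in> I2pi" for y
    using osc[OF x y] osc[OF y x] by (cases "x \<le> y") (auto simp: norm_minus_commute)
  note fi = continuous_integrable_leb[OF ac_continuous[OF f]]
  have "(2 * pi) *\<^sub>R f x = (LINT y|leb. f x - f y)"
    unfolding Bochner_Integration.integral_diff[OF integrable_leb_const fi] LINT_const mean by simp
  also have "norm \<dots> \<le> (LINT y|leb. 2 * pi * B)"
    using fi by (intro LINT_norm_le AE_leb_I osc' integrable_leb_const Bochner_Integration.integrable_diff)
  also have "\<dots> = 2 * pi * (2 * pi * B)" by (simp only: LINT_const real_scaleR_def)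
  finally have "2 * pi * norm (f x) \<le> 2 * pi * (2 * pi * B)" by simp
  then show ?thesis by (rule mult_left_le_imp_le) simp
qed

text \<open>
  The variables \<open>0, \<dots>, 7\<close> stand for \<open>\<tau>\<^sub>1\<close>, \<open>\<tau>\<^sub>2\<close>, \<open>w\<close>, \<open>c\<close>, \<open>a\<^sub>1\<close>, \<open>a\<^sub>2\<close>, \<open>m\<^sub>1\<close>, \<open>m\<^sub>2\<close>.
\<close>

definition kappa_exp :: "real \<Rightarrow> real \<Rightarrow> pexp" where
  "kappa_exp \<delta> lam = Add (Mul (Const ((lam + \<delta>\<^sup>2) / lam)) (Var 2))
     (Mul (Const (- \<delta> / lam)) (Add (Mul (Var 4) (Var 0)) (Mul (Var 5) (Var 1))))"

text \<open>The system of \<open>\<tau>_deriv\<close> and \<open>W_deriv\<close> in coordinates. The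
  parameters are carried as variables with zero derivative, so that they too are covered by the
  uniform bound.\<close>

definition field_exp :: "real \<Rightarrow> real \<Rightarrow> nat \<Rightarrow> pexp" where
  "field_exp \<delta> lam i =
     (if i = 0 then Mul (Const (-1)) (Mul (Var 3) (Mul (kappa_exp \<delta> lam) (Var 1)))
      else if i = 1 then Mul (Var 3) (Mul (kappa_exp \<delta> lam) (Var 0))
      else if i = 2 then Mul (Var 3) (Add
        (Mul (Const (\<delta> / lam)) (Mul (Var 2) (Add (Mul (Var 5) (Var 0)) (Mul (Const (-1)) (Mul (Var 4) (Var 1))))))
        (Mul (Const (-1)) (Add (Mul (Var 7) (Var 0)) (Mul (Const (-1)) (Mul (Var 6) (Var 1))))))
      else Const 0)"

definition gamma_exp :: "nat \<Rightarrow> pexp" where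
  "gamma_exp i = Mul (Var 3) (Var i)"

definition eta_exp :: "real \<Rightarrow> real \<Rightarrow> nat \<Rightarrow> pexp" where
  "eta_exp \<delta> lam i = Mul (Const (1 / lam)) (Mul (Var 3) (Add (Var (4 + i)) (Mul (Const (- \<delta>)) (Mul (Var 2) (Var i)))))"

text \<open>The separate bounds for \<tau>, c, a, m and W, with c replaced by h; they are added so
  that one number dominates every variable.\<close>

definition state_bound :: "real \<Rightarrow> real \<Rightarrow> real \<Rightarrow> real" where
  "state_bound \<delta> lam h = 1 + h + (3 * \<bar>\<delta>\<bar> + lam + 2) + (5 + 2 * \<bar>\<delta>\<bar> * (1 + 1 / lam))
     + (3 + 8 * pi * (5 + 2 * \<bar>\<delta>\<bar> * (1 + 1 / lam)) * h)"

definition exp_bound :: "real \<Rightarrow> real \<Rightarrow> real \<Rightarrow> (nat \<Rightarrow> pexp) \<Rightarrow> nat \<Rightarrow> real" where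
  "exp_bound \<delta> lam h f l = pbound (state_bound \<delta> lam h) ((pderivation (field_exp \<delta> lam) ^^ l) (f 0))
     + pbound (state_bound \<delta> lam h) ((pderivation (field_exp \<delta> lam) ^^ l) (f 1))"

text \<open>Shifted by one: \<open>f\<close> describes the first derivative of the function, so
  order l + 1 uses l derivations. Order 0 is not polynomial in the state and gets 2 pi times the
  bound of order 1.\<close>

definition tower_bound :: "real \<Rightarrow> real \<Rightarrow> real \<Rightarrow> (nat \<Rightarrow> pexp) \<Rightarrow> nat \<Rightarrow> real" where
  "tower_bound \<delta> lam h f l = (case l of 0 \<Rightarrow> 2 * pi * exp_bound \<delta> lam h f 0 | Suc l \<Rightarrow> exp_bound \<delta> lam h f l)"

context critical_curve
begin

text \<open>The default 0 beyond index 7 makes bound and differential equation hold for every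
  index.\<close>

definition state :: "real \<Rightarrow> nat \<Rightarrow> real" where
  "state x i = (if i = 0 then \<tau> x $ 1 else if i = 1 then \<tau> x $ 2 else if i = 2 then W x
     else if i = 3 then c else if i = 4 then a $ 1 else if i = 5 then a $ 2
     else if i = 6 then m $ 1 else if i = 7 then m $ 2 else 0)"

lemma state_simps [simp]:
  "state x 0 = \<tau> x $ 1" "state x (Suc 0) = \<tau> x $ 2" "state x 2 = W x" "state x 3 = c" "state x 4 = a $ 1" "state x 5 = a $ 2"
  "state x 6 = m $ 1" "state x 7 = m $ 2"
  by (simp_all add: state_def)

lemma pval_kappa: "pval (state x) (kappa_exp \<delta> lam) = \<kappa> x"
  using lam_pos by (simp add: kappa_exp_def \<kappa>_def inner2 field_simps)

lemma state_derivative: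
  assumes x: "x \<in> I2pi"
  shows "((\<lambda>x. state x i) has_vector_derivative pval (state x) (field_exp \<delta> lam i)) (at x within I2pi)"
proof -
  consider "i = 0" | "i = 1" | "i = 2" | "i > 2" by linarith
  then show ?thesis
  proof cases
    case 1
    then show ?thesis
      using component_vector_derivative[OF \<tau>_deriv[OF x], of 1]
      by (simp add: field_exp_def pval_kappa mult.assoc)
  next
    case 2
    then show ?thesis
      using component_vector_derivative[OF \<tau>_deriv[OF x], of 2]
      by (simp add: field_exp_def pval_kappa mult.assoc)
  next
    case 3
    then show ?thesis
      using W_deriv[OF x] by (simp add: field_exp_def inner2 algebra_simps)
  next
    case 4
    then have "(\<lambda>x. state x i) = (\<lambda>x. state 0 i)" by (auto simp: state_def)
    then show ?thesis
      using 4 has_vector_derivative_const[of "state 0 i" "at x within I2pi"] by (simp add: field_exp_def)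
  qed
qed

lemma state_bound:
  assumes x: "x \<in> I2pi" and h: "c \<le> h"
  shows "\<bar>state x i\<bar> \<le> state_bound \<delta> lam h"
proof -
  define A where "A = 3 * \<bar>\<delta>\<bar> + lam + 2"
  have R: "state_bound \<delta> lam h = 1 + h + A + B + (3 + 8 * pi * B * h)"
    by (simp add: state_bound_def A_def B_def)
  have A0: "A \<ge> 0" using lam_pos by (simp add: A_def)
  have h0: "h \<ge> 0" using h c_pos by simp
  have WB: "\<bar>W x\<bar> \<le> 3 + 8 * pi * B * h"
  proof -
    have "8 * pi * B * c \<le> 8 * pi * B * h" using h B_pos by (intro mult_left_mono) auto
    then show ?thesis using W_bound[OF x] by linarith
  qed
  have Bh: "0 \<le> 8 * pi * B * h" using B_pos h0 by simp
  define S where "S = state_bound \<delta> lam h"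
  note pos = A0 h0 Bh B_pos R[folded S_def]
  have "\<bar>\<tau> x $ j\<bar> \<le> S" for j using component_le_norm_cart[of "\<tau> x" j] norm_\<tau>[OF x] pos by linarith
  moreover have "\<bar>a $ j\<bar> \<le> S" for j
    using component_le_norm_cart[of a j] a_bound[folded A_def] pos by linarith
  moreover have "\<bar>m $ j\<bar> \<le> S" for j using component_le_norm_cart[of m j] m_bound pos by linarith
  moreover have "\<bar>W x\<bar> \<le> S" "\<bar>c\<bar> \<le> S" "0 \<le> S" using WB h c_pos pos by linarith+
  ultimately show ?thesis
    unfolding S_def[symmetric] by (simp add: state_def)
qed

definition exp_tower :: "(real \<Rightarrow> real^2) \<Rightarrow> (nat \<Rightarrow> pexp) \<Rightarrow> nat \<Rightarrow> real \<Rightarrow> real^2" where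
  "exp_tower f g l = (case l of 0 \<Rightarrow> f | Suc l \<Rightarrow>
     (\<lambda>x. vec2 (pval (state x) ((pderivation (field_exp \<delta> lam) ^^ l) (g 0)))
               (pval (state x) ((pderivation (field_exp \<delta> lam) ^^ l) (g 1)))))"

lemma exp_tower_simps:
  "exp_tower f g 0 = f"
  "exp_tower f g (Suc l) = (\<lambda>x. vec2 (pval (state x) ((pderivation (field_exp \<delta> lam) ^^ l) (g 0)))
               (pval (state x) ((pderivation (field_exp \<delta> lam) ^^ l) (g 1))))"
  by (simp_all add: exp_tower_def)

lemma exp_tower:
  assumes f: "\<And>x. x \<in> I2pi \<Longrightarrow> (f has_vector_derivative vec2 (pval (state x) (g 0)) (pval (state x) (g 1))) (at x within I2pi)"
    and per: "f 0 = f (2 * pi)" and mean: "(LINT x|leb. f x) = 0" and h: "c \<le> h"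
  shows "derivative_tower (exp_tower f g) (tower_bound \<delta> lam h g)"
proof -
  have deriv: "(exp_tower f g l has_vector_derivative exp_tower f g (Suc l) x) (at x within I2pi)" if x: "x \<in> I2pi" for l x
  proof (cases l)
    case 0
    then show ?thesis using f[OF x] by (simp add: exp_tower_simps)
  next
    case (Suc n)
    show ?thesis
      unfolding Suc exp_tower_simps funpow.simps o_apply
      by (intro vec2_vector_derivative pval_vector_derivative state_derivative x)
  qed
  have bound1: "norm (exp_tower f g (Suc l) x) \<le> tower_bound \<delta> lam h g (Suc l)" if x: "x \<in> I2pi" for l x
    unfolding exp_tower_simps tower_bound_def exp_bound_def nat.case
    by (rule order_trans[OF norm_vec2_le add_mono[OF pval_bound pval_bound]]) (rule state_bound[OF x h])+
  show ?thesis
  proof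
    fix l
    show "exp_tower f g l 0 = exp_tower f g l (2 * pi)"
    proof (cases l)
      case 0
      then show ?thesis using per by (simp add: exp_tower_simps)
    next
      case (Suc n)
      \<comment> \<open>Periodicity of all higher derivatives at once, since they are functions of
        the state.\<close>
      have "state 0 = state (2 * pi)" using \<tau>_per W_per by (auto simp: state_def)
      then show ?thesis by (simp add: Suc exp_tower_simps)
    qed
  next
    fix l and x :: real
    assume x: "x \<in> I2pi"
    show "(exp_tower f g l has_vector_derivative exp_tower f g (Suc l) x) (at x within I2pi)" by (rule deriv[OF x])
    show "norm (exp_tower f g l x) \<le> tower_bound \<delta> lam h g l"
    proof (cases l)
      case 0
      have "continuous_on I2pi (exp_tower f g (Suc 0))"
        by (rule continuous_on_vector_derivative) (rule deriv)
      then have "ac f (exp_tower f g (Suc 0))"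
        using deriv[of _ 0] by (intro ac_of_vector_derivative) (simp_all add: exp_tower_simps(1))
      from norm_le_of_mean_zero[OF this mean bound1 x] show ?thesis
        by (simp add: 0 exp_tower_simps(1) tower_bound_def)
    next
      case (Suc n)
      then show ?thesis using bound1[OF x] by simp
    qed
  qed
qed

lemma gamma_exp_derivative:
  "x \<in> I2pi \<Longrightarrow> (\<gamma> has_vector_derivative vec2 (pval (state x) (gamma_exp 0)) (pval (state x) (gamma_exp 1))) (at x within I2pi)"
proof -
  have "vec2 (pval (state x) (gamma_exp 0)) (pval (state x) (gamma_exp 1)) = c *\<^sub>R \<tau> x"
    by (simp add: vec2_eq_iff gamma_exp_def)
  then show "x \<in> I2pi \<Longrightarrow> ?thesis" using \<gamma>_deriv by simp
qed

lemma eta_exp_derivative: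
  "x \<in> I2pi \<Longrightarrow> (\<eta> has_vector_derivative vec2 (pval (state x) (eta_exp \<delta> lam 0)) (pval (state x) (eta_exp \<delta> lam 1))) (at x within I2pi)"
proof -
  have "vec2 (pval (state x) (eta_exp \<delta> lam 0)) (pval (state x) (eta_exp \<delta> lam 1)) = (c / lam) *\<^sub>R (a - (\<delta> * W x) *\<^sub>R \<tau> x)"
    by (simp add: vec2_eq_iff eta_exp_def)
  then show "x \<in> I2pi \<Longrightarrow> ?thesis" using \<eta>_deriv by simp
qed

end

text \<open>The l = 1 term of the squared norm equals 2 pi c^2, and 2 pi is at least 1.\<close>

lemma speed_le_Hnorm:
  fixes f :: "real \<Rightarrow> 'a::euclidean_space"
  assumes "\<And>x. x \<in> I2pi \<Longrightarrow> norm (wderiv 1 f x) = c" "0 \<le> c"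
  shows "c \<le> Hnorm 2 f"
proof -
  have "(LINT x|leb. (norm (wderiv 1 f x))\<^sup>2) = (LINT x|leb. c\<^sup>2)"
    by (rule Bochner_Integration.integral_cong) (use assms in auto)
  also have "\<dots> = 2 * pi * c\<^sup>2" by (simp only: LINT_const real_scaleR_def)
  finally have "c\<^sup>2 \<le> (LINT x|leb. (norm (wderiv 1 f x))\<^sup>2)"
    using pi_gt3 mult_right_mono[of 1 "2 * pi" "c\<^sup>2"] by simp
  also have "\<dots> \<le> (\<Sum>l\<le>2. LINT x|leb. (norm (wderiv l f x))\<^sup>2)"
    by (rule member_le_sum) auto
  finally show ?thesis
    unfolding Hnorm_def using assms(2) by (simp add: real_le_rsqrt)
qed

theorem theorem4p1:
  fixes \<delta> lam :: real
  assumes "lam > 0"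
  shows "\<exists>C :: nat \<Rightarrow> real \<Rightarrow> real \<Rightarrow> real. \<forall>\<gamma> \<eta> :: real \<Rightarrow> real^2.
    \<gamma> \<in> Himm2 \<longrightarrow>
    (\<forall>x\<in>I2pi. norm (wderiv 1 \<gamma> x) = curve_length \<gamma> / (2 * pi)) \<longrightarrow>
    \<eta> \<in> Hper 1 \<longrightarrow>
    (LINT x|leb. \<gamma> x) = 0 \<longrightarrow>
    (LINT x|leb. \<eta> x) = 0 \<longrightarrow>
    critical_point_LM \<delta> lam \<gamma> \<eta> \<longrightarrow>
      \<gamma> \<in> Cinf_per \<and> \<eta> \<in> Cinf_per \<and>
      (\<forall>k\<ge>1. \<gamma> \<in> sobolev Linf (k + 2) \<and> \<eta> \<in> sobolev Linf (k + 1) \<and>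
        Winf_norm (k + 2) \<gamma> + Winf_norm (k + 1) \<eta>
          \<le> ereal (C k (Hnorm 2 \<gamma>) (Hnorm 1 \<eta>)))"
proof (intro exI[of _ "\<lambda>k h _. (\<Sum>l\<le>k + 2. tower_bound \<delta> lam h gamma_exp l)
    + (\<Sum>l\<le>k + 1. tower_bound \<delta> lam h (eta_exp \<delta> lam) l)"] allI impI)
  fix \<gamma> \<eta> :: "real \<Rightarrow> real^2"
  assume \<gamma>: "\<gamma> \<in> Himm2" and speed: "\<forall>x\<in>I2pi. norm (wderiv 1 \<gamma> x) = curve_length \<gamma> / (2 * pi)"
    and \<eta>: "\<eta> \<in> Hper 1" and mean: "(LINT x|leb. \<gamma> x) = 0" "(LINT x|leb. \<eta> x) = 0"
    and crit: "critical_point_LM \<delta> lam \<gamma> \<eta>"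
  define c where "c = curve_length \<gamma> / (2 * pi)"
  have \<gamma>2: "\<gamma> \<in> Hper 2" and imm: "\<And>x. x \<in> I2pi \<Longrightarrow> wderiv 1 \<gamma> x \<noteq> 0"
    using \<gamma> unfolding Himm2_def by auto
  have sp: "norm (wderiv 1 \<gamma> x) = c" if "x \<in> I2pi" for x using speed that by (simp add: c_def)
  \<comment> \<open>The immersion condition at the single point 0 gives positive speed
    everywhere.\<close>
  have "c > 0" using sp[of 0] imm[of 0] by (metis atLeastAtMost_iff order_refl pi_ge_zero zero_less_norm_iff zero_le_mult_iff zero_le_numeral)
  interpret critical_curve \<delta> lam c \<gamma> \<eta> "wderiv 1 \<gamma>" "wderiv 2 \<gamma>" "wderiv 1 \<eta>"
    by unfold_locales
      (use assms \<open>c > 0\<close> sp crit Hper2_D[OF \<gamma>2] Hper1_D[OF \<eta>] in \<open>simp_all add: critical_point_LM_def\<close>)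
  \<comment> \<open>The tower bounds hold with any \<open>h\<close> above \<open>c\<close>, so the
    norm may take the place of the speed.\<close>
  have h: "c \<le> Hnorm 2 \<gamma>" by (rule speed_le_Hnorm[OF sp]) (use \<open>c > 0\<close> in auto)
  interpret G: derivative_tower "exp_tower \<gamma> gamma_exp" "tower_bound \<delta> lam (Hnorm 2 \<gamma>) gamma_exp"
    by (rule exp_tower[OF gamma_exp_derivative \<gamma>_per mean(1) h])
  interpret N: derivative_tower "exp_tower \<eta> (eta_exp \<delta> lam)" "tower_bound \<delta> lam (Hnorm 2 \<gamma>) (eta_exp \<delta> lam)"
    by (rule exp_tower[OF eta_exp_derivative Hper1_D(3)[OF \<eta>] mean(2) h])
  have "Winf_norm (k + 2) \<gamma> + Winf_norm (k + 1) \<eta> \<le>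
      ereal ((\<Sum>l\<le>k + 2. tower_bound \<delta> lam (Hnorm 2 \<gamma>) gamma_exp l)
        + (\<Sum>l\<le>k + 1. tower_bound \<delta> lam (Hnorm 2 \<gamma>) (eta_exp \<delta> lam) l))" for k
    using add_mono[OF G.G_Winf[of "k + 2"] N.G_Winf[of "k + 1"]] by (simp only: exp_tower_simps plus_ereal.simps)
  then show "\<gamma> \<in> Cinf_per \<and> \<eta> \<in> Cinf_per \<and>
      (\<forall>k\<ge>1. \<gamma> \<in> sobolev Linf (k + 2) \<and> \<eta> \<in> sobolev Linf (k + 1) \<and>
        Winf_norm (k + 2) \<gamma> + Winf_norm (k + 1) \<eta>
          \<le> ereal ((\<Sum>l\<le>k + 2. tower_bound \<delta> lam (Hnorm 2 \<gamma>) gamma_exp l)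
            + (\<Sum>l\<le>k + 1. tower_bound \<delta> lam (Hnorm 2 \<gamma>) (eta_exp \<delta> lam) l)))"
    using G.G_Cinf N.G_Cinf G.G_sobolev N.G_sobolev by (simp only: exp_tower_simps) blast
qed

end
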